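(* Fix $\varepsilon\in(0,1/3)$, $\alpha>0$, a dimension $d\ge 2$ and constants $\gamma,\kappa>0$ with $\varepsilon/(1-\varepsilon)<\gamma\kappa\le 1/2$. Let $\beta=\alpha/(\alpha-1)$ if $\alpha>1$ and $\beta=\infty$ if $0<\alpha\le 1$. Let $\mathcal{A}$ be the class of all $\alpha$-symmetric distributions $P\in\mathcal{P}(\mathbb{R}^d)$ with $P(\{\boldsymbol 0\})=0$ whose first marginal distribution function $F(t)=\mathbb{P}(X_1\le t)$, $\boldsymbol X=(X_1,\dots,X_d)^{\mathsf T}\sim P$, satisfies $$\inf_{0<|t|<\gamma}\frac{|F(t)-F(0)|}{|t|}\ge\kappa .$$ Then for any $\delta\in(0,1/2)$ there exists an absolute constant $C>0$ such that $$\inf_{P\in\mathcal{A},\,Q\in\mathcal{P}(\mathbb{R}^d)}\mathbb{P}\left(\left\|\widehat{\boldsymbol\mu}^{\mathrm{hs}}_n-\boldsymbol\mu^{\mathrm{hs}}\right\|_\beta\le C\left(\varepsilon+\sqrt{\frac dn}+\sqrt{\frac{\log(1/\delta)}{n}}\right)\right)\ge 1-2\delta$$ for all $n\in\mathbb{N}$ such that $$C_1\sqrt{\frac dn}+C_2\sqrt{\frac{\log(1/\delta)}{n}}<\gamma\kappa-\frac{\varepsilon}{1-\varepsilon},$$ where $C_1=24\sqrt{60\pi e/(1-e^{-1})}$ and $C_2=(9\sqrt2+4\sqrt6)/4$. Here $\boldsymbol\mu^{\mathrm{hs}}=\boldsymbol\mu^{\mathrm{hs}}(P)$ is the halfspace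 median of $P$, and $\widehat{\boldsymbol\mu}^{\mathrm{hs}}_n$ is the sample halfspace median of a random sample $\boldsymbol X_1,\dots,\boldsymbol X_n$ drawn from $(1-\varepsilon)P+\varepsilon Q$.
   Context: $\mathcal{P}(\mathbb{R}^d)$ is the set of Borel probability distributions on $\mathbb{R}^d$ and $\mathbb{S}^{d-1}$ is the Euclidean unit sphere of $\mathbb{R}^d$. For $0<\alpha<\infty$, $\|\boldsymbol x\|_\alpha=(\sum_{i=1}^d|x_i|^\alpha)^{1/\alpha}$, and $\|\boldsymbol x\|_\infty=\max_i|x_i|$ (called a norm also for $\alpha<1$). A distribution $P\in\mathcal{P}(\mathbb{R}^d)$ of $\boldsymbol X$ is $\alpha$-symmetric if its characteristic function has the form $\mathbb{E}\exp(i\langle\boldsymbol t,\boldsymbol X\rangle)=\phi(\|\boldsymbol t\|_\alpha)$ for all $\boldsymbol t\in\mathbb{R}^d$, with $\phi$ a continuous function on $\mathbb{R}$; equivalently $\langle\boldsymbol X,\boldsymbol u\rangle$ has the same distribution as $\|\boldsymbol u\|_\alpha X_1$ for all $\boldsymbol u\in\mathbb{S}^{d-1}$. Halfspace depth: $\mathcal{D}(\boldsymbol x;P)=\inf_{\boldsymbol u\in\mathbb{S}^{d-1}}\mathbb{P}(\langle\boldsymbol X,\boldsymbol u\rangle\le\langle\boldsymbol x,\boldsymbol u\rangle)$, $\boldsymbol X\sim P$. The halfspace median $\boldsymbol\mu^{\mathrm{hs}}(P)$ is the barycenter of the non-empty compact convex set of maximizers of $\mathcal{D}(\cdot;P)$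 over $\mathbb{R}^d$, where the barycenter of a non-empty compact convex set is the expectation of a random vector uniformly distributed on it. The sample halfspace median of $\boldsymbol X_1,\dots,\boldsymbol X_n$ is $\boldsymbol\mu^{\mathrm{hs}}(\widehat P_n)$, where $\widehat P_n$ is the empirical distribution assigning mass $1/n$ to each $\boldsymbol X_i$. $(1-\varepsilon)P+\varepsilon Q$ is the mixture $B\mapsto(1-\varepsilon)P(B)+\varepsilon Q(B)$. An "absolute constant" is a constant that does not depend on the sample size $n$, the dimension $d$, the contamination amount $\varepsilon$, or the confidence parameter $\delta$. *)

theory Defs
  imports "HOL-Probability.Probability"
begin

text \<open>
  The dimension is a natural number bound inside the statement, so \<open>\<real>\<^sup>d\<close> is the space of the product
  \<open>\<sigma>\<close>-algebra over the index set \<open>{..<d}\<close>. Its points are functions \<open>nat \<Rightarrow> real\<close> that take the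
  dummy value \<open>undefined\<close> outside \<open>{..<d}\<close>; only coordinates below \<open>d\<close> are ever inspected.
  Coordinates are numbered from \<open>0\<close>.
\<close>

type_synonym point = "nat \<Rightarrow> real"

definition Rd :: "nat \<Rightarrow> point measure" where
  "Rd d = (\<Pi>\<^sub>M i\<in>{..<d}. borel)"

definition distributions :: "nat \<Rightarrow> point measure set" where
  "distributions d = {P. prob_space P \<and> sets P = sets (Rd d)}"

definition ip :: "nat \<Rightarrow> point \<Rightarrow> point \<Rightarrow> real" where
  "ip d x y = (\<Sum>i<d. x i * y i)"

definition unit_sphere :: "nat \<Rightarrow> point set" where
  "unit_sphere d = {u \<in> space (Rd d). L2_set u {..<d} = 1}"

text \<open>
  The exponent ranges over \<open>(0, \<infinity>]\<close>. As \<open>0 powr a = 0\<close>, vanishing coordinates contribute nothing.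
\<close>

definition lp_norm :: "nat \<Rightarrow> ereal \<Rightarrow> point \<Rightarrow> real" where
  "lp_norm d p x =
     (if p = \<infinity> then Max ((\<lambda>i. \<bar>x i\<bar>) ` {..<d})
      else (\<Sum>i<d. \<bar>x i\<bar> powr real_of_ereal p) powr (1 / real_of_ereal p))"

definition conj_exponent :: "real \<Rightarrow> ereal" where
  "conj_exponent \<alpha> = (if \<alpha> > 1 then ereal (\<alpha> / (\<alpha> - 1)) else \<infinity>)"

definition alpha_symmetric :: "nat \<Rightarrow> real \<Rightarrow> point measure \<Rightarrow> bool" where
  "alpha_symmetric d \<alpha> P \<longleftrightarrow>
     (\<exists>\<phi> :: real \<Rightarrow> complex. continuous_on UNIV \<phi> \<and>
        (\<forall>t\<in>space (Rd d). (CLINT x|P. iexp (ip d t x)) = \<phi> (lp_norm d (ereal \<alpha>) t)))"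

definition first_marginal_cdf :: "point measure \<Rightarrow> real \<Rightarrow> real" where
  "first_marginal_cdf P = cdf (distr P borel (\<lambda>x. x 0))"

definition symmetric_class :: "nat \<Rightarrow> real \<Rightarrow> real \<Rightarrow> real \<Rightarrow> point measure set" where
  "symmetric_class d \<alpha> \<gamma> \<kappa> =
     {P \<in> distributions d.
        alpha_symmetric d \<alpha> P \<and>
        measure P {\<lambda>i\<in>{..<d}. 0} = 0 \<and>
        (INF t\<in>{t. 0 < \<bar>t\<bar> \<and> \<bar>t\<bar> < \<gamma>}.
           \<bar>first_marginal_cdf P t - first_marginal_cdf P 0\<bar> / \<bar>t\<bar>) \<ge> \<kappa>}"

definition mixture :: "real \<Rightarrow> 'a measure \<Rightarrow> 'a measure \<Rightarrow> 'a measure" where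
  "mixture \<epsilon> P Q =
     measure_of (space P) (sets P)
       (\<lambda>B. ennreal (1 - \<epsilon>) * emeasure P B + ennreal \<epsilon> * emeasure Q B)"

lemma sets_mixture [simp]: "sets (mixture \<epsilon> P Q) = sets P"
  by (simp add: mixture_def)

lemma space_mixture [simp]: "space (mixture \<epsilon> P Q) = space P"
  by (simp add: mixture_def space_measure_of_conv)

lemma emeasure_mixture:
  assumes "sets Q = sets P" "B \<in> sets P"
  shows "emeasure (mixture \<epsilon> P Q) B = ennreal (1 - \<epsilon>) * emeasure P B + ennreal \<epsilon> * emeasure Q B"
proof (rule emeasure_measure_of[OF mixture_def])
  show "countably_additive (sets (mixture \<epsilon> P Q))
      (\<lambda>B. ennreal (1 - \<epsilon>) * emeasure P B + ennreal \<epsilon> * emeasure Q B)"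
  proof (rule countably_additiveI)
    fix A :: "nat \<Rightarrow> 'a set"
    assume A: "range A \<subseteq> sets (mixture \<epsilon> P Q)" "disjoint_family A"
    then have "range A \<subseteq> sets P" "range A \<subseteq> sets Q"
      by (auto simp: assms(1))
    then show "(\<Sum>i. ennreal (1 - \<epsilon>) * emeasure P (A i) + ennreal \<epsilon> * emeasure Q (A i))
        = ennreal (1 - \<epsilon>) * emeasure P (\<Union> (range A)) + ennreal \<epsilon> * emeasure Q (\<Union> (range A))"
      using A(2) by (simp add: suminf_add[symmetric] suminf_emeasure)
  qed
qed (use assms sets.space_closed in \<open>auto simp: mixture_def positive_def\<close>)

lemma mixture_in_distributions:
  assumes "P \<in> distributions d" "Q \<in> distributions d" "0 \<le> \<epsilon>" "\<epsilon> \<le> 1"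
  shows "mixture \<epsilon> P Q \<in> distributions d"
proof -
  have eq: "sets Q = sets P"
    using assms by (simp add: distributions_def)
  have sp: "space Q = space P"
    by (rule sets_eq_imp_space_eq[OF eq])
  have "emeasure P (space P) = 1" "emeasure Q (space P) = 1"
    using assms prob_space.emeasure_space_1[of P] prob_space.emeasure_space_1[of Q]
    by (simp_all add: distributions_def sp)
  then have "emeasure (mixture \<epsilon> P Q) (space P) = 1"
    using assms(3,4) by (simp add: emeasure_mixture[OF eq] flip: ennreal_plus)
  then show ?thesis
    using assms by (auto simp: distributions_def intro!: prob_spaceI)
qed

definition hdepth :: "nat \<Rightarrow> point measure \<Rightarrow> point \<Rightarrow> real" where
  "hdepth d P x = (INF u\<in>unit_sphere d. measure P {y \<in> space P. ip d y u \<le> ip d x u})"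

definition median_set :: "nat \<Rightarrow> point measure \<Rightarrow> point set" where
  "median_set d P =
     {x \<in> space (Rd d). \<forall>y\<in>space (Rd d). hdepth d P y \<le> hdepth d P x}"

text \<open>
  The set of maximizers may be lower-dimensional. The uniform distribution on a set \<open>K\<close> is taken with
  respect to Lebesgue measure on the smallest flat containing \<open>K\<close>, that is, on its affine hull: this
  flat is parametrized isometrically by \<open>\<real>\<^sup>k\<close>, with base point \<open>a\<close> and orthonormal directions
  \<open>b 0, \<dots>, b (k - 1)\<close>, and the normalized \<open>k\<close>-dimensional Lebesgue measure on the preimage of \<open>K\<close> is
  pushed forward. Lebesgue measure being invariant under isometries, the result does not depend on
  the chosen \<open>a\<close> and \<open>b\<close>. For \<open>k = 0\<close> the measure on \<open>\<real>\<^sup>0\<close> is a unit mass, so a singleton \<open>K\<close>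
  carries a Dirac measure.
\<close>

definition flat_param :: "nat \<Rightarrow> nat \<Rightarrow> point \<Rightarrow> (nat \<Rightarrow> point) \<Rightarrow> point \<Rightarrow> point" where
  "flat_param d k a b c = (\<lambda>i\<in>{..<d}. a i + (\<Sum>j<k. c j * b j i))"

definition in_flat :: "nat \<Rightarrow> point set \<Rightarrow> nat \<Rightarrow> point \<Rightarrow> (nat \<Rightarrow> point) \<Rightarrow> bool" where
  "in_flat d K k a b \<longleftrightarrow>
     (\<forall>i<k. \<forall>j<k. ip d (b i) (b j) = (if i = j then 1 else 0)) \<and>
     K \<subseteq> flat_param d k a b ` space (Rd k)"

definition flat_dim :: "nat \<Rightarrow> point set \<Rightarrow> nat" where
  "flat_dim d K = (LEAST k. \<exists>a b. in_flat d K k a b)"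

definition uniform_dist :: "nat \<Rightarrow> point set \<Rightarrow> point measure" where
  "uniform_dist d K =
     (let k = flat_dim d K;
          (a, b) = (SOME (a, b). in_flat d K k a b);
          L = (\<Pi>\<^sub>M i\<in>{..<k}. lborel)
      in distr (uniform_measure L (flat_param d k a b -` K \<inter> space L)) (Rd d) (flat_param d k a b))"

definition barycenter :: "nat \<Rightarrow> point set \<Rightarrow> point" where
  "barycenter d K = (\<lambda>i\<in>{..<d}. LINT x|uniform_dist d K. x i)"

definition halfspace_median :: "nat \<Rightarrow> point measure \<Rightarrow> point" where
  "halfspace_median d P = barycenter d (median_set d P)"

definition empirical :: "nat \<Rightarrow> nat \<Rightarrow> (nat \<Rightarrow> point) \<Rightarrow> point measure" where
  "empirical d n X = distr (uniform_count_measure {..<n}) (Rd d) X"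

text \<open>The joint law of \<open>n\<close> independent draws \<open>X 0, \<dots>, X (n - 1)\<close> from \<open>P\<close>.\<close>

definition sample_law :: "nat \<Rightarrow> point measure \<Rightarrow> (nat \<Rightarrow> point) measure" where
  "sample_law n P = (\<Pi>\<^sub>M i\<in>{..<n}. P)"

definition C1 :: real where
  "C1 = 24 * sqrt (60 * pi * exp 1 / (1 - exp (-1)))"

definition C2 :: real where
  "C2 = (9 * sqrt 2 + 4 * sqrt 6) / 4"

end

theory Submission
  imports Defs
begin

text \<open>
  For an \<open>\<alpha>\<close>-symmetric \<open>P\<close> the projection of \<open>P\<close> on \<open>u\<close> is the first marginal scaled by \<open>\<parallel>u\<parallel>\<^sub>\<alpha>\<close>,
  because the two have the same characteristic function (\<open>proj_eq_scaled\<close>). Hence every halfspace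
  has probability \<open>F (t / \<parallel>u\<parallel>\<^sub>\<alpha>)\<close>. All hyperplanes through the origin have the same mass. This
  mass is \<open>0\<close>, since there are infinitely many of them of which a nonzero point lies on at most
  \<open>d\<close>. So \<open>F 0 = 1/2\<close> (\<open>no_atom\<close>, \<open>F_zero\<close>), and the growth of \<open>F\<close> near \<open>0\<close> makes the origin the
  only median.

  Now let all empirical halfspace frequencies be within \<open>\<Delta>\<close> of their probabilities under the
  contaminated distribution. The origin then has empirical depth at least \<open>(1 - \<epsilon>)/2 - \<Delta>\<close>, so
  every deepest point \<open>x\<close> has at least this depth too. Translated back to \<open>P\<close>, every halfspace
  with \<open>x\<close> on its boundary has probability at least \<open>1/2 - \<tau>\<close> with \<open>\<tau> = (\<epsilon> + 2\<Delta>)/(1 - \<epsilon>)\<close>, and as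
  \<open>\<tau> < \<gamma>\<kappa>\<close> the growth condition turns this into \<open>\<langle>x, u\<rangle> \<ge> - (\<tau>/\<kappa>) \<parallel>u\<parallel>\<^sub>\<alpha>\<close> for all \<open>u\<close>. These
  inequalities are linear in \<open>x\<close>, so the barycenter of the deepest points inherits them
  (\<open>barycenter_halfspace\<close>). For the direction \<open>u\<close> in which Hoelder's inequality is sharp
  (\<open>dual_direction\<close>) the left side is minus the product of the two norms, and the dual norm of the
  sample median is at most \<open>\<tau>/\<kappa>\<close> (\<open>median_error_on_deviation_event\<close>).

  The deviation bound (\<open>uniform_halfspace_deviation\<close>) holds with probability at least \<open>1 - 2\<delta>\<close> for
  \<open>\<Delta> = 20 \<surd>((d + 1)/n) + \<surd>(2 ln(1/\<delta>)/n)\<close>. The supremum of the deviations changes by at most \<open>1/n\<close>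
  when one sample point is replaced, so it concentrates at its mean (\<open>bounded_differences_tail\<close>).
  The mean is bounded by symmetrization and chaining: halfspaces shatter at most \<open>d + 1\<close> points by
  Radon's theorem, and families of bounded VC dimension have small separated subfamilies
  (\<open>ln_packing_le\<close>). Chaining is what makes the first term \<open>\<surd>(d/n)\<close> without a logarithm. The
  constants \<open>C1\<close> and \<open>C2\<close> are large enough for the assumption on \<open>n\<close> to give \<open>\<tau> < \<gamma>\<kappa>\<close>.

  A probability is attached to the set of samples with a small error, so this set has to be
  measurable, although the barycenter depends on the sample through the affine hull of the set of
  deepest points, whose dimension varies. It is a limit of centroids of the closed parallel bodies
  (\<open>barycenter_parallel_limit\<close>), which are full-dimensional and depend measurably on the sample
  because membership in them is a countable condition (\<open>nbhd_level_set_iff\<close>). The limit is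
  computed in coordinates in which the directions orthogonal to the affine hull are rescaled by
  the radius; it needs that the body has positive volume in its affine hull
  (\<open>flat_preimage_positive_volume\<close>).
\<close>

section \<open>Shattered sets and separated families\<close>

definition shatters :: "'a set set \<Rightarrow> 'a set \<Rightarrow> bool" where
  "shatters F S \<longleftrightarrow> (\<forall>T\<subseteq>S. \<exists>A\<in>F. A \<inter> S = T)"

text \<open>
  Pajor's form of the Sauer--Shelah lemma. Split the family by membership of \<open>x\<close> and delete \<open>x\<close>. A
  set shattered by the union of the two halves is shattered by the family, and a set shattered by
  their intersection remains shattered after \<open>x\<close> is added to it.
\<close>

lemma shatters_finite_card_le:
  assumes "finite X" "F \<subseteq> Pow X"
  shows "card F \<le> card {S\<in>Pow X. shatters F S}"
  using assms
proof (induction X arbitrary: F rule: finite_induct)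
  case empty
  show ?case
  proof (cases "F = {}")
    case False
    then have "F = {{}}" using empty by auto
    then have "{S\<in>Pow {}. shatters F S} = {{}}" by (auto simp: shatters_def)
    with \<open>F = {{}}\<close> show ?thesis by simp
  qed simp
next
  case (insert x X)
  define F0 where "F0 = {A\<in>F. x \<notin> A}"
  define F1 where "F1 = {A\<in>F. x \<in> A}"
  define G where "G = (\<lambda>A. A - {x}) ` F1"
  have fin: "finite F" using insert by (meson finite_Pow_iff finite_insert finite_subset)
  have finG: "finite F0" "finite G" using fin by (auto simp: F0_def G_def F1_def)
  have sub: "F0 \<subseteq> Pow X" "G \<subseteq> Pow X" using insert.prems by (auto simp: F0_def G_def F1_def)
  have "card F = card F0 + card F1"
    using fin by (subst card_Un_disjoint[symmetric]) (auto simp: F0_def F1_def intro: arg_cong[where f=card])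
  also have "card F1 = card G"
    unfolding G_def by (rule card_image[symmetric]) (auto simp: inj_on_def F1_def)
  also have "card F0 + card G = card (F0 \<union> G) + card (F0 \<inter> G)"
    using finG by (rule card_Un_Int)
  also have "\<dots> \<le> card {S\<in>Pow X. shatters (F0 \<union> G) S} + card {S\<in>Pow X. shatters (F0 \<inter> G) S}"
    using sub by (intro add_mono insert.IH) auto
  also have "card {S\<in>Pow X. shatters (F0 \<inter> G) S} = card (Set.insert x ` {S\<in>Pow X. shatters (F0 \<inter> G) S})"
    using insert.hyps by (intro card_image[symmetric]) (auto simp: inj_on_def)
  also have "card {S\<in>Pow X. shatters (F0 \<union> G) S} + \<dots>
      = card ({S\<in>Pow X. shatters (F0 \<union> G) S} \<union> Set.insert x ` {S\<in>Pow X. shatters (F0 \<inter> G) S})"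
    using insert.hyps by (intro card_Un_disjoint[symmetric]) auto
  also have "\<dots> \<le> card {S\<in>Pow (Set.insert x X). shatters F S}"
  proof (rule card_mono)
    show "finite {S\<in>Pow (Set.insert x X). shatters F S}" using insert.hyps by simp
    have 1: "shatters F S" if S: "S \<subseteq> X" "shatters (F0 \<union> G) S" for S
      unfolding shatters_def
    proof (intro allI impI)
      fix T assume "T \<subseteq> S"
      then obtain A where A: "A \<in> F0 \<union> G" "A \<inter> S = T" using S(2) unfolding shatters_def by blast
      have "x \<notin> S" using S insert.hyps by auto
      from A(1) show "\<exists>A\<in>F. A \<inter> S = T"
      proof
        assume "A \<in> F0" then show ?thesis using A(2) by (auto simp: F0_def)
      next
        assume "A \<in> G"
        then obtain B where "B \<in> F" "A = B - {x}" by (auto simp: G_def F1_def)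
        then show ?thesis using A(2) \<open>x \<notin> S\<close> by (intro bexI[of _ B]) auto
      qed
    qed
    have 2: "shatters F (Set.insert x S)" if S: "S \<subseteq> X" "shatters (F0 \<inter> G) S" for S
      unfolding shatters_def
    proof (intro allI impI)
      fix T assume T: "T \<subseteq> Set.insert x S"
      then have "T - {x} \<subseteq> S" by auto
      then obtain A where A: "A \<in> F0" "A \<in> G" "A \<inter> S = T - {x}"
        using S(2) unfolding shatters_def by blast
      obtain B where B: "B \<in> F" "x \<in> B" "A = B - {x}" using A(2) by (auto simp: G_def F1_def)
      have "x \<notin> A" "A \<in> F" using A(1) by (auto simp: F0_def)
      have "x \<notin> S" using S insert.hyps by auto
      show "\<exists>A\<in>F. A \<inter> Set.insert x S = T"
      proof (cases "x \<in> T")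
        case True
        have "B \<inter> Set.insert x S = T" using A(3) B True \<open>x \<notin> S\<close> by auto
        with B(1) show ?thesis by blast
      next
        case False
        have "A \<inter> Set.insert x S = T" using A(3) False \<open>x \<notin> A\<close> by auto
        with \<open>A \<in> F\<close> show ?thesis by blast
      qed
    qed
    show "{S\<in>Pow X. shatters (F0 \<union> G) S} \<union> Set.insert x ` {S\<in>Pow X. shatters (F0 \<inter> G) S}
        \<subseteq> {S\<in>Pow (Set.insert x X). shatters F S}"
      using 1 2 by auto
  qed
  finally show ?case .
qed

text \<open>
  Weighting the \<open>i\<close>-th term by \<open>(m/V)^(V - i) \<ge> 1\<close> turns the partial sum into part of a full
  binomial expansion.
\<close>

lemma sum_binomial_le:
  assumes "1 \<le> V" "V \<le> m"
  shows "real (\<Sum>i\<le>V. m choose i) \<le> (exp 1 * real m / real V) ^ V"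
proof -
  have pos: "real m > 0" "real V > 0" and q: "real m / real V \<ge> 1" using assms by auto
  have "real (\<Sum>i\<le>V. m choose i) = (\<Sum>i\<le>V. real (m choose i) * 1)" by simp
  also have "\<dots> \<le> (\<Sum>i\<le>V. real (m choose i) * ((real m / real V) ^ V * (real V / real m) ^ i))"
  proof (intro sum_mono mult_left_mono)
    fix i assume "i \<in> {..V}"
    then have "(real m / real V) ^ V * (real V / real m) ^ i = (real m / real V) ^ (V - i)"
      using pos by (simp add: power_diff power_divide)
    also have "\<dots> \<ge> 1" using q by (rule one_le_power)
    finally show "1 \<le> (real m / real V) ^ V * (real V / real m) ^ i" .
  qed simp
  also have "\<dots> \<le> (\<Sum>i\<le>m. real (m choose i) * ((real m / real V) ^ V * (real V / real m) ^ i))"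
    using assms by (intro sum_mono2) auto
  also have "\<dots> = (real m / real V) ^ V * (1 + real V / real m) ^ m"
    by (subst add.commute, subst binomial_ring) (simp add: sum_distrib_left mult_ac)
  also have "\<dots> \<le> (real m / real V) ^ V * exp (real V)"
  proof (intro mult_left_mono)
    have "(1 + real V / real m) ^ m \<le> exp (real V / real m) ^ m"
      by (intro power_mono) (auto simp: exp_ge_add_one_self)
    also have "\<dots> = exp (real V)" using pos by (simp flip: exp_of_nat_mult)
    finally show "(1 + real V / real m) ^ m \<le> exp (real V)" .
  qed simp
  also have "\<dots> = (exp 1 * real m / real V) ^ V"
    by (simp add: power_divide power_mult_distrib flip: exp_of_nat_mult)
  finally show ?thesis .
qed

lemma sauer_shelah:
  assumes "finite X" "F \<subseteq> Pow X" and V: "\<And>S. shatters F S \<Longrightarrow> S \<subseteq> X \<Longrightarrow> card S \<le> V"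
  shows "card F \<le> (\<Sum>i\<le>V. card X choose i)"
proof -
  have "card F \<le> card {S\<in>Pow X. shatters F S}" by (rule shatters_finite_card_le) fact+
  also have "\<dots> \<le> card (\<Union>i\<le>V. {S. S \<subseteq> X \<and> card S = i})"
    using V assms(1) by (intro card_mono) auto
  also have "\<dots> \<le> (\<Sum>i\<le>V. card {S. S \<subseteq> X \<and> card S = i})" by (rule card_UN_le) simp
  also have "\<dots> = (\<Sum>i\<le>V. card X choose i)" using n_subsets[OF assms(1)] by simp
  finally show ?thesis .
qed

text \<open>
  The probabilistic method: of \<open>m\<close> points drawn from \<open>U\<close> with replacement, none lies in the
  symmetric difference of a given pair with probability at most \<open>(1 - p)^m \<le> exp (- p m)\<close>, and
  there are at most \<open>card F ^ 2\<close> pairs. So some draw distinguishes all members of \<open>F\<close>.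
\<close>

lemma exists_separating_sample:
  fixes p :: real
  assumes U: "finite U" "U \<noteq> {}" and F: "F \<subseteq> Pow U" and p: "0 \<le> p" "p \<le> 1"
    and sep: "\<And>A B. A \<in> F \<Longrightarrow> B \<in> F \<Longrightarrow> A \<noteq> B \<Longrightarrow> p * card U < card (sym_diff A B)"
    and m: "real (card F) ^ 2 * exp (- p * real m) < 1"
  shows "\<exists>T\<subseteq>U. card T \<le> m \<and> inj_on (\<lambda>A. A \<inter> T) F"
proof -
  define n where "n = card U"
  have n: "n > 0" using U by (simp add: n_def card_gt_0_iff)
  have finF: "finite F" using F U by (meson finite_Pow_iff finite_subset)
  (* the draws that miss the symmetric difference of the pair *)
  define bad where "bad = (\<lambda>(A, B). {..<m} \<rightarrow>\<^sub>E (U - sym_diff A B))"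
  have cb: "real (card (bad P)) \<le> real n ^ m * exp (- p * real m)"
    if in_P: "P \<in> {(A, B)\<in>F \<times> F. A \<noteq> B}" for P
  proof -
    obtain A B where P: "P = (A, B)" "A \<in> F" "B \<in> F" "A \<noteq> B"
      using in_P by (cases P) auto
    have sub: "sym_diff A B \<subseteq> U" using P F by auto
    then have "finite (sym_diff A B)" using U finite_subset by blast
    then have "real (card (U - sym_diff A B)) = real n - real (card (sym_diff A B))"
      using sub U by (simp add: card_Diff_subset n_def card_mono of_nat_diff)
    also have "\<dots> \<le> real n * (1 - p)" using sep[OF P(2-4)] by (simp add: n_def algebra_simps)
    also have "\<dots> \<le> real n * exp (- p)" using exp_ge_add_one_self[of "-p"] by (intro mult_left_mono) auto
    finally have *: "real (card (U - sym_diff A B)) \<le> real n * exp (- p)" .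
    have "real (card (bad P)) = real (card (U - sym_diff A B)) ^ m"
      by (simp add: bad_def P card_PiE)
    also have "\<dots> \<le> (real n * exp (- p)) ^ m" using * by (intro power_mono) auto
    also have "\<dots> = real n ^ m * exp (- p * real m)"
      by (simp add: power_mult_distrib mult.commute flip: exp_of_nat_mult)
    finally show ?thesis .
  qed
  let ?P = "{(A, B)\<in>F \<times> F. A \<noteq> B}"
  have finP: "finite ?P" by (rule finite_subset[of _ "F \<times> F"]) (use finF in auto)
  have cP: "card ?P \<le> card F * card F"
    using card_mono[of "F \<times> F" ?P] finF by (auto simp: card_cartesian_product)
  have "real (card (\<Union>P\<in>?P. bad P)) \<le> (\<Sum>P\<in>?P. real (card (bad P)))"
    using card_UN_le[OF finP, of bad] by (metis (mono_tags) of_nat_le_iff of_nat_sum)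
  also have "\<dots> \<le> real (card ?P) * (real n ^ m * exp (- p * real m))"
    by (rule sum_bounded_above) (use cb in auto)
  also have "\<dots> \<le> (real (card F) ^ 2) * (real n ^ m * exp (- p * real m))"
    using cP by (intro mult_right_mono) (auto simp: power2_eq_square simp flip: of_nat_mult)
  also have "\<dots> = (real (card F) ^ 2 * exp (- p * real m)) * real n ^ m" by simp
  also have "\<dots> < 1 * real n ^ m" using m n by (intro mult_strict_right_mono) auto
  also have "\<dots> = real (card ({..<m} \<rightarrow>\<^sub>E U))" by (simp add: card_PiE n_def)
  finally have "card (\<Union>P\<in>?P. bad P) < card ({..<m} \<rightarrow>\<^sub>E U)" by simp
  then have "\<not> ({..<m} \<rightarrow>\<^sub>E U) \<subseteq> (\<Union>P\<in>?P. bad P)"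
  proof (rule contrapos_pn)
    have "finite (bad P)" if "P \<in> ?P" for P
      using U by (auto simp: bad_def split: prod.split intro!: finite_PiE)
    moreover assume "({..<m} \<rightarrow>\<^sub>E U) \<subseteq> (\<Union>P\<in>?P. bad P)"
    ultimately have "card ({..<m} \<rightarrow>\<^sub>E U) \<le> card (\<Union>P\<in>?P. bad P)"
      using finP by (intro card_mono) blast+
    then show "\<not> card (\<Union>P\<in>?P. bad P) < card ({..<m} \<rightarrow>\<^sub>E U)" by simp
  qed
  then obtain s where s: "s \<in> {..<m} \<rightarrow>\<^sub>E U" "\<And>P. P \<in> ?P \<Longrightarrow> s \<notin> bad P" by blast
  show ?thesis
  proof (intro exI[of _ "s ` {..<m}"] conjI)
    show "s ` {..<m} \<subseteq> U" using s(1) by auto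
    show "card (s ` {..<m}) \<le> m" using card_image_le[of "{..<m}" s] by simp
    show "inj_on (\<lambda>A. A \<inter> s ` {..<m}) F"
    proof (rule inj_onI, rule ccontr)
      fix A B assume AB: "A \<in> F" "B \<in> F" "A \<inter> s ` {..<m} = B \<inter> s ` {..<m}" "A \<noteq> B"
      then have "s \<notin> bad (A, B)" using s(2)[of "(A, B)"] by auto
      moreover have "s \<in> bad (A, B)"
        unfolding bad_def prod.case
      proof (rule PiE_I)
        fix l assume l: "l \<in> {..<m}"
        then have "s l \<in> U" using s(1) by auto
        moreover have "s l \<in> A \<longleftrightarrow> s l \<in> B" using AB(3) l by blast
        ultimately show "s l \<in> U - sym_diff A B" by auto
      next
        fix l assume "l \<notin> {..<m}" then show "s l = undefined" using s(1) by auto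
      qed
      ultimately show False by simp
    qed
  qed
qed

text \<open>
  The packing numbers of a VC family are polynomial in \<open>1/p\<close>, uniformly in the size of the ground
  set. About \<open>2 ln (card F) / p\<close> sample points distinguish all members of \<open>F\<close>, and by
  Sauer--Shelah they have few traces on the sample. The resulting inequality bounds
  \<open>ln (card F) / V\<close> by the logarithm of a multiple of itself.
\<close>

lemma ln_packing_le:
  fixes p :: real
  assumes U: "finite U" "U \<noteq> {}" and F: "F \<subseteq> Pow U" "F \<noteq> {}" and p: "0 < p" "p \<le> 1" and V1: "1 \<le> V"
    and sep: "\<And>A B. A \<in> F \<Longrightarrow> B \<in> F \<Longrightarrow> A \<noteq> B \<Longrightarrow> p * card U < card (sym_diff A B)"
    and V: "\<And>S. shatters F S \<Longrightarrow> S \<subseteq> U \<Longrightarrow> card S \<le> V"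
  shows "ln (card F) \<le> 2 * real V * ln (6 / p)"
proof -
  have finF: "finite F" using F U by (meson finite_Pow_iff finite_subset)
  have cF: "card F \<ge> 1" using F(2) finF by (simp add: Suc_leI card_gt_0_iff)
  define z where "z = ln (card F) / V"
  have z0: "z \<ge> 0" using cF by (simp add: z_def)
  have Vpos: "real V > 0" using V1 by simp
  have lnF: "ln (card F) = V * z" using Vpos by (simp add: z_def)
  have ln14: "ln (6 / p) \<ge> 1"
  proof -
    have "exp 1 * p \<le> 3 * 1" using exp_le p by (intro mult_mono) auto
    then have "exp 1 \<le> 6 / p" using p by (simp add: field_simps)
    then show ?thesis using p by (subst ln_ge_iff) auto
  qed
  have "z \<le> 2 * ln (6 / p)"
  proof (cases "z < 1")
    case True then show ?thesis using ln14 by simp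
  next
    case False
    then have z1: "z \<ge> 1" by simp
    (* just more than 2 ln (card F) / p draws make the union bound less than 1 *)
    define m where "m = nat \<lfloor>2 * (V * z) / p\<rfloor> + 1"
    have Vz: "V * z \<ge> 0" using z0 by simp
    have mgt: "2 * (V * z) / p < real m"
      unfolding m_def using Vz p by (simp add: of_nat_nat) linarith
    have mle: "real m \<le> 2 * (V * z) / p + 1"
      unfolding m_def using Vz p by (simp add: of_nat_nat)
    have "real (card F) = exp (V * z)" using cF lnF by (metis exp_ln of_nat_0_less_iff less_le_trans zero_less_one)
    then have "real (card F) ^ 2 * exp (- p * real m) = exp (2 * (V * z) - p * real m)"
      by (simp add: exp_diff exp_minus exp_double divide_inverse)
    also have "\<dots> < 1" using mgt p by (simp add: field_simps)
    finally have "\<exists>T\<subseteq>U. card T \<le> m \<and> inj_on (\<lambda>A. A \<inter> T) F"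
      using sep p by (intro exists_separating_sample[OF U F(1)]) auto
    then obtain T where T: "T \<subseteq> U" "card T \<le> m" "inj_on (\<lambda>A. A \<inter> T) F" by blast
    have finT: "finite T" using T U finite_subset by blast
    have "card F = card ((\<lambda>A. A \<inter> T) ` F)" using T(3) by (simp add: card_image)
    also have "\<dots> \<le> (\<Sum>i\<le>V. card T choose i)"
    proof (rule sauer_shelah[OF finT])
      show "(\<lambda>A. A \<inter> T) ` F \<subseteq> Pow T" by auto
    next
      fix S assume S: "shatters ((\<lambda>A. A \<inter> T) ` F) S" "S \<subseteq> T"
      have "shatters F S"
        unfolding shatters_def
      proof (intro allI impI)
        fix R assume "R \<subseteq> S"
        then obtain A where "A \<in> F" "A \<inter> T \<inter> S = R" using S(1) unfolding shatters_def by blast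
        then show "\<exists>A\<in>F. A \<inter> S = R" using S(2) by (intro bexI[of _ A]) auto
      qed
      then show "card S \<le> V" using V S T by blast
    qed
    also have "\<dots> \<le> (\<Sum>i\<le>V. m choose i)" using T(2) by (intro sum_mono binomial_right_mono) auto
    finally have "real (card F) \<le> real (\<Sum>i\<le>V. m choose i)" by (simp only: of_nat_le_iff)
    also have Vm: "V \<le> m"
    proof -
      have "real V * p \<le> V * (2 * z)" using z1 p by (intro mult_left_mono) auto
      then have "real V \<le> 2 * (V * z) / p" using p by (simp add: field_simps)
      with mgt show ?thesis by linarith
    qed
    have "real (\<Sum>i\<le>V. m choose i) \<le> (exp 1 * real m / real V) ^ V"
      by (rule sum_binomial_le[OF V1 Vm])
    finally have le: "real (card F) \<le> (exp 1 * real m / real V) ^ V" .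
    have mpos: "real m > 0" using Vm Vpos by linarith
    have "V * z \<le> V * ln (exp 1 * real m / real V)"
      unfolding lnF[symmetric] using le cF mpos Vpos by (simp add: ln_realpow[symmetric])
    then have "z \<le> ln (exp 1 * real m / real V)" using Vpos by simp
    also have "\<dots> \<le> ln (exp 1 * (3 * z / p))"
    proof -
      have "real m / V \<le> (2 * (V * z) / p + 1) / V"
        using mle by (intro divide_right_mono) auto
      also have "\<dots> = 2 * z / p + 1 / V" using Vpos by (simp add: add_divide_distrib)
      also have "\<dots> \<le> 2 * z / p + 1" using V1 by simp
      also have "\<dots> \<le> 3 * z / p" using z1 p by (simp add: field_simps)
      finally have "real m / V \<le> 3 * z / p" .
      then have "exp 1 * (real m / V) \<le> exp 1 * (3 * z / p)" by (intro mult_left_mono) auto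
      then show ?thesis using mpos Vpos by (intro ln_mono) auto
    qed
    (* splitting off z / 2 lets ln (z/2) <= z/2 - 1 absorb half of z *)
    also have "\<dots> = ln (6 * exp 1 / p) + ln (z / 2)"
      using p z1 by (subst ln_mult_pos[symmetric]) (auto simp: field_simps)
    also have "\<dots> \<le> ln (6 * exp 1 / p) + (z / 2 - 1)"
      using z1 ln_le_minus_one[of "z/2"] by simp
    also have "ln (6 * exp 1 / p) = ln (6 / p) + 1"
      using p by (simp add: ln_mult_pos ln_div)
    finally have "z \<le> 2 * ln (6 / p)" by simp
    then show ?thesis .
  qed
  then have "V * z \<le> V * (2 * ln (6 / p))" using Vpos by (intro mult_left_mono) auto
  then show ?thesis using lnF by (simp add: mult_ac)
qed

lemma shatters_mono: "shatters F S \<Longrightarrow> F \<subseteq> G \<Longrightarrow> shatters G S"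
  unfolding shatters_def by (meson subsetD)

section \<open>Rademacher averages of VC families\<close>

definition signs :: "'a set \<Rightarrow> ('a \<Rightarrow> real) set" where
  "signs I = (I \<rightarrow>\<^sub>E {-1, 1})"

text \<open>
  The expectation over independent uniform signs, written as a finite average.
\<close>

definition sign_avg :: "'a set \<Rightarrow> (('a \<Rightarrow> real) \<Rightarrow> real) \<Rightarrow> real" where
  "sign_avg I h = (\<Sum>s\<in>signs I. h s) / 2 ^ card I"

lemma finite_signs [simp]: "finite I \<Longrightarrow> finite (signs I)"
  by (auto simp: signs_def intro: finite_PiE)

lemma card_signs: "finite I \<Longrightarrow> card (signs I) = 2 ^ card I"
  by (simp add: signs_def card_PiE numeral_2_eq_2)

lemma sign_avg_mono:
  "(\<And>s. s \<in> signs I \<Longrightarrow> h s \<le> g s) \<Longrightarrow> sign_avg I h \<le> sign_avg I g"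
  unfolding sign_avg_def by (intro divide_right_mono sum_mono) auto

lemma sign_avg_add: "sign_avg I (\<lambda>s. h s + g s) = sign_avg I h + sign_avg I g"
  by (simp add: sign_avg_def sum.distrib add_divide_distrib)

lemma sign_avg_cmult: "sign_avg I (\<lambda>s. c * h s) = c * sign_avg I h"
  by (simp add: sign_avg_def sum_distrib_left)

lemma sign_avg_const: "finite I \<Longrightarrow> sign_avg I (\<lambda>_. c) = c"
  by (simp add: sign_avg_def card_signs)

lemma sign_avg_sum: "sign_avg I (\<lambda>s. \<Sum>t\<in>T. h t s) = (\<Sum>t\<in>T. sign_avg I (h t))"
  unfolding sign_avg_def by (subst sum.swap) (simp add: sum_divide_distrib)

lemma sign_avg_uminus:
  assumes "finite I" "\<And>s s'. (\<And>i. i \<in> I \<Longrightarrow> s i = s' i) \<Longrightarrow> h s = h s'"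
  shows "sign_avg I (\<lambda>s. h (\<lambda>i. - s i)) = sign_avg I h"
proof -
  have "(\<Sum>s\<in>signs I. h (\<lambda>i. - s i)) = (\<Sum>s\<in>signs I. h s)"
    by (rule sum.reindex_bij_witness[where i = "\<lambda>s. \<lambda>i\<in>I. - s i" and j = "\<lambda>s. \<lambda>i\<in>I. - s i"])
       (auto simp: signs_def fun_eq_iff PiE_iff extensional_def intro!: assms(2) split: if_splits)
  then show ?thesis by (simp add: sign_avg_def)
qed

text \<open>
  Two integrations: \<open>sinh y \<le> y cosh y\<close> holds by comparing derivatives, so \<open>y\<^sup>2/2 - ln (cosh y)\<close>
  is nondecreasing on the positive half-line.
\<close>

lemma cosh_le_exp_square: "cosh (x::real) \<le> exp (x\<^sup>2 / 2)"
proof -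
  have pos: "cosh x \<le> exp (x\<^sup>2 / 2)" if x: "x \<ge> 0" for x :: real
  proof -
    define g where "g y = y\<^sup>2 / 2 - ln (cosh y)" for y :: real
    have "g 0 \<le> g x"
    proof (rule DERIV_nonneg_imp_nondecreasing[OF x])
      fix y :: real assume y: "0 \<le> y" "y \<le> x"
      have "(g has_real_derivative (y - sinh y / cosh y)) (at y)"
        unfolding g_def by (auto intro!: derivative_eq_intros simp: cosh_real_pos)
      moreover have "sinh y / cosh y \<le> y"
      proof -
        define k where "k t = t * cosh t - sinh t" for t :: real
        have "k 0 \<le> k y"
        proof (rule DERIV_nonneg_imp_nondecreasing[OF y(1)])
          fix t :: real assume "0 \<le> t"
          have "(k has_real_derivative (t * sinh t)) (at t)"
            unfolding k_def by (auto intro!: derivative_eq_intros)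
          moreover have "0 \<le> t * sinh t" using \<open>0 \<le> t\<close> by simp
          ultimately show "\<exists>d. (k has_real_derivative d) (at t) \<and> 0 \<le> d" by blast
        qed
        then show ?thesis by (simp add: k_def field_simps cosh_real_pos)
      qed
      ultimately show "\<exists>d. (g has_real_derivative d) (at y) \<and> 0 \<le> d" by force
    qed
    then have "ln (cosh x) \<le> x\<^sup>2 / 2" by (simp add: g_def)
    then have "exp (ln (cosh x)) \<le> exp (x\<^sup>2 / 2)" by (simp only: exp_le_cancel_iff)
    then show ?thesis by (simp add: cosh_real_pos)
  qed
  show ?thesis
  proof (cases "x \<ge> 0")
    case False
    then show ?thesis using pos[of "-x"] by simp
  qed (rule pos)
qed

lemma sign_avg_exp_le:
  assumes I: "finite I"
  shows "sign_avg I (\<lambda>s. exp (l * (\<Sum>i\<in>I. s i * a i))) \<le> exp (l\<^sup>2 * (\<Sum>i\<in>I. (a i)\<^sup>2) / 2)"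
proof -
  have "(\<Sum>s\<in>signs I. exp (l * (\<Sum>i\<in>I. s i * a i))) = (\<Sum>s\<in>signs I. \<Prod>i\<in>I. exp (l * (s i * a i)))"
    using I by (simp add: exp_sum sum_distrib_left)
  also have "\<dots> = (\<Prod>i\<in>I. \<Sum>y\<in>{-1, 1}. exp (l * (y * a i)))"
    unfolding signs_def using I by (subst prod_sum_PiE) auto
  also have "\<dots> = (\<Prod>i\<in>I. 2 * cosh (l * a i))"
    by (intro prod.cong) (auto simp: cosh_def)
  also have "\<dots> \<le> (\<Prod>i\<in>I. 2 * exp ((l * a i)\<^sup>2 / 2))"
    by (intro prod_mono conjI mult_left_mono cosh_le_exp_square) auto
  also have "\<dots> = 2 ^ card I * exp (\<Sum>i\<in>I. (l * a i)\<^sup>2 / 2)"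
    using I by (simp add: prod.distrib exp_sum)
  also have "(\<Sum>i\<in>I. (l * a i)\<^sup>2 / 2) = l\<^sup>2 * (\<Sum>i\<in>I. (a i)\<^sup>2) / 2"
    by (simp add: power_mult_distrib sum_distrib_left sum_divide_distrib)
  finally show ?thesis by (simp add: sign_avg_def field_simps)
qed

text \<open>
  Each linear form in the signs is sub-Gaussian, so a maximum over \<open>card T\<close> of them is of order
  \<open>\<surd>(r ln (card T))\<close>. A bound \<open>L > 0\<close> on the logarithm is used because a singleton has logarithm
  \<open>0\<close>.
\<close>

lemma massart_finite_class:
  fixes a :: "'t \<Rightarrow> 'a \<Rightarrow> real"
  assumes I: "finite I" and T: "finite T" "T \<noteq> {}"
    and r: "r > 0" "\<And>t. t \<in> T \<Longrightarrow> (\<Sum>i\<in>I. (a t i)\<^sup>2) \<le> r"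
    and L: "L > 0" "ln (card T) \<le> L"
  shows "sign_avg I (\<lambda>s. Max ((\<lambda>t. \<Sum>i\<in>I. s i * a t i) ` T)) \<le> sqrt (2 * r * L)"
proof -
  define Z where "Z s t = (\<Sum>i\<in>I. s i * a t i)" for s t
  (* balances L / l against l r / 2 *)
  define l where "l = sqrt (2 * L / r)"
  define c where "c = card T * exp (l\<^sup>2 * r / 2)"
  have l: "l > 0" using L r by (simp add: l_def)
  have cT: "card T > 0" using T by (simp add: card_gt_0_iff)
  have c: "c > 0" using cT by (simp add: c_def)
  (* The tangent of ln at c, instead of Jensen: it makes the bound linear in the exponential sum,
     so that it can be averaged term by term. Choosing c as the bound for the averaged sum loses
     nothing. *)
  have pt: "Max (Z s ` T) \<le> (ln c - 1) / l + inverse (c * l) * (\<Sum>t\<in>T. exp (l * Z s t))" for s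
  proof -
    have "Max (Z s ` T) \<in> Z s ` T" using T by (intro Max_in) auto
    then obtain t where t: "t \<in> T" "Max (Z s ` T) = Z s t" by blast
    have "l * Z s t = ln c + ln (exp (l * Z s t) / c)" using c by (simp add: ln_div)
    also have "\<dots> \<le> ln c + (exp (l * Z s t) / c - 1)" using c by (intro add_left_mono ln_le_minus_one) auto
    also have "\<dots> \<le> ln c + ((\<Sum>t\<in>T. exp (l * Z s t)) / c - 1)"
      using c t T by (intro add_left_mono diff_right_mono divide_right_mono member_le_sum) auto
    finally have "Z s t * l \<le> ln c - 1 + (\<Sum>t\<in>T. exp (l * Z s t)) / c" by (simp add: mult.commute)
    then have "Z s t \<le> (ln c - 1 + (\<Sum>t\<in>T. exp (l * Z s t)) / c) / l"
      using l by (simp add: pos_le_divide_eq)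
    also have "\<dots> = (ln c - 1) / l + inverse (c * l) * (\<Sum>t\<in>T. exp (l * Z s t))"
      using l c by (simp add: field_simps)
    finally show ?thesis using t by simp
  qed
  have "sign_avg I (\<lambda>s. Max (Z s ` T))
      \<le> sign_avg I (\<lambda>s. (ln c - 1) / l + inverse (c * l) * (\<Sum>t\<in>T. exp (l * Z s t)))"
    by (intro sign_avg_mono pt)
  also have "\<dots> = (ln c - 1) / l + inverse (c * l) * (\<Sum>t\<in>T. sign_avg I (\<lambda>s. exp (l * Z s t)))"
    using I by (simp only: sign_avg_add sign_avg_const sign_avg_cmult sign_avg_sum)
  also have "(\<Sum>t\<in>T. sign_avg I (\<lambda>s. exp (l * Z s t))) \<le> (\<Sum>t\<in>T. exp (l\<^sup>2 * r / 2))"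
  proof (rule sum_mono)
    fix t assume t: "t \<in> T"
    have "sign_avg I (\<lambda>s. exp (l * Z s t)) \<le> exp (l\<^sup>2 * (\<Sum>i\<in>I. (a t i)\<^sup>2) / 2)"
      unfolding Z_def by (rule sign_avg_exp_le[OF I])
    also have "\<dots> \<le> exp (l\<^sup>2 * r / 2)" using r(2)[OF t] by (simp add: mult_left_mono)
    finally show "sign_avg I (\<lambda>s. exp (l * Z s t)) \<le> exp (l\<^sup>2 * r / 2)" .
  qed
  also have "(\<Sum>t\<in>T. exp (l\<^sup>2 * r / 2)) = c" by (simp add: c_def)
  also have "(ln c - 1) / l + inverse (c * l) * c = ln c / l" using c l by (simp add: field_simps)
  also have "ln c = ln (card T) + l\<^sup>2 * r / 2" using cT by (simp add: c_def ln_mult_pos)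
  also have "\<dots> \<le> L + L" using L r by (simp add: l_def)
  also have "(L + L) / l = sqrt (2 * r * L)"
  proof -
    have "sqrt (2 * r * L) * l = sqrt ((2 * r * L) * (2 * L / r))" by (simp only: l_def real_sqrt_mult)
    also have "(2 * r * L) * (2 * L / r) = (L + L)\<^sup>2" using r by (simp add: power2_eq_square)
    also have "sqrt ((L + L)\<^sup>2) = L + L" using L by (simp only: real_sqrt_abs)
    finally show ?thesis using l by (simp add: field_simps)
  qed
  finally show ?thesis using l c by (simp add: Z_def divide_right_mono)
qed

text \<open>
  A maximal separated subfamily is a net.
\<close>

lemma exists_separated_net:
  fixes r :: real
  assumes "finite F"
  obtains S where "S \<subseteq> F" "\<And>A B. A \<in> S \<Longrightarrow> B \<in> S \<Longrightarrow> A \<noteq> B \<Longrightarrow> r < card (sym_diff A B)"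
    "\<And>A. A \<in> F \<Longrightarrow> A \<notin> S \<Longrightarrow> \<exists>B\<in>S. card (sym_diff A B) \<le> r"
proof -
  define P where "P S \<longleftrightarrow> S \<subseteq> F \<and> (\<forall>A\<in>S. \<forall>B\<in>S. A \<noteq> B \<longrightarrow> r < card (sym_diff A B))" for S
  have "P {}" by (simp add: P_def)
  moreover have "\<forall>S. P S \<longrightarrow> card S < Suc (card F)"
    using assms by (auto simp: P_def card_mono less_Suc_eq_le)
  ultimately obtain S where S: "P S" "\<And>S'. P S' \<Longrightarrow> card S' \<le> card S"
    using ex_has_greatest_nat[of P "{}" card "Suc (card F)"] by blast
  have fS: "finite S" using S(1) assms finite_subset by (auto simp: P_def)
  show ?thesis
  proof (rule that)
    show "S \<subseteq> F" using S(1) by (simp add: P_def)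
    show "r < card (sym_diff A B)" if "A \<in> S" "B \<in> S" "A \<noteq> B" for A B
      using S(1) that by (auto simp: P_def)
    show "\<exists>B\<in>S. card (sym_diff A B) \<le> r" if A: "A \<in> F" "A \<notin> S" for A
    proof (rule ccontr)
      assume "\<not> ?thesis"
      then have "\<forall>B\<in>S. r < card (sym_diff A B)" by (simp add: not_le)
      moreover have "sym_diff A B = sym_diff B A" for B by auto
      ultimately have "P (insert A S)" using S(1) A by (auto simp: P_def)
      from S(2)[OF this] A(2) fS show False by simp
    qed
  qed
qed

text \<open>
  Chaining. Take separated nets of \<open>F\<close> at the scales \<open>n/4^j\<close>. Passing from one net to the next
  replaces each member by a nearby one, and the maximum of the differences is controlled by
  Massart's lemma with the packing bound; these increments are summable. At scale \<open>n\<close> the net is a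
  singleton with average \<open>0\<close>, and at a scale below \<open>1\<close> it is the whole family.
\<close>

lemma rademacher_vc_bound:
  assumes I: "finite I" "I \<noteq> {}" and F: "F \<subseteq> Pow I" "F \<noteq> {}" and V1: "1 \<le> V"
    and V: "\<And>S. shatters F S \<Longrightarrow> S \<subseteq> I \<Longrightarrow> card S \<le> V"
  shows "sign_avg I (\<lambda>s. Max ((\<lambda>A. \<Sum>i\<in>A. s i) ` F)) \<le> 10 * sqrt (real (card I) * real V)"
proof -
  define n where "n = real (card I)"
  have n: "n > 0" using I by (simp add: n_def card_gt_0_iff)
  have Vpos: "real V > 0" using V1 by simp
  have finF: "finite F" using F I by (meson finite_Pow_iff finite_subset)
  define W where "W S = sign_avg I (\<lambda>s. Max ((\<lambda>A. \<Sum>i\<in>A. s i) ` S))" for S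
  define net where "net r S \<longleftrightarrow> S \<subseteq> F \<and> (\<forall>A\<in>S. \<forall>B\<in>S. A \<noteq> B \<longrightarrow> r < card (sym_diff A B))
      \<and> (\<forall>A\<in>F. \<exists>B\<in>S. card (sym_diff A B) \<le> r)" for r :: real and S
  have ex_net: "\<exists>S. net r S" if "r \<ge> 0" for r
  proof -
    obtain S where S: "S \<subseteq> F" "\<And>A B. A \<in> S \<Longrightarrow> B \<in> S \<Longrightarrow> A \<noteq> B \<Longrightarrow> r < card (sym_diff A B)"
      "\<And>A. A \<in> F \<Longrightarrow> A \<notin> S \<Longrightarrow> \<exists>B\<in>S. card (sym_diff A B) \<le> r"
      using exists_separated_net[OF finF, of r] by blast
    have "\<exists>B\<in>S. card (sym_diff A B) \<le> r" if "A \<in> F" for A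
    proof (cases "A \<in> S")
      case True then show ?thesis using \<open>r \<ge> 0\<close> by (intro bexI[of _ A]) auto
    qed (use S that in auto)
    then show ?thesis using S by (intro exI[of _ S]) (auto simp: net_def)
  qed
  have net_ne: "S \<noteq> {}" if "net r S" for r S using that F(2) by (auto simp: net_def)
  have finS: "finite S" if "net r S" for r S using that finF finite_subset by (auto simp: net_def)
  have sum_eq: "(\<Sum>i\<in>I. s i * indicator A i) = (\<Sum>i\<in>A. s i)" if "A \<in> F" for A and s :: "'a \<Rightarrow> real"
  proof -
    have "A \<subseteq> I" using F(1) that by auto
    then show ?thesis using I(1) by (intro sum.mono_neutral_cong_right) (auto simp: indicator_def)
  qed
  have sum_ind: "(\<Sum>i\<in>I. indicator D i) = real (card (I \<inter> D))" for D
    using I by (simp add: indicator_def sum.If_cases Int_def)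
  have start: "W S \<le> 0" if S: "net n S" for S
  proof -
    obtain A where "A \<in> S" using net_ne[OF S] by auto
    have "B = A" if B: "B \<in> S" for B
    proof (rule ccontr)
      assume "B \<noteq> A"
      then have "n < card (sym_diff B A)" using S B \<open>A \<in> S\<close> by (auto simp: net_def)
      moreover have "sym_diff B A \<subseteq> I" using S B \<open>A \<in> S\<close> F by (auto simp: net_def)
      ultimately show False using card_mono[OF I(1), of "sym_diff B A"] by (simp add: n_def)
    qed
    then have SA: "S = {A}" using \<open>A \<in> S\<close> by blast
    have "A \<in> F" using S \<open>A \<in> S\<close> by (auto simp: net_def)
    have "W S = sign_avg I (\<lambda>s. \<Sum>i\<in>I. indicator A i * s i)"
      using sum_eq[OF \<open>A \<in> F\<close>] by (simp add: W_def SA mult.commute)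
    also have "\<dots> = (\<Sum>i\<in>I. indicator A i * sign_avg I (\<lambda>s. s i))"
      by (simp add: sign_avg_sum sign_avg_cmult)
    also have "\<dots> = 0"
    proof (intro sum.neutral ballI)
      fix i assume i: "i \<in> I"
      have "sign_avg I (\<lambda>s. - s i) = sign_avg I (\<lambda>s. s i)"
        using I(1) i by (intro sign_avg_uminus[where h = "\<lambda>s. s i"]) auto
      moreover have "sign_avg I (\<lambda>s. - s i) = - sign_avg I (\<lambda>s. s i)"
        using sign_avg_cmult[of I "-1" "\<lambda>s. s i"] by simp
      ultimately show "indicator A i * sign_avg I (\<lambda>s. s i) = 0" by simp
    qed
    finally show ?thesis by simp
  qed
  have step: "W S' \<le> W S + sqrt (2 * r * L)"
    if S: "net r S" and S': "net r' S'" and r: "r > 0" and L: "L > 0" "ln (card S') \<le> L" for r r' S S' L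
  proof -
    have "\<forall>A\<in>S'. \<exists>B. B \<in> S \<and> card (sym_diff A B) \<le> r" using S S' by (auto simp: net_def)
    then obtain p where p: "\<And>A. A \<in> S' \<Longrightarrow> p A \<in> S \<and> card (sym_diff A (p A)) \<le> r" by metis
    define a where "a A i = (indicator A i - indicator (p A) i :: real)" for A i
    have "W S' \<le> sign_avg I (\<lambda>s. Max ((\<lambda>A. \<Sum>i\<in>A. s i) ` S) + Max ((\<lambda>A. \<Sum>i\<in>I. s i * a A i) ` S'))"
      unfolding W_def
    proof (rule sign_avg_mono)
      fix s
      show "Max ((\<lambda>A. \<Sum>i\<in>A. s i) ` S')
        \<le> Max ((\<lambda>A. \<Sum>i\<in>A. s i) ` S) + Max ((\<lambda>A. \<Sum>i\<in>I. s i * a A i) ` S')"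
      proof (rule Max.boundedI)
        fix x assume "x \<in> (\<lambda>A. \<Sum>i\<in>A. s i) ` S'"
        then obtain A where A: "A \<in> S'" "x = (\<Sum>i\<in>A. s i)" by auto
        have AF: "A \<in> F" "p A \<in> F" using A p S S' by (auto simp: net_def)
        have "x = (\<Sum>i\<in>p A. s i) + (\<Sum>i\<in>I. s i * a A i)"
          using sum_eq[OF AF(1), of s] sum_eq[OF AF(2), of s]
          by (simp add: A a_def algebra_simps sum_subtractf)
        also have "\<dots> \<le> Max ((\<lambda>A. \<Sum>i\<in>A. s i) ` S) + Max ((\<lambda>A. \<Sum>i\<in>I. s i * a A i) ` S')"
          using A p finS[OF S] finS[OF S'] by (intro add_mono Max_ge) auto
        finally show "x \<le> \<dots>" .
      qed (use finS[OF S'] net_ne[OF S'] in auto)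
    qed
    also have "\<dots> = W S + sign_avg I (\<lambda>s. Max ((\<lambda>A. \<Sum>i\<in>I. s i * a A i) ` S'))"
      by (simp add: sign_avg_add W_def)
    also have "\<dots> \<le> W S + sqrt (2 * r * L)"
    proof (intro add_left_mono massart_finite_class I finS[OF S'] net_ne[OF S'] r L)
      fix A assume A: "A \<in> S'"
      have AF: "A \<in> F" "p A \<in> F" using A p S S' by (auto simp: net_def)
      have "(\<Sum>i\<in>I. (a A i)\<^sup>2) = (\<Sum>i\<in>I. indicator (sym_diff A (p A)) i)"
        by (intro sum.cong) (auto simp: a_def indicator_def)
      also have "\<dots> = card (I \<inter> sym_diff A (p A))"
        using sum_ind[of "sym_diff A (p A)"] .
      also have "I \<inter> sym_diff A (p A) = sym_diff A (p A)" using AF F by auto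
      also have "card \<dots> \<le> r" using p[OF A] by simp
      finally show "(\<Sum>i\<in>I. (a A i)\<^sup>2) \<le> r" by simp
    qed
    finally show ?thesis .
  qed
  (* The increment at level j is sqrt(n V) (4 + j) / 2^j, and 10 - (10 + 2 j) / 2^j are exactly the
     partial sums of (4 + j) / 2^j. *)
  have chain: "\<exists>S. net (n / 4 ^ j) S \<and> W S \<le> sqrt (n * V) * (10 - (10 + 2 * real j) / 2 ^ j)" for j :: nat
  proof (induction j)
    case 0
    obtain S where "net n S" using ex_net[of n] n by auto
    then show ?case using start by auto
  next
    case (Suc j)
    then obtain S where S: "net (n / 4 ^ j) S" "W S \<le> sqrt (n * V) * (10 - (10 + 2 * real j) / 2 ^ j)" by blast
    obtain S' where S': "net (n / 4 ^ Suc j) S'" using ex_net[of "n / 4 ^ Suc j"] n by auto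
    define p :: real where "p = 1 / 4 ^ Suc j"
    have p: "0 < p" "p \<le> 1" using one_le_power[of "4::real" "Suc j"] by (simp_all add: p_def divide_simps)
    (* a perfect square, so that the increment contains no nested root *)
    define L where "L = 2 * real V * (2 + real j / 2)\<^sup>2"
    have Lpos: "L > 0" using Vpos by (auto simp: L_def)
    have "ln (card S') \<le> 2 * real V * ln (6 / p)"
    proof (rule ln_packing_le[OF I _ net_ne[OF S'] p V1])
      show "S' \<subseteq> Pow I" using S' F by (auto simp: net_def)
      show "p * card I < card (sym_diff A B)" if "A \<in> S'" "B \<in> S'" "A \<noteq> B" for A B
        using S' that by (auto simp: net_def p_def n_def)
      show "card T \<le> V" if "shatters S' T" "T \<subseteq> I" for T
      proof (rule V[OF _ that(2)])
        have "S' \<subseteq> F" using S' by (simp add: net_def)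
        then show "shatters F T" by (rule shatters_mono[OF that(1)])
      qed
    qed
    also have "ln (6 / p) \<le> (2 + real j / 2)\<^sup>2"
    proof -
      have "ln (24::real) = ln (6 * 4)" by simp
      also have "\<dots> = ln 6 + ln (4::real)" by (rule ln_mult_pos) auto
      finally have ln24: "ln (24::real) = ln 6 + ln 4" .
      have "6 / p = 6 * 4 ^ Suc j" by (simp add: p_def)
      also have "ln \<dots> = ln 6 + ln (4 ^ Suc j :: real)" by (rule ln_mult_pos) auto
      also have "\<dots> = ln 6 + (real j + 1) * ln (4::real)"
        by (simp add: ln_realpow del: power_Suc)
      also have "\<dots> = ln 24 + real j * ln (4::real)"
        unfolding ln24 by (simp add: distrib_right)
      also have "\<dots> \<le> 4 + real j * 2"
      proof (intro add_mono mult_left_mono)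
        have e: "(5/2::real) \<le> exp 1" using exp_lower_Taylor_quadratic[of "1::real"] by simp
        have "24 \<le> (5/2::real) ^ 4" by (simp add: power_numeral_reduce)
        also have "\<dots> \<le> exp 1 ^ 4" using e by (intro power_mono) auto
        also have "\<dots> = exp (4::real)" by (simp flip: exp_of_nat_mult)
        finally have "ln 24 \<le> ln (exp (4::real))" by (intro ln_mono) auto
        then show "ln 24 \<le> (4::real)" by simp
        have "4 \<le> (5/2::real) ^ 2" by (simp add: power_numeral_reduce)
        also have "\<dots> \<le> exp 1 ^ 2" using e by (intro power_mono) auto
        also have "\<dots> = exp (2::real)" by (simp flip: exp_of_nat_mult)
        finally have "ln 4 \<le> ln (exp (2::real))" by (intro ln_mono) auto
        then show "ln 4 \<le> (2::real)" by simp
      qed auto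
      also have "\<dots> \<le> (2 + real j / 2)\<^sup>2" by (simp add: power2_eq_square algebra_simps)
      finally show ?thesis .
    qed
    finally have "ln (card S') \<le> L" using Vpos by (simp add: L_def mult_left_mono)
    with S(1) S' n Lpos have "W S' \<le> W S + sqrt (2 * (n / 4 ^ j) * L)"
      by (intro step) auto
    also have "sqrt (2 * (n / 4 ^ j) * L) = sqrt (n * V) * ((4 + real j) / 2 ^ j)"
    proof -
      have "2 * (n / 4 ^ j) * L = (n * V) * ((4 + real j) / 2 ^ j)\<^sup>2"
        by (simp add: L_def power2_eq_square field_simps flip: power_mult_distrib)
      then show ?thesis by (simp add: real_sqrt_mult)
    qed
    also have "W S + \<dots> \<le> sqrt (n * V) * (10 - (10 + 2 * real j) / 2 ^ j) + sqrt (n * V) * ((4 + real j) / 2 ^ j)"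
      using S(2) by simp
    also have "\<dots> = sqrt (n * V) * (10 - (10 + 2 * real (Suc j)) / 2 ^ Suc j)"
      by (simp add: field_simps)
    finally show ?case using S' by blast
  qed
  obtain j :: nat where j: "n < 4 ^ j" using real_arch_pow[of 4 n] by auto
  obtain S where S: "net (n / 4 ^ j) S" "W S \<le> sqrt (n * V) * (10 - (10 + 2 * real j) / 2 ^ j)"
    using chain[of j] by blast
  have "F \<subseteq> S"
  proof
    fix A assume A: "A \<in> F"
    then obtain B where B: "B \<in> S" "card (sym_diff A B) \<le> n / 4 ^ j" using S by (auto simp: net_def)
    have "n / 4 ^ j < 1" using j by simp
    with B(2) have "card (sym_diff A B) = 0" by linarith
    moreover have "finite (sym_diff A B)"
      using A B(1) S(1) F I(1) by (auto simp: net_def intro: finite_subset[of _ I])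
    ultimately have "A = B" by auto
    with B show "A \<in> S" by simp
  qed
  then have "F = S" using S(1) by (auto simp: net_def)
  then have "W F \<le> sqrt (n * V) * (10 - (10 + 2 * real j) / 2 ^ j)" using S(2) by simp
  also have "\<dots> \<le> sqrt (n * V) * 10" using n by (intro mult_left_mono) auto
  finally show ?thesis by (simp add: W_def n_def mult.commute)
qed

section \<open>Concentration under bounded differences\<close>

lemma (in prob_space) integrable_bounded:
  fixes f :: "'a \<Rightarrow> real"
  assumes "f \<in> borel_measurable M" "\<And>x. x \<in> space M \<Longrightarrow> \<bar>f x\<bar> \<le> B"
  shows "integrable M f"
  using assms by (intro integrable_const_bound[of _ B]) auto

lemma (in prob_space) abs_integral_le_bound:
  fixes f :: "'a \<Rightarrow> real"
  assumes "f \<in> borel_measurable M" "\<And>x. x \<in> space M \<Longrightarrow> \<bar>f x\<bar> \<le> B"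
  shows "\<bar>\<integral>x. f x \<partial>M\<bar> \<le> B"
proof -
  have "\<bar>\<integral>x. f x \<partial>M\<bar> \<le> (\<integral>x. \<bar>f x\<bar> \<partial>M)" by (rule integral_abs_bound)
  also have "\<dots> \<le> (\<integral>x. B \<partial>M)"
    using assms by (intro integral_mono integrable_abs integrable_bounded[of f B]) auto
  finally show ?thesis by (simp add: prob_space)
qed

text \<open>
  Hoeffding's lemma for a variable with values in an interval of length \<open>2c\<close>.
\<close>

lemma (in prob_space) hoeffding_mgf:
  fixes f :: "'a \<Rightarrow> real"
  assumes f: "f \<in> borel_measurable M" and r: "\<And>x. x \<in> space M \<Longrightarrow> \<bar>f x - m\<bar> \<le> c" and l: "l > 0"
  shows "(\<integral>x. exp (l * (f x - expectation f)) \<partial>M) \<le> exp (l\<^sup>2 * c\<^sup>2 / 2)"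
proof -
  interpret interval_bounded_random_variable M f "m - c" "m + c"
  proof unfold_locales
    show "f \<in> borel_measurable M" by (rule f)
    show "AE x in M. f x \<in> {m - c..m + c}"
    proof (rule AE_I2)
      fix x assume "x \<in> space M"
      from r[OF this] show "f x \<in> {m - c..m + c}" unfolding atLeastAtMost_iff by linarith
    qed
  qed
  have "ennreal (\<integral>x. exp (l * (f x - expectation f)) \<partial>M) = (\<integral>\<^sup>+x. exp (l * (f x - expectation f)) \<partial>M)"
  proof (rule nn_integral_eq_integral[symmetric])
    have b: "\<bar>f x\<bar> \<le> \<bar>m\<bar> + c" if "x \<in> space M" for x using r[OF that] by linarith
    show "integrable M (\<lambda>x. exp (l * (f x - expectation f)))"
    proof (rule integrable_bounded)
      fix x assume "x \<in> space M"
      then have "f x - expectation f \<le> \<bar>m\<bar> + c - expectation f" using b by (auto simp: abs_le_iff)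
      then show "\<bar>exp (l * (f x - expectation f))\<bar> \<le> exp (l * (\<bar>m\<bar> + c - expectation f))"
        using l by (simp add: mult_left_mono)
    qed (use f in measurable)
  qed simp
  also have "\<dots> \<le> ennreal (exp (l\<^sup>2 * (m + c - (m - c))\<^sup>2 / 8))"
    by (rule Hoeffdings_lemma_nn_integral[OF l])
  also have "l\<^sup>2 * (m + c - (m - c))\<^sup>2 / 8 = l\<^sup>2 * c\<^sup>2 / 2" by (simp add: power2_eq_square)
  finally show ?thesis by (simp add: ennreal_le_iff)
qed

text \<open>
  Induction on the coordinates: integrating one coordinate out leaves a function \<open>g\<close> of the others
  with the same bounded differences, and for fixed other coordinates the fluctuation around \<open>g\<close> is
  controlled by Hoeffding's lemma.
\<close>

lemma bounded_differences_mgf: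
  fixes f :: "('i \<Rightarrow> 'a) \<Rightarrow> real"
  assumes M: "prob_space M" and "finite I" and f: "f \<in> borel_measurable (PiM I (\<lambda>_. M))"
    and B: "\<And>x. x \<in> space (PiM I (\<lambda>_. M)) \<Longrightarrow> \<bar>f x\<bar> \<le> B"
    and diff: "\<And>x i y. x \<in> space (PiM I (\<lambda>_. M)) \<Longrightarrow> i \<in> I \<Longrightarrow> y \<in> space M \<Longrightarrow> \<bar>f (x(i := y)) - f x\<bar> \<le> c"
    and l: "l > 0"
  shows "(\<integral>x. exp (l * (f x - (\<integral>x. f x \<partial>PiM I (\<lambda>_. M)))) \<partial>PiM I (\<lambda>_. M)) \<le> exp (l\<^sup>2 * c\<^sup>2 * card I / 2)"
  using assms(2) f B diff
proof (induction I arbitrary: f rule: finite_induct)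
  case empty
  show ?case by (simp add: PiM_empty lebesgue_integral_count_space_finite)
next
  case (insert i I f)
  interpret M: prob_space M by (rule M)
  interpret P: product_prob_space "\<lambda>_. M" by unfold_locales
  interpret I: prob_space "PiM I (\<lambda>_. M)" by (intro prob_space_PiM M)
  interpret Ii: prob_space "PiM (insert i I) (\<lambda>_. M)" by (intro prob_space_PiM M)
  note f[measurable] = insert.prems(1)
  define g where "g x = (\<integral>y. f (x(i := y)) \<partial>M)" for x
  define E where "E = (\<integral>x. f x \<partial>PiM (insert i I) (\<lambda>_. M))"
  have upd: "x(i := y) \<in> space (PiM (insert i I) (\<lambda>_. M))"
    if "x \<in> space (PiM I (\<lambda>_. M))" "y \<in> space M" for x y
    using that by (auto simp: space_PiM PiE_def extensional_def)
  have fpair[measurable]: "(\<lambda>p. f ((fst p)(i := snd p))) \<in> borel_measurable (PiM I (\<lambda>_. M) \<Otimes>\<^sub>M M)"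
    using measurable_compose[OF measurable_add_dim f] by (simp add: case_prod_beta)
  have fx: "(\<lambda>y. f (x(i := y))) \<in> borel_measurable M" if "x \<in> space (PiM I (\<lambda>_. M))" for x
    using measurable_compose[OF measurable_Pair1'[OF that] fpair] by simp
  have g[measurable]: "g \<in> borel_measurable (PiM I (\<lambda>_. M))"
    unfolding g_def using fpair by (intro M.borel_measurable_lebesgue_integral) (simp add: case_prod_beta)
  have gB: "\<bar>g x\<bar> \<le> B" if "x \<in> space (PiM I (\<lambda>_. M))" for x
    unfolding g_def using that by (intro M.abs_integral_le_bound fx insert.prems(2) upd)
  have fint: "integrable (PiM (insert i I) (\<lambda>_. M)) f"
    using insert.prems by (intro Ii.integrable_bounded[of f B]) auto
  have E: "E = (\<integral>x. g x \<partial>PiM I (\<lambda>_. M))"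
    unfolding E_def g_def using insert.hyps fint by (intro P.product_integral_insert) auto
  obtain y0 where y0: "y0 \<in> space M" using M.not_empty by blast
  have gdiff: "\<bar>g (x(j := z)) - g x\<bar> \<le> c"
    if x: "x \<in> space (PiM I (\<lambda>_. M))" and j: "j \<in> I" and z: "z \<in> space M" for x j z
  proof -
    have x': "x(j := z) \<in> space (PiM I (\<lambda>_. M))" using x j z by (auto simp: space_PiM PiE_def extensional_def)
    have tw: "x(j := z, i := y) = x(i := y, j := z)" for y
      using j insert.hyps by (metis fun_upd_twist)
    have "integrable M (\<lambda>y. f (x(i := y)))" if "x \<in> space (PiM I (\<lambda>_. M))" for x
      using that insert.prems(2) by (intro M.integrable_bounded[of _ B] fx upd) (auto intro: upd)
    then have "g (x(j := z)) - g x = (\<integral>y. f (x(j := z, i := y)) - f (x(i := y)) \<partial>M)"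
      unfolding g_def using x x' by simp
    also have "\<bar>\<dots>\<bar> \<le> c"
    proof (rule M.abs_integral_le_bound)
      show "(\<lambda>y. f (x(j := z, i := y)) - f (x(i := y))) \<in> borel_measurable M"
        using fx[OF x] fx[OF x'] by measurable
      show "\<bar>f (x(j := z, i := y)) - f (x(i := y))\<bar> \<le> c" if "y \<in> space M" for y
        unfolding tw by (rule insert.prems(3)[OF upd[OF x that] insertI2[OF j] z])
    qed
    finally show ?thesis .
  qed
  have eint: "integrable (PiM (insert i I) (\<lambda>_. M)) (\<lambda>x. exp (l * (f x - E)))"
  proof (rule Ii.integrable_bounded)
    fix x assume x: "x \<in> space (PiM (insert i I) (\<lambda>_. M))"
    have "f x - E \<le> B - E" using insert.prems(2)[OF x] by (simp add: abs_le_iff)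
    then show "\<bar>exp (l * (f x - E))\<bar> \<le> exp (l * (B - E))" using l by (simp add: mult_left_mono)
  qed measurable
  have "(\<integral>x. exp (l * (f x - E)) \<partial>PiM (insert i I) (\<lambda>_. M))
      = (\<integral>x. (\<integral>y. exp (l * (f (x(i := y)) - E)) \<partial>M) \<partial>PiM I (\<lambda>_. M))"
    using insert.hyps eint by (intro P.product_integral_insert) auto
  also have "\<dots> \<le> (\<integral>x. exp (l * (g x - E)) * exp (l\<^sup>2 * c\<^sup>2 / 2) \<partial>PiM I (\<lambda>_. M))"
  proof (rule integral_mono_AE')
    show "integrable (PiM I (\<lambda>_. M)) (\<lambda>x. exp (l * (g x - E)) * exp (l\<^sup>2 * c\<^sup>2 / 2))"
    proof (rule I.integrable_bounded)
      fix x assume x: "x \<in> space (PiM I (\<lambda>_. M))"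
      have "g x - E \<le> B - E" using gB[OF x] by (simp add: abs_le_iff)
      then show "\<bar>exp (l * (g x - E)) * exp (l\<^sup>2 * c\<^sup>2 / 2)\<bar> \<le> exp (l * (B - E)) * exp (l\<^sup>2 * c\<^sup>2 / 2)"
        using l by (simp add: mult_left_mono)
    qed measurable
    show "AE x in PiM I (\<lambda>_. M). (\<integral>y. exp (l * (f (x(i := y)) - E)) \<partial>M) \<le> exp (l * (g x - E)) * exp (l\<^sup>2 * c\<^sup>2 / 2)"
    proof (rule AE_I2)
      fix x assume x: "x \<in> space (PiM I (\<lambda>_. M))"
      have "(\<integral>y. exp (l * (f (x(i := y)) - E)) \<partial>M)
          = (\<integral>y. exp (l * (g x - E)) * exp (l * (f (x(i := y)) - g x)) \<partial>M)"
        by (simp add: exp_add[symmetric] algebra_simps)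
      also have "\<dots> = exp (l * (g x - E)) * (\<integral>y. exp (l * (f (x(i := y)) - g x)) \<partial>M)"
        by simp
      also have "\<dots> \<le> exp (l * (g x - E)) * exp (l\<^sup>2 * c\<^sup>2 / 2)"
        unfolding g_def
      proof (rule mult_left_mono[OF M.hoeffding_mgf[OF fx[OF x] _ l, of "f (x(i := y0))"] exp_ge_zero])
        fix y assume y: "y \<in> space M"
        show "\<bar>f (x(i := y)) - f (x(i := y0))\<bar> \<le> c"
          using insert.prems(3)[OF upd[OF x y0] insertI1 y] unfolding fun_upd_upd .
      qed
      finally show "(\<integral>y. exp (l * (f (x(i := y)) - E)) \<partial>M) \<le> exp (l * (g x - E)) * exp (l\<^sup>2 * c\<^sup>2 / 2)" .
    qed
  qed simp
  also have "\<dots> = (\<integral>x. exp (l * (g x - E)) \<partial>PiM I (\<lambda>_. M)) * exp (l\<^sup>2 * c\<^sup>2 / 2)" by simp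
  also have "\<dots> \<le> exp (l\<^sup>2 * c\<^sup>2 * card I / 2) * exp (l\<^sup>2 * c\<^sup>2 / 2)"
    unfolding E by (rule mult_right_mono[OF insert.IH[OF g gB gdiff] exp_ge_zero])
  also have "\<dots> = exp (l\<^sup>2 * c\<^sup>2 * card (insert i I) / 2)"
    using insert.hyps by (simp add: exp_add[symmetric] algebra_simps add_divide_distrib)
  finally show ?case unfolding E_def .
qed

text \<open>
  McDiarmid's inequality, by the exponential Markov inequality.
\<close>

lemma bounded_differences_tail:
  fixes f :: "('i \<Rightarrow> 'a) \<Rightarrow> real"
  assumes M: "prob_space M" and I: "finite I" "I \<noteq> {}" and f[measurable]: "f \<in> borel_measurable (PiM I (\<lambda>_. M))"
    and B: "\<And>x. x \<in> space (PiM I (\<lambda>_. M)) \<Longrightarrow> \<bar>f x\<bar> \<le> B"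
    and diff: "\<And>x i y. x \<in> space (PiM I (\<lambda>_. M)) \<Longrightarrow> i \<in> I \<Longrightarrow> y \<in> space M \<Longrightarrow> \<bar>f (x(i := y)) - f x\<bar> \<le> c"
    and c: "c > 0" and t: "t > 0"
  shows "measure (PiM I (\<lambda>_. M)) {x \<in> space (PiM I (\<lambda>_. M)). f x \<le> (\<integral>x. f x \<partial>PiM I (\<lambda>_. M)) + t}
    \<ge> 1 - exp (- t\<^sup>2 / (2 * c\<^sup>2 * card I))"
proof -
  interpret prob_space "PiM I (\<lambda>_. M)" by (intro prob_space_PiM M)
  let ?P = "PiM I (\<lambda>_. M)"
  define E where "E = expectation f"
  define n where "n = real (card I)"
  have n: "n > 0" using I by (simp add: n_def card_gt_0_iff)
  (* the minimizer of the exponent *)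
  define l where "l = t / (c\<^sup>2 * n)"
  have l: "l > 0" using t c n by (simp add: l_def)
  have eint: "integrable ?P (\<lambda>x. exp (l * (f x - E)))"
  proof (rule integrable_bounded)
    fix x assume "x \<in> space ?P"
    then have "f x - E \<le> B - E" using B by (auto simp: abs_le_iff)
    then show "\<bar>exp (l * (f x - E))\<bar> \<le> exp (l * (B - E))" using l by (simp add: mult_left_mono)
  qed measurable
  have "prob {x \<in> space ?P. f x > E + t} \<le> prob {x \<in> space ?P. exp (l * t) \<le> exp (l * (f x - E))}"
    using l by (intro finite_measure_mono) (auto simp: mult_left_mono)
  also have "\<dots> \<le> (\<integral>x. exp (l * (f x - E)) \<partial>?P) / exp (l * t)"
    by (rule integral_Markov_inequality_measure[OF eint]) auto
  also have "\<dots> \<le> exp (l\<^sup>2 * c\<^sup>2 * n / 2) / exp (l * t)"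
    using bounded_differences_mgf[OF M I(1) f B diff l] by (intro divide_right_mono) (auto simp: E_def n_def)
  also have "\<dots> = exp (- t\<^sup>2 / (2 * c\<^sup>2 * n))"
  proof -
    have "l\<^sup>2 * c\<^sup>2 * n / 2 - l * t = - t\<^sup>2 / (2 * c\<^sup>2 * n)"
      using c n by (simp add: l_def power2_eq_square divide_simps)
    then show ?thesis by (simp add: exp_diff[symmetric])
  qed
  finally have "prob {x \<in> space ?P. f x > E + t} \<le> exp (- t\<^sup>2 / (2 * c\<^sup>2 * n))" .
  moreover have "prob {x \<in> space ?P. \<not> (f x > E + t)} = 1 - prob {x \<in> space ?P. f x > E + t}"
    by (rule prob_neg) measurable
  ultimately show ?thesis by (simp add: not_less E_def n_def)
qed

section \<open>Uniform deviations over a countable VC class\<close>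

lemma bdd_above_range_abs:
  fixes f :: "'j \<Rightarrow> real"
  assumes "\<And>j. \<bar>f j\<bar> \<le> B"
  shows "bdd_above (range f)"
  using assms by (intro bdd_aboveI[of _ B]) (auto simp: abs_le_iff)

lemma abs_SUP_le:
  fixes f :: "'j \<Rightarrow> real"
  assumes B: "\<And>j. \<bar>f j\<bar> \<le> B"
  shows "\<bar>SUP j. f j\<bar> \<le> B"
proof -
  have "(SUP j. f j) \<le> B" using B by (intro cSUP_least) (auto simp: abs_le_iff)
  moreover have "f undefined \<le> (SUP j. f j)" by (intro cSUP_upper bdd_above_range_abs[OF B]) simp
  moreover have "- B \<le> f undefined" using B[of undefined] by (simp add: abs_le_iff)
  ultimately show ?thesis by (simp add: abs_le_iff)
qed

lemma abs_SUP_diff_le: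
  fixes f g :: "'j \<Rightarrow> real"
  assumes f: "\<And>j. \<bar>f j\<bar> \<le> B" and g: "\<And>j. \<bar>g j\<bar> \<le> B'" and c: "\<And>j. \<bar>f j - g j\<bar> \<le> c"
  shows "\<bar>(SUP j. f j) - (SUP j. g j)\<bar> \<le> c"
proof -
  have "(SUP j. f j) \<le> (SUP j. g j) + c"
  proof (rule cSUP_least)
    fix j
    have "g j \<le> (SUP j. g j)" by (intro cSUP_upper bdd_above_range_abs[OF g]) simp
    then show "f j \<le> (SUP j. g j) + c" using c[of j] by (simp add: abs_le_iff)
  qed simp
  moreover have "(SUP j. g j) \<le> (SUP j. f j) + c"
  proof (rule cSUP_least)
    fix j
    have "f j \<le> (SUP j. f j)" by (intro cSUP_upper bdd_above_range_abs[OF f]) simp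
    then show "g j \<le> (SUP j. f j) + c" using c[of j] by (simp add: abs_le_iff)
  qed simp
  ultimately show ?thesis by (simp add: abs_le_iff)
qed

lemma borel_measurable_countable_SUP:
  fixes F :: "nat \<Rightarrow> 'a \<Rightarrow> real"
  assumes "\<And>j. F j \<in> borel_measurable M" "\<And>j x. x \<in> space M \<Longrightarrow> \<bar>F j x\<bar> \<le> B x"
  shows "(\<lambda>x. SUP j. F j x) \<in> borel_measurable M"
  using assms by (intro borel_measurable_cSUP bdd_above_range_abs) auto

lemma abs_sum_le_card:
  fixes h :: "'i \<Rightarrow> real"
  assumes "\<And>i. i \<in> I \<Longrightarrow> \<bar>h i\<bar> \<le> c"
  shows "\<bar>\<Sum>i\<in>I. h i\<bar> \<le> real (card I) * c"
  using order_trans[OF sum_abs sum_bounded_above[of I "\<lambda>i. \<bar>h i\<bar>" c]] assms by simp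

text \<open>
  The class is countable so that suprema over it are measurable. The VC condition concerns the
  index sets that the class cuts out of a sample, not the sample points, so repeated points cause
  no problem.
\<close>

locale vc_sample = prob_space M for M :: "'a measure" +
  fixes H :: "nat \<Rightarrow> 'a set" and n V :: nat
  assumes H: "\<And>j. H j \<in> sets M" and n: "1 \<le> n" and V: "1 \<le> V"
    and vc: "\<And>X S. X \<in> space (PiM {..<n} (\<lambda>_. M)) \<Longrightarrow> S \<subseteq> {..<n} \<Longrightarrow>
      shatters (range (\<lambda>j. {i\<in>{..<n}. X i \<in> H j})) S \<Longrightarrow> card S \<le> V"
begin

definition Mn where "Mn = PiM {..<n} (\<lambda>_. M)"

definition dev where "dev X = (SUP j. (\<Sum>i<n. indicator (H j) (X i)) / n - prob (H j))"

lemma ind_comp: "i \<in> I \<Longrightarrow> (\<lambda>\<omega>. indicator (H j) (\<omega> i) :: real) \<in> borel_measurable (PiM I (\<lambda>_. M))"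
  using H by (intro measurable_compose[OF measurable_component_singleton borel_measurable_indicator])

definition rademacher_sup where "rademacher_sup s X = (SUP j. (\<Sum>i<n. s i * indicator (H j) (X i)))" for s :: "nat \<Rightarrow> real"

lemma signs_abs: "s \<in> signs I \<Longrightarrow> i \<in> I \<Longrightarrow> \<bar>s i\<bar> \<le> 1"
  by (auto simp: signs_def PiE_def Pi_def)

lemma rademacher_sup_term_bound:
  assumes "\<And>i. i < n \<Longrightarrow> \<bar>s i\<bar> \<le> 1"
  shows "\<bar>\<Sum>i<n. s i * indicator (H j) (X i)\<bar> \<le> real n"
  using abs_sum_le_card[of "{..<n}" "\<lambda>i. s i * indicator (H j) (X i)" 1] assms
  by (auto simp: indicator_def)

lemma rademacher_sup_measurable:
  assumes "\<And>i. i < n \<Longrightarrow> \<bar>s i\<bar> \<le> 1"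
  shows "rademacher_sup s \<in> borel_measurable Mn"
  unfolding rademacher_sup_def Mn_def
  using rademacher_sup_term_bound[OF assms]
  by (intro borel_measurable_countable_SUP borel_measurable_sum borel_measurable_times ind_comp) auto

lemma rademacher_sup_bound: "(\<And>i. i < n \<Longrightarrow> \<bar>s i\<bar> \<le> 1) \<Longrightarrow> \<bar>rademacher_sup s X\<bar> \<le> n"
  unfolding rademacher_sup_def by (intro abs_SUP_le rademacher_sup_term_bound)

text \<open>
  For a fixed sample only finitely many index sets are cut out, and the chaining bound applies to
  them.
\<close>

lemma sign_avg_rademacher_sup_le:
  assumes X: "X \<in> space Mn"
  shows "sign_avg {..<n} (\<lambda>s. rademacher_sup s X) \<le> 10 * sqrt (real n * real V)"
proof -
  define F where "F = range (\<lambda>j. {i\<in>{..<n}. X i \<in> H j})"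
  have F: "F \<subseteq> Pow {..<n}" "F \<noteq> {}" by (auto simp: F_def)
  have "rademacher_sup s X = Max ((\<lambda>A. \<Sum>i\<in>A. s i) ` F)" for s
  proof -
    have "rademacher_sup s X = (SUP A\<in>F. \<Sum>i\<in>A. s i)"
      unfolding rademacher_sup_def F_def image_image
      by (intro SUP_cong sum.mono_neutral_cong_right) (auto simp: indicator_def)
    also have "\<dots> = Max ((\<lambda>A. \<Sum>i\<in>A. s i) ` F)"
    proof (rule cSup_eq_Max)
      show "finite ((\<lambda>A. \<Sum>i\<in>A. s i) ` F)"
        using F finite_subset[of F "Pow {..<n}"] by simp
    qed (use F in auto)
    finally show ?thesis .
  qed
  then have "sign_avg {..<n} (\<lambda>s. rademacher_sup s X) = sign_avg {..<n} (\<lambda>s. Max ((\<lambda>A. \<Sum>i\<in>A. s i) ` F))" by simp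
  also have "\<dots> \<le> 10 * sqrt (real (card {..<n}) * real V)"
  proof (rule rademacher_vc_bound[OF _ _ F V])
    show "card S \<le> V" if "shatters F S" "S \<subseteq> {..<n}" for S
      using vc[OF X[unfolded Mn_def] that(2)] that(1) unfolding F_def by blast
  qed (use n in \<open>auto simp: lessThan_empty_iff\<close>)
  finally show ?thesis by simp
qed

lemma dev_term_bound: "\<bar>(\<Sum>i<n. indicator (H j) (X i)) / n - prob (H j)\<bar> \<le> 1"
proof -
  have "0 \<le> (\<Sum>i<n. indicator (H j) (X i) :: real)" by (intro sum_nonneg) auto
  moreover have "(\<Sum>i<n. indicator (H j) (X i) :: real) \<le> (\<Sum>i<n. 1)" by (intro sum_mono) auto
  ultimately have "0 \<le> (\<Sum>i<n. indicator (H j) (X i) :: real) / n" "(\<Sum>i<n. indicator (H j) (X i) :: real) / n \<le> 1"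
    using n by (auto simp: divide_simps)
  then show ?thesis using measure_nonneg[of M "H j"] prob_le_1[of "H j"] unfolding abs_le_iff by linarith
qed

lemma dev_measurable: "dev \<in> borel_measurable Mn"
  unfolding dev_def Mn_def
  by (rule borel_measurable_countable_SUP[OF _ dev_term_bound])
     (intro borel_measurable_diff borel_measurable_divide borel_measurable_sum ind_comp borel_measurable_const, auto)

lemma dev_bound: "\<bar>dev X\<bar> \<le> 1"
  unfolding dev_def by (intro abs_SUP_le dev_term_bound)

lemma dev_diff:
  assumes i: "i < n"
  shows "\<bar>dev (X(i := y)) - dev X\<bar> \<le> 1 / n"
  unfolding dev_def
proof (rule abs_SUP_diff_le[OF dev_term_bound dev_term_bound])
  fix j
  let ?I = "indicator (H j) :: 'a \<Rightarrow> real"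
  have "(\<Sum>k<n. ?I ((X(i := y)) k)) - (\<Sum>k<n. ?I (X k)) = (\<Sum>k<n. if k = i then ?I y - ?I (X i) else 0)"
    unfolding sum_subtractf[symmetric] by (intro sum.cong) auto
  also have "\<dots> = ?I y - ?I (X i)" using i by simp
  finally have "(\<Sum>k<n. ?I ((X(i := y)) k)) / n - prob (H j) - ((\<Sum>k<n. ?I (X k)) / n - prob (H j)) = (?I y - ?I (X i)) / n"
    by (simp add: diff_divide_distrib[symmetric])
  also have "\<bar>\<dots>\<bar> \<le> 1 / n" by (auto simp: indicator_def abs_divide)
  finally show "\<bar>(\<Sum>k<n. ?I ((X(i := y)) k)) / n - prob (H j) - ((\<Sum>k<n. ?I (X k)) / n - prob (H j))\<bar> \<le> 1 / n" .
qed

definition K where "K = PiM ({..<n} \<union> {n..<2*n}) (\<lambda>_. M)"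

definition ghost_sup where "ghost_sup s \<omega> = (SUP j. \<Sum>i<n. s i * (indicator (H j) (\<omega> i) - indicator (H j) (\<omega> (i + n))))"
  for s :: "nat \<Rightarrow> real"

lemma ghost_sup_term_bound:
  assumes "\<And>i. i < n \<Longrightarrow> \<bar>s i\<bar> \<le> 1"
  shows "\<bar>\<Sum>i<n. s i * (indicator (H j) (\<omega> i) - indicator (H j) (\<omega> (i + n)))\<bar> \<le> real n"
  using abs_sum_le_card[of "{..<n}" "\<lambda>i. s i * (indicator (H j) (\<omega> i) - indicator (H j) (\<omega> (i + n)))" 1] assms
  by (auto simp: indicator_def)

lemma ghost_sup_measurable:
  assumes "\<And>i. i < n \<Longrightarrow> \<bar>s i\<bar> \<le> 1"
  shows "ghost_sup s \<in> borel_measurable K"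
  unfolding ghost_sup_def K_def
  by (rule borel_measurable_countable_SUP[OF _ ghost_sup_term_bound[OF assms]])
     (intro borel_measurable_sum borel_measurable_times borel_measurable_diff ind_comp borel_measurable_const, auto)

lemma ghost_sup_bound: "(\<And>i. i < n \<Longrightarrow> \<bar>s i\<bar> \<le> 1) \<Longrightarrow> \<bar>ghost_sup s \<omega>\<bar> \<le> n"
  unfolding ghost_sup_def by (intro abs_SUP_le ghost_sup_term_bound)

lemma prob_space_K: "prob_space K" unfolding K_def by (intro prob_space_PiM prob_space_axioms)
lemma prob_space_Mn: "prob_space Mn" unfolding Mn_def by (intro prob_space_PiM prob_space_axioms)

text \<open>
  The probability of \<open>H j\<close> is the mean frequency in an independent second sample, and a supremum
  of means is at most the mean of the supremum.
\<close>

lemma dev_le_ghost: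
  assumes X: "X \<in> space Mn"
  shows "n * dev X \<le> (\<integral>Y. ghost_sup (\<lambda>_. 1) (merge {..<n} {n..<2*n} (X, Y)) \<partial>PiM {n..<2*n} (\<lambda>_. M))"
proof -
  let ?J = "PiM {n..<2*n} (\<lambda>_. M)" and ?m = "\<lambda>Y. merge {..<n} {n..<2*n} (X, Y)"
  interpret J: prob_space ?J by (intro prob_space_PiM prob_space_axioms)
  have m: "?m \<in> measurable ?J K"
    unfolding K_def by (rule measurable_compose[OF measurable_Pair1'[OF X[unfolded Mn_def]] measurable_merge])
  have sint: "integrable ?J (\<lambda>Y. ghost_sup (\<lambda>_. 1) (?m Y))"
    using measurable_compose[OF m ghost_sup_measurable[of "\<lambda>_. 1"]]
    by (intro J.integrable_bounded[of _ n] ghost_sup_bound) auto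
  have eq: "(\<integral>Y. (\<Sum>i<n. indicator (H j) (?m Y i) - indicator (H j) (?m Y (i + n))) \<partial>?J)
      = (\<Sum>i<n. indicator (H j) (X i)) - n * prob (H j)" for j
  proof -
    have c: "(\<integral>Y. indicator (H j) (Y i) \<partial>?J) = prob (H j)" if "i \<in> {n..<2*n}" for i
    proof -
      have "prob (H j) = (\<integral>y. indicator (H j) y \<partial>distr ?J M (\<lambda>Y. Y i))"
        using distr_PiM_component[of "{n..<2*n}" "\<lambda>_. M" i] that prob_space_axioms H by simp
      also have "\<dots> = (\<integral>Y. indicator (H j) (Y i) \<partial>?J)"
        using that H by (intro integral_distr) auto
      finally show ?thesis by simp
    qed
    have ii: "integrable ?J (\<lambda>Y. indicator (H j) (Y i) :: real)" if "i \<in> {n..<2*n}" for i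
      using that by (intro J.integrable_bounded[of _ 1] ind_comp) auto
    have "(\<integral>Y. (\<Sum>i<n. indicator (H j) (?m Y i) - indicator (H j) (?m Y (i + n))) \<partial>?J)
        = (\<integral>Y. (\<Sum>i<n. indicator (H j) (X i) - indicator (H j) (Y (i + n)) :: real) \<partial>?J)"
      by (intro Bochner_Integration.integral_cong sum.cong) (auto simp: merge_def)
    also have "\<dots> = (\<Sum>i<n. \<integral>Y. indicator (H j) (X i) - indicator (H j) (Y (i + n)) \<partial>?J)"
      by (intro Bochner_Integration.integral_sum Bochner_Integration.integrable_diff) (auto intro!: ii)
    also have "\<dots> = (\<Sum>i<n. indicator (H j) (X i) - prob (H j))"
    proof (rule sum.cong)
      fix i assume "i \<in> {..<n}"
      then have i: "i + n \<in> {n..<2*n}" by auto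
      show "(\<integral>Y. indicator (H j) (X i) - indicator (H j) (Y (i + n)) \<partial>?J) = indicator (H j) (X i) - prob (H j)"
        using c[OF i] ii[OF i] by (subst Bochner_Integration.integral_diff) (auto simp: J.prob_space)
    qed simp
    finally show ?thesis by (simp add: sum_subtractf)
  qed
  have "dev X \<le> (\<integral>Y. ghost_sup (\<lambda>_. 1) (?m Y) \<partial>?J) / n"
    unfolding dev_def
  proof (rule cSUP_least)
    fix j
    have "(\<Sum>i<n. indicator (H j) (X i)) - n * prob (H j) \<le> (\<integral>Y. ghost_sup (\<lambda>_. 1) (?m Y) \<partial>?J)"
      unfolding eq[symmetric]
    proof (rule integral_mono)
      show "integrable ?J (\<lambda>Y. \<Sum>i<n. indicator (H j) (?m Y i) - indicator (H j) (?m Y (i + n)) :: real)"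
        using measurable_compose[OF m[unfolded K_def] ind_comp]
        by (intro Bochner_Integration.integrable_sum Bochner_Integration.integrable_diff J.integrable_bounded[of _ 1]) auto
      show "(\<Sum>i<n. indicator (H j) (?m Y i) - indicator (H j) (?m Y (i + n))) \<le> ghost_sup (\<lambda>_. 1) (?m Y)" for Y
      proof -
        have "(\<Sum>i<n. (\<lambda>_. 1) i * (indicator (H j) (?m Y i) - indicator (H j) (?m Y (i + n)))) \<le> ghost_sup (\<lambda>_. 1) (?m Y)"
          unfolding ghost_sup_def by (intro cSUP_upper bdd_above_range_abs[OF ghost_sup_term_bound]) auto
        then show ?thesis by simp
      qed
    qed (rule sint)
    from divide_right_mono[OF this, of "real n"]
    show "(\<Sum>i<n. indicator (H j) (X i)) / n - prob (H j) \<le> (\<integral>Y. ghost_sup (\<lambda>_. 1) (?m Y) \<partial>?J) / n"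
      using n by (simp add: diff_divide_distrib)
  qed simp
  then show ?thesis using n by (simp add: pos_le_divide_eq mult.commute)
qed

lemma integral_dev_le_ghost_sup: "n * (\<integral>X. dev X \<partial>Mn) \<le> (\<integral>\<omega>. ghost_sup (\<lambda>_. 1) \<omega> \<partial>K)"
proof -
  interpret P: product_prob_space "\<lambda>_. M" by unfold_locales
  interpret K: prob_space K by (rule prob_space_K)
  interpret Mn: prob_space Mn by (rule prob_space_Mn)
  have int: "integrable K (ghost_sup (\<lambda>_. 1))"
    by (intro K.integrable_bounded[of _ n] ghost_sup_measurable ghost_sup_bound) auto
  have "(\<integral>\<omega>. ghost_sup (\<lambda>_. 1) \<omega> \<partial>K)
      = (\<integral>X. (\<integral>Y. ghost_sup (\<lambda>_. 1) (merge {..<n} {n..<2*n} (X, Y)) \<partial>PiM {n..<2*n} (\<lambda>_. M)) \<partial>Mn)"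
    using int unfolding K_def Mn_def by (intro P.product_integral_fold) auto
  moreover have "(\<integral>X. n * dev X \<partial>Mn) \<le> \<dots>"
  proof (rule integral_mono)
    show "integrable Mn (\<lambda>X. real n * dev X)"
      using dev_measurable dev_bound by (intro integrable_mult_right Mn.integrable_bounded[of _ 1]) auto
    show "integrable Mn (\<lambda>X. \<integral>Y. ghost_sup (\<lambda>_. 1) (merge {..<n} {n..<2*n} (X, Y)) \<partial>PiM {n..<2*n} (\<lambda>_. M))"
    proof (rule Mn.integrable_bounded[of _ n])
      interpret J: prob_space "PiM {n..<2*n} (\<lambda>_. M)" by (intro prob_space_PiM prob_space_axioms)
      have mm: "(\<lambda>p. ghost_sup (\<lambda>_. 1) (merge {..<n} {n..<2*n} p)) \<in> borel_measurable (Mn \<Otimes>\<^sub>M PiM {n..<2*n} (\<lambda>_. M))"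
        unfolding Mn_def
        by (rule measurable_compose[OF measurable_merge ghost_sup_measurable[unfolded K_def]]) auto
      then show "(\<lambda>X. \<integral>Y. ghost_sup (\<lambda>_. 1) (merge {..<n} {n..<2*n} (X, Y)) \<partial>PiM {n..<2*n} (\<lambda>_. M)) \<in> borel_measurable Mn"
        by (intro J.borel_measurable_lebesgue_integral) (simp add: case_prod_beta)
      fix X assume X: "X \<in> space Mn"
      show "\<bar>\<integral>Y. ghost_sup (\<lambda>_. 1) (merge {..<n} {n..<2*n} (X, Y)) \<partial>PiM {n..<2*n} (\<lambda>_. M)\<bar> \<le> n"
        using measurable_compose[OF measurable_Pair1'[OF X] mm]
        by (intro J.abs_integral_le_bound ghost_sup_bound) auto
    qed
  qed (rule dev_le_ghost)
  ultimately show ?thesis by simp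
qed

text \<open>
  Exchanging the \<open>i\<close>-th point of the sample with its partner \<open>i + n\<close> preserves the law of the
  double sample and flips the sign of the \<open>i\<close>-th difference.
\<close>

lemma integral_ghost_sup_swap:
  assumes s: "s \<in> signs {..<n}"
  shows "(\<integral>\<omega>. ghost_sup s \<omega> \<partial>K) = (\<integral>\<omega>. ghost_sup (\<lambda>_. 1) \<omega> \<partial>K)"
proof -
  let ?L = "{..<n} \<union> {n..<2*n}"
  (* the transposition of i and i + n wherever s i = -1; an involution *)
  define t where "t i = (if i < n then if s i = -1 then i + n else i else if s (i - n) = -1 then i - n else i)" for i
  have inj: "inj_on t ?L"
    by (rule inj_on_inverseI[of _ t]) (auto simp: t_def)
  have tL: "t \<in> ?L \<rightarrow> ?L" by (auto simp: t_def split: if_splits)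
  have d: "distr K K (\<lambda>\<omega>. \<lambda>i\<in>?L. \<omega> (t i)) = K"
    using distr_PiM_reindex[of ?L "\<lambda>_. M" t ?L] prob_space_axioms inj tL unfolding K_def by simp
  have m: "(\<lambda>\<omega>. \<lambda>i\<in>?L. \<omega> (t i)) \<in> measurable K K"
    unfolding K_def using tL by (intro measurable_restrict measurable_component_singleton) auto
  have "(\<integral>\<omega>. ghost_sup (\<lambda>_. 1) \<omega> \<partial>K) = (\<integral>\<omega>. ghost_sup (\<lambda>_. 1) \<omega> \<partial>distr K K (\<lambda>\<omega>. \<lambda>i\<in>?L. \<omega> (t i)))" by (simp add: d)
  also have "\<dots> = (\<integral>\<omega>. ghost_sup (\<lambda>_. 1) (\<lambda>i\<in>?L. \<omega> (t i)) \<partial>K)"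
    by (rule integral_distr[OF m ghost_sup_measurable]) simp
  also have "(\<lambda>\<omega>. ghost_sup (\<lambda>_. 1) (\<lambda>i\<in>?L. \<omega> (t i))) = ghost_sup s"
  proof
    fix \<omega>
    have "(\<lambda>_. 1) i * (indicator (H j) ((\<lambda>i\<in>?L. \<omega> (t i)) i) - indicator (H j) ((\<lambda>i\<in>?L. \<omega> (t i)) (i + n)))
       = s i * (indicator (H j) (\<omega> i) - indicator (H j) (\<omega> (i + n)))" if i: "i < n" for i j
    proof -
      have "s i = 1 \<or> s i = -1" using s i by (auto simp: signs_def PiE_def Pi_def)
      then show ?thesis using i by (auto simp: t_def)
    qed
    then show "ghost_sup (\<lambda>_. 1) (\<lambda>i\<in>?L. \<omega> (t i)) = ghost_sup s \<omega>"
      unfolding ghost_sup_def by (intro SUP_cong sum.cong) auto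
  qed
  finally show ?thesis by simp
qed

lemma integral_ghost_sup_le:
  assumes s: "s \<in> signs {..<n}"
  shows "(\<integral>\<omega>. ghost_sup s \<omega> \<partial>K) \<le> (\<integral>X. rademacher_sup s X \<partial>Mn) + (\<integral>X. rademacher_sup (\<lambda>i. - s i) X \<partial>Mn)"
proof -
  let ?L = "{..<n} \<union> {n..<2*n}"
  interpret K: prob_space K by (rule prob_space_K)
  have s1: "\<bar>s i\<bar> \<le> 1" "\<bar>- s i\<bar> \<le> 1" if "i < n" for i using signs_abs[OF s] that by auto
  define p where "p f \<omega> = (\<lambda>i\<in>{..<n}. \<omega> (f i))" for f :: "nat \<Rightarrow> nat" and \<omega> :: "nat \<Rightarrow> 'a"
  have pm: "p f \<in> measurable K Mn" if "f \<in> {..<n} \<rightarrow> ?L" for f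
    unfolding K_def Mn_def p_def using that by (intro measurable_restrict measurable_component_singleton) auto
  have pr: "(\<integral>\<omega>. rademacher_sup z (p f \<omega>) \<partial>K) = (\<integral>X. rademacher_sup z X \<partial>Mn)"
    if "inj_on f {..<n}" "f \<in> {..<n} \<rightarrow> ?L" "\<And>i. i < n \<Longrightarrow> \<bar>z i\<bar> \<le> 1" for f z
  proof -
    have "distr K Mn (p f) = Mn"
      using distr_PiM_reindex[of ?L "\<lambda>_. M" f "{..<n}"] prob_space_axioms that unfolding K_def Mn_def p_def by simp
    moreover have "(\<integral>X. rademacher_sup z X \<partial>distr K Mn (p f)) = (\<integral>\<omega>. rademacher_sup z (p f \<omega>) \<partial>K)"
      by (rule integral_distr[OF pm[OF that(2)] rademacher_sup_measurable[OF that(3)]])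
    ultimately show ?thesis by simp
  qed
  have f1: "inj_on (\<lambda>i. i) {..<n}" "(\<lambda>i. i) \<in> {..<n} \<rightarrow> ?L" by auto
  have f2: "inj_on (\<lambda>i. i + n) {..<n}" "(\<lambda>i. i + n) \<in> {..<n} \<rightarrow> ?L" by auto
  have int: "integrable K (\<lambda>\<omega>. rademacher_sup z (p f \<omega>))"
    if "f \<in> {..<n} \<rightarrow> ?L" "\<And>i. i < n \<Longrightarrow> \<bar>z i\<bar> \<le> 1" for f z
    using measurable_compose[OF pm[OF that(1)] rademacher_sup_measurable[OF that(2)]] rademacher_sup_bound[OF that(2)]
    by (intro K.integrable_bounded[of _ n]) auto
  have "(\<integral>\<omega>. ghost_sup s \<omega> \<partial>K) \<le> (\<integral>\<omega>. rademacher_sup s (p (\<lambda>i. i) \<omega>) + rademacher_sup (\<lambda>i. - s i) (p (\<lambda>i. i + n) \<omega>) \<partial>K)"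
  proof (rule integral_mono)
    show "integrable K (ghost_sup s)"
      using ghost_sup_measurable[OF s1(1)] ghost_sup_bound[OF s1(1)] by (intro K.integrable_bounded[of _ n]) auto
    show "integrable K (\<lambda>\<omega>. rademacher_sup s (p (\<lambda>i. i) \<omega>) + rademacher_sup (\<lambda>i. - s i) (p (\<lambda>i. i + n) \<omega>))"
      using s1 f1 f2 by (intro Bochner_Integration.integrable_add int) auto
    fix \<omega>
    show "ghost_sup s \<omega> \<le> rademacher_sup s (p (\<lambda>i. i) \<omega>) + rademacher_sup (\<lambda>i. - s i) (p (\<lambda>i. i + n) \<omega>)"
      unfolding ghost_sup_def
    proof (rule cSUP_least)
      fix j
      have "(\<Sum>i<n. s i * (indicator (H j) (\<omega> i) - indicator (H j) (\<omega> (i + n))))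
        = (\<Sum>i<n. s i * indicator (H j) (p (\<lambda>i. i) \<omega> i)) + (\<Sum>i<n. (- s i) * indicator (H j) (p (\<lambda>i. i + n) \<omega> i))"
        unfolding sum.distrib[symmetric] by (intro sum.cong) (auto simp: p_def algebra_simps)
      also have "\<dots> \<le> rademacher_sup s (p (\<lambda>i. i) \<omega>) + rademacher_sup (\<lambda>i. - s i) (p (\<lambda>i. i + n) \<omega>)"
        unfolding rademacher_sup_def
        by (rule add_mono; rule cSUP_upper[OF UNIV_I bdd_above_range_abs[OF rademacher_sup_term_bound]]; rule s1)
      finally show "(\<Sum>i<n. s i * (indicator (H j) (\<omega> i) - indicator (H j) (\<omega> (i + n)))) \<le> \<dots>" .
    qed simp
  qed
  also have "\<dots> = (\<integral>X. rademacher_sup s X \<partial>Mn) + (\<integral>X. rademacher_sup (\<lambda>i. - s i) X \<partial>Mn)"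
    using pr[OF f1 s1(1)] pr[OF f2 s1(2)] int[OF f1(2) s1(1)] int[OF f2(2) s1(2)]
    by (subst Bochner_Integration.integral_add) auto
  finally show ?thesis .
qed

text \<open>
  Symmetrization: average the bound for the double sample over all sign vectors and treat the two
  halves separately. Each contributes \<open>10 \<surd>(V n)\<close>.
\<close>

lemma expectation_dev_le: "(\<integral>X. dev X \<partial>Mn) \<le> 20 * sqrt (V / n)"
proof -
  interpret Mn: prob_space Mn by (rule prob_space_Mn)
  let ?S = "sign_avg {..<n}"
  have rint: "integrable Mn (rademacher_sup s)" if "s \<in> signs {..<n}" for s
    using rademacher_sup_measurable[of s] rademacher_sup_bound[of s] signs_abs[OF that] by (intro Mn.integrable_bounded[of _ n]) auto
  have "n * (\<integral>X. dev X \<partial>Mn) \<le> (\<integral>\<omega>. ghost_sup (\<lambda>_. 1) \<omega> \<partial>K)" by (rule integral_dev_le_ghost_sup)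
  also have "\<dots> = ?S (\<lambda>s. \<integral>\<omega>. ghost_sup (\<lambda>_. 1) \<omega> \<partial>K)" by (simp add: sign_avg_const)
  also have "\<dots> \<le> ?S (\<lambda>s. (\<integral>X. rademacher_sup s X \<partial>Mn) + (\<integral>X. rademacher_sup (\<lambda>i. - s i) X \<partial>Mn))"
    using integral_ghost_sup_swap integral_ghost_sup_le by (intro sign_avg_mono) metis
  also have "\<dots> = ?S (\<lambda>s. \<integral>X. rademacher_sup s X \<partial>Mn) + ?S (\<lambda>s. \<integral>X. rademacher_sup (\<lambda>i. - s i) X \<partial>Mn)" by (rule sign_avg_add)
  also have "?S (\<lambda>s. \<integral>X. rademacher_sup (\<lambda>i. - s i) X \<partial>Mn) = ?S (\<lambda>s. \<integral>X. rademacher_sup s X \<partial>Mn)"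
  proof (rule sign_avg_uminus[where h = "\<lambda>s. \<integral>X. rademacher_sup s X \<partial>Mn"])
    fix s s' :: "nat \<Rightarrow> real" assume "\<And>i. i \<in> {..<n} \<Longrightarrow> s i = s' i"
    then have "rademacher_sup s = rademacher_sup s'" unfolding rademacher_sup_def by (intro ext SUP_cong sum.cong) auto
    then show "(\<integral>X. rademacher_sup s X \<partial>Mn) = (\<integral>X. rademacher_sup s' X \<partial>Mn)" by simp
  qed simp
  also have "?S (\<lambda>s. \<integral>X. rademacher_sup s X \<partial>Mn) = (\<integral>X. ?S (\<lambda>s. rademacher_sup s X) \<partial>Mn)"
    unfolding sign_avg_def using rint by simp
  also have "\<dots> \<le> (\<integral>X. 10 * sqrt (real n * real V) \<partial>Mn)"
  proof (rule integral_mono)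
    show "integrable Mn (\<lambda>X. ?S (\<lambda>s. rademacher_sup s X))" unfolding sign_avg_def using rint by (intro integrable_divide Bochner_Integration.integrable_sum) auto
  qed (auto intro: sign_avg_rademacher_sup_le)
  also have "\<dots> = 10 * sqrt (real n * real V)" by (simp add: Mn.prob_space)
  finally have "n * (\<integral>X. dev X \<partial>Mn) \<le> 20 * sqrt (real n * real V)" by simp
  also have "\<dots> = n * (20 * sqrt (V / n))"
  proof -
    have "real n * sqrt (V / n) = sqrt ((real n)\<^sup>2) * sqrt (V / n)" by simp
    also have "\<dots> = sqrt ((real n)\<^sup>2 * (V / n))" by (rule real_sqrt_mult[symmetric])
    also have "(real n)\<^sup>2 * (V / n) = real n * real V" using n by (simp add: power2_eq_square)
    finally show ?thesis by simp
  qed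
  finally show ?thesis using n by simp
qed

theorem prob_dev_le:
  assumes \<delta>: "0 < \<delta>" "\<delta> < 1"
  shows "measure Mn {X \<in> space Mn. \<forall>j. (\<Sum>i<n. indicator (H j) (X i)) / n - prob (H j)
      \<le> 20 * sqrt (V / n) + sqrt (2 * ln (1 / \<delta>) / n)} \<ge> 1 - \<delta>"
proof -
  interpret Mn: prob_space Mn by (rule prob_space_Mn)
  define t where "t = sqrt (2 * ln (1 / \<delta>) / n)"
  have ln: "ln (1 / \<delta>) > 0" using \<delta> by simp
  have t: "t > 0" unfolding t_def using ln n by simp
  have "1 - \<delta> = 1 - exp (- t\<^sup>2 / (2 * (1 / real n)\<^sup>2 * card {..<n}))"
  proof -
    have "t\<^sup>2 = 2 * ln (1 / \<delta>) / n" using ln n by (simp add: t_def)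
    then have "- t\<^sup>2 / (2 * (1 / real n)\<^sup>2 * card {..<n}) = ln \<delta>"
      using n \<delta> by (simp add: power2_eq_square ln_div)
    then show ?thesis using \<delta> by simp
  qed
  also have "\<dots> \<le> measure Mn {X \<in> space Mn. dev X \<le> (\<integral>X. dev X \<partial>Mn) + t}"
    unfolding Mn_def
    by (rule bounded_differences_tail[OF prob_space_axioms _ _ dev_measurable[unfolded Mn_def] dev_bound dev_diff])
       (use n t in \<open>auto simp: lessThan_empty_iff\<close>)
  also have "\<dots> \<le> measure Mn {X \<in> space Mn. \<forall>j. (\<Sum>i<n. indicator (H j) (X i)) / n - prob (H j)
      \<le> 20 * sqrt (V / n) + t}"
  proof (rule Mn.finite_measure_mono)
    show "{X \<in> space Mn. dev X \<le> (\<integral>X. dev X \<partial>Mn) + t} \<subseteq> {X \<in> space Mn. \<forall>j. (\<Sum>i<n. indicator (H j) (X i)) / n - prob (H j)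
      \<le> 20 * sqrt (V / n) + t}"
    proof clarify
      fix X j assume X: "dev X \<le> (\<integral>X. dev X \<partial>Mn) + t"
      have "(\<Sum>i<n. indicator (H j) (X i)) / n - prob (H j) \<le> dev X"
        unfolding dev_def by (intro cSUP_upper bdd_above_range_abs[OF dev_term_bound]) auto
      then show "(\<Sum>i<n. indicator (H j) (X i)) / n - prob (H j) \<le> 20 * sqrt (V / n) + t"
        using X expectation_dev_le by linarith
    qed
    have "(\<lambda>X. (\<Sum>i<n. indicator (H j) (X i)) / n - prob (H j)) \<in> borel_measurable Mn" for j
      unfolding Mn_def
      by (intro borel_measurable_diff borel_measurable_divide borel_measurable_sum ind_comp borel_measurable_const) auto
    then show "{X \<in> space Mn. \<forall>j. (\<Sum>i<n. indicator (H j) (X i)) / n - prob (H j) \<le> 20 * sqrt (V / n) + t} \<in> sets Mn"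
      by measurable
  qed
  finally show ?thesis unfolding t_def .
qed

end

section \<open>Uniform deviations over halfspaces\<close>

lemma space_Rd: "space (Rd d) = ({..<d} \<rightarrow>\<^sub>E UNIV)"
  by (simp add: Rd_def space_PiM)

lemma restrict_in_Rd [simp]: "(\<lambda>i\<in>{..<d}. f i) \<in> space (Rd d)"
  by (simp add: space_Rd)

lemma ip_cong: "(\<And>i. i < d \<Longrightarrow> x i = x' i) \<Longrightarrow> (\<And>i. i < d \<Longrightarrow> y i = y' i) \<Longrightarrow> ip d x y = ip d x' y'"
  unfolding ip_def by (intro sum.cong) auto

lemma ip_commute: "ip d x y = ip d y x"
  by (simp add: ip_def mult.commute)

lemma component_measurable_Rd [measurable]: "i < d \<Longrightarrow> (\<lambda>x. x i) \<in> borel_measurable (Rd d)"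
  unfolding Rd_def by (rule measurable_component_singleton) simp

lemma ip_measurable_Rd [measurable]: "(\<lambda>x. ip d x u) \<in> borel_measurable (Rd d)"
  unfolding ip_def by (intro borel_measurable_sum borel_measurable_times) auto

lemma distributionsD:
  assumes "M \<in> distributions d"
  shows "prob_space M" "sets M = sets (Rd d)" "space M = space (Rd d)"
  using assms sets_eq_imp_space_eq by (auto simp: distributions_def)

lemma halfspace_in_sets:
  assumes "sets M = sets (Rd d)"
  shows "{y \<in> space M. ip d y u \<le> t} \<in> sets M"
proof -
  have "(\<lambda>y. ip d y u) \<in> borel_measurable M"
    using ip_measurable_Rd by (simp add: measurable_cong_sets[OF assms refl])
  then show ?thesis by measurable
qed

text \<open>
  Gaussian elimination of one unknown and one equation.
\<close>

lemma homogeneous_system_solvable: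
  fixes A :: "nat \<Rightarrow> 'i \<Rightarrow> real"
  assumes "finite I" "m < card I"
  shows "\<exists>c. (\<exists>i\<in>I. c i \<noteq> 0) \<and> (\<forall>e<m. (\<Sum>i\<in>I. c i * A e i) = 0)"
  using assms
proof (induction m arbitrary: I A)
  case 0
  then have "I \<noteq> {}" by auto
  then show ?case by (intro exI[of _ "\<lambda>_. 1"]) auto
next
  case (Suc m)
  show ?case
  proof (cases "\<forall>i\<in>I. A m i = 0")
    case True
    obtain c where c: "\<exists>i\<in>I. c i \<noteq> 0" "\<forall>e<m. (\<Sum>i\<in>I. c i * A e i) = 0"
      using Suc.IH[OF Suc.prems(1), of A] Suc.prems(2) by auto
    have "(\<Sum>i\<in>I. c i * A m i) = 0" using True by (intro sum.neutral) auto
    then have "\<forall>e<Suc m. (\<Sum>i\<in>I. c i * A e i) = 0" using c(2) by (auto simp: less_Suc_eq)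
    then show ?thesis using c(1) by blast
  next
    case False
    then obtain p where p: "p \<in> I" "A m p \<noteq> 0" by blast
    define J where "J = I - {p}"
    define B where "B e i = A e i - A m i / A m p * A e p" for e i
    have J: "finite J" "m < card J" "p \<notin> J" and I: "I = insert p J"
      using Suc.prems p by (auto simp: J_def)
    obtain c where c: "\<exists>i\<in>J. c i \<noteq> 0" "\<And>e. e < m \<Longrightarrow> (\<Sum>i\<in>J. c i * B e i) = 0"
      using Suc.IH[OF J(1,2), of B] by blast
    define s where "s = (\<Sum>i\<in>J. c i * A m i)"
    define c' where "c' i = (if i = p then - s / A m p else c i)" for i
    have split: "(\<Sum>i\<in>I. c' i * A e i) = (\<Sum>i\<in>J. c i * A e i) - s / A m p * A e p" for e
    proof -
      have "(\<Sum>i\<in>J. c' i * A e i) = (\<Sum>i\<in>J. c i * A e i)"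
        using J(3) by (intro sum.cong) (auto simp: c'_def)
      then show ?thesis using J by (simp add: I c'_def)
    qed
    have "(\<Sum>i\<in>I. c' i * A e i) = 0" if "e < Suc m" for e
    proof (cases "e = m")
      case True
      then show ?thesis using p by (simp add: split s_def)
    next
      case False
      then have "e < m" using that by simp
      have "(\<Sum>i\<in>J. c i * B e i) = (\<Sum>i\<in>J. c i * A e i) - (\<Sum>i\<in>J. c i * A m i) / A m p * A e p"
        by (simp add: B_def algebra_simps sum_subtractf sum_distrib_left sum_divide_distrib)
      then show ?thesis using c(2)[OF \<open>e < m\<close>] by (simp add: split s_def)
    qed
    moreover have "\<exists>i\<in>I. c' i \<noteq> 0" using c(1) J(3) by (auto simp: I c'_def)
    ultimately show ?thesis by blast
  qed
qed

text \<open>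
  An affine dependence among more than \<open>d + 1\<close> points splits them by the sign of its coefficients;
  a halfspace containing exactly one of the parts would make a vanishing sum negative. Hence
  halfspaces shatter at most \<open>d + 1\<close> points. The points are indexed, so coinciding points are
  covered.
\<close>

lemma radon_partition:
  fixes X :: "nat \<Rightarrow> point"
  assumes "finite S" "d + 1 < card S"
  obtains P N where "P \<subseteq> S" "N \<subseteq> S" "P \<inter> N = {}"
    "\<And>u t. (\<And>i. i \<in> P \<Longrightarrow> ip d (X i) u \<le> t) \<Longrightarrow> (\<And>i. i \<in> N \<Longrightarrow> ip d (X i) u > t) \<Longrightarrow> False"
proof -
  obtain c where c: "\<exists>i\<in>S. c i \<noteq> 0"
    "\<And>e. e < d + 1 \<Longrightarrow> (\<Sum>i\<in>S. c i * (if e < d then X i e else 1)) = 0"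
    using homogeneous_system_solvable[OF assms, of "\<lambda>e i. if e < d then X i e else 1"] by blast
  have c1: "(\<Sum>i\<in>S. c i) = 0" using c(2)[of d] by simp
  have cX: "(\<Sum>i\<in>S. c i * X i e) = 0" if "e < d" for e using c(2)[of e] that by simp
  define P N where "P = {i\<in>S. c i > 0}" and "N = {i\<in>S. c i < 0}"
  have N: "N \<noteq> {}"
  proof
    assume "N = {}"
    then have "\<And>i. i \<in> S \<Longrightarrow> c i \<ge> 0" by (auto simp: N_def not_less)
    then have "\<forall>i\<in>S. c i = 0" using c1 assms(1) by (simp add: sum_nonneg_eq_0_iff)
    then show False using c(1) by blast
  qed
  show ?thesis
  proof (rule that[of P N])
    fix u :: point and t assume P: "\<And>i. i \<in> P \<Longrightarrow> ip d (X i) u \<le> t" and Nt: "\<And>i. i \<in> N \<Longrightarrow> ip d (X i) u > t"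
    have "(\<Sum>i\<in>S. c i * ip d (X i) u) = (\<Sum>e<d. (\<Sum>i\<in>S. c i * X i e) * u e)"
      unfolding ip_def sum_distrib_left sum_distrib_right by (subst sum.swap) (simp add: mult_ac)
    also have "\<dots> = 0" using cX by simp
    finally have "(\<Sum>i\<in>S. c i * (ip d (X i) u - t)) = 0"
      using c1 by (simp add: right_diff_distrib sum_subtractf flip: sum_distrib_right)
    moreover have "(\<Sum>i\<in>S. c i * (ip d (X i) u - t)) < (\<Sum>i\<in>S. 0)"
    proof (rule sum_strict_mono_ex1[OF assms(1)])
      show "\<forall>i\<in>S. c i * (ip d (X i) u - t) \<le> 0"
      proof
        fix i assume "i \<in> S"
        then consider "i \<in> P" | "i \<in> N" | "c i = 0" by (force simp: P_def N_def)
        then show "c i * (ip d (X i) u - t) \<le> 0"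
          using P[of i] Nt[of i] by cases (auto simp: P_def N_def mult_le_0_iff)
      qed
      obtain i where "i \<in> N" using N by blast
      then show "\<exists>i\<in>S. c i * (ip d (X i) u - t) < 0"
        using Nt[of i] by (intro bexI[of _ i]) (auto simp: N_def mult_less_0_iff)
    qed
    ultimately show False by simp
  qed (auto simp: P_def N_def)
qed

definition rational_points :: "nat \<Rightarrow> point set" where
  "rational_points d = ({..<d} \<rightarrow>\<^sub>E \<rat>)"

lemma countable_rational_points: "countable (rational_points d)"
  unfolding rational_points_def by (intro countable_PiE) (auto simp: countable_rat)

lemma rational_approx:
  assumes "\<epsilon> > 0"
  obtains v where "v \<in> rational_points d" "\<And>i. i < d \<Longrightarrow> \<bar>v i - u i\<bar> \<le> \<epsilon>"
proof -
  have "\<exists>q. q \<in> \<rat> \<and> \<bar>q - u i\<bar> \<le> \<epsilon>" for i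
    using Rats_dense_in_real[of "u i - \<epsilon>" "u i + \<epsilon>"] assms by (force simp: abs_le_iff)
  then obtain q where "\<And>i. q i \<in> \<rat> \<and> \<bar>q i - u i\<bar> \<le> \<epsilon>" by metis
  then show ?thesis by (intro that[of "\<lambda>i\<in>{..<d}. q i"]) (auto simp: rational_points_def)
qed

lemma ip_diff_right: "ip d y u - ip d y v = ip d y (\<lambda>i. u i - v i)"
  by (simp add: ip_def sum_subtractf right_diff_distrib)

lemma abs_ip_le:
  assumes "\<And>i. i < d \<Longrightarrow> \<bar>w i\<bar> \<le> \<epsilon>"
  shows "\<bar>ip d y w\<bar> \<le> (\<Sum>i<d. \<bar>y i\<bar>) * \<epsilon>"
proof -
  have "\<bar>ip d y w\<bar> \<le> (\<Sum>i<d. \<bar>y i * w i\<bar>)" unfolding ip_def by (rule sum_abs)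
  also have "\<dots> \<le> (\<Sum>i<d. \<bar>y i\<bar> * \<epsilon>)"
    using assms by (intro sum_mono) (auto simp: abs_mult intro!: mult_left_mono)
  finally show ?thesis by (simp add: sum_distrib_right)
qed

text \<open>
  A closed halfspace is a pointwise limit of rational ones if the offsets approach \<open>t\<close> from above
  more slowly than the directions approach \<open>u\<close>: then each point of the halfspace, also on its
  boundary, is eventually contained in the approximations.
\<close>

lemma halfspace_rational_limit:
  obtains v q where "\<And>k. v k \<in> rational_points d" "\<And>k. q k \<in> \<rat>"
    "\<And>y. eventually (\<lambda>k. ip d y (v k) \<le> q k \<longleftrightarrow> ip d y u \<le> t) sequentially"
proof -
  have "\<exists>v. v \<in> rational_points d \<and> (\<forall>i<d. \<bar>v i - u i\<bar> \<le> inverse (real (Suc k)) ^ 2)" for k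
    using rational_approx[of "inverse (real (Suc k)) ^ 2" d u] by (metis of_nat_0_less_iff positive_imp_inverse_positive zero_less_Suc zero_less_power)
  (* directions converge at rate 1/k^2, offsets from above at rate 1/k *)
  then obtain v where v: "\<And>k. v k \<in> rational_points d" "\<And>k i. i < d \<Longrightarrow> \<bar>v k i - u i\<bar> \<le> inverse (real (Suc k)) ^ 2" by metis
  have "\<exists>q\<in>\<rat>. t + inverse (real (Suc k)) < q \<and> q < t + 2 * inverse (real (Suc k))" for k
    by (rule Rats_dense_in_real) simp
  then obtain q where q: "\<And>k. q k \<in> \<rat>" "\<And>k. t + inverse (real (Suc k)) < q k" "\<And>k. q k < t + 2 * inverse (real (Suc k))" by metis
  have inv0: "(\<lambda>k. inverse (real (Suc k))) \<longlonglongrightarrow> 0" by (rule LIMSEQ_inverse_real_of_nat)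
  have q_lim: "q \<longlonglongrightarrow> t"
  proof (rule real_tendsto_sandwich)
    have "(\<lambda>k. t + c * inverse (real (Suc k))) \<longlonglongrightarrow> t + c * 0" for c by (intro tendsto_intros inv0)
    from this[of 1] this[of 2] show "(\<lambda>k. t + inverse (real (Suc k))) \<longlonglongrightarrow> t" "(\<lambda>k. t + 2 * inverse (real (Suc k))) \<longlonglongrightarrow> t"
      by simp_all
  qed (use q less_imp_le in \<open>blast intro: always_eventually\<close>)+
  have dist: "\<bar>ip d y (v k) - ip d y u\<bar> \<le> (\<Sum>i<d. \<bar>y i\<bar>) * inverse (real (Suc k)) ^ 2" for y k
    unfolding ip_diff_right by (rule abs_ip_le) (use v in auto)
  have ev: "eventually (\<lambda>k. ip d y (v k) \<le> q k \<longleftrightarrow> ip d y u \<le> t) sequentially" for y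
  proof (cases "ip d y u \<le> t")
    case True
    obtain K :: nat where K: "(\<Sum>i<d. \<bar>y i\<bar>) \<le> K" using real_arch_simple by blast
    have "ip d y (v k) \<le> q k" if "k \<ge> K" for k
    proof -
      have "(\<Sum>i<d. \<bar>y i\<bar>) * inverse (real (Suc k)) ^ 2 \<le> real (Suc k) * inverse (real (Suc k)) ^ 2"
        using K that by (intro mult_right_mono) auto
      also have "\<dots> = inverse (real (Suc k))" by (simp add: power2_eq_square del: of_nat_Suc)
      finally show ?thesis using dist[of y k] q(2)[of k] True unfolding abs_le_iff by linarith
    qed
    then show ?thesis using True by (auto simp: eventually_sequentially)
  next
    case False
    have "(\<lambda>k. ip d y (v k) - ip d y u) \<longlonglongrightarrow> 0"
    proof (rule Lim_null_comparison)
      show "\<forall>\<^sub>F k in sequentially. norm (ip d y (v k) - ip d y u) \<le> (\<Sum>i<d. \<bar>y i\<bar>) * inverse (real (Suc k)) ^ 2"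
        using dist by simp
      have "(\<lambda>k. (\<Sum>i<d. \<bar>y i\<bar>) * inverse (real (Suc k)) ^ 2) \<longlonglongrightarrow> (\<Sum>i<d. \<bar>y i\<bar>) * 0 ^ 2"
        by (intro tendsto_intros inv0)
      then show "(\<lambda>k. (\<Sum>i<d. \<bar>y i\<bar>) * inverse (real (Suc k)) ^ 2) \<longlonglongrightarrow> 0" by simp
    qed
    then have "(\<lambda>k. (ip d y (v k) - ip d y u) - q k) \<longlonglongrightarrow> 0 - t" by (intro tendsto_diff q_lim)
    moreover have "0 - t > - ip d y u" using False by simp
    ultimately have "\<forall>\<^sub>F k in sequentially. (ip d y (v k) - ip d y u) - q k > - ip d y u"
      by (rule order_tendstoD)
    then show ?thesis by (rule eventually_mono) (use False in auto)
  qed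
  show ?thesis by (rule that[of v q]) (use v q ev in auto)
qed

definition emp_frac :: "nat \<Rightarrow> nat \<Rightarrow> (nat \<Rightarrow> point) \<Rightarrow> point \<Rightarrow> real \<Rightarrow> real" where
  "emp_frac d n X u t = real (card {i. i < n \<and> ip d (X i) u \<le> t}) / n"

lemma sum_indicator_card:
  "(\<Sum>i<n. indicator A (f i)) = real (card {i. i < (n::nat) \<and> f i \<in> A})"
proof -
  have "(\<Sum>i<n. indicator A (f i)) = (\<Sum>i\<in>{i. i < n \<and> f i \<in> A}. 1 :: real)"
    by (intro sum.mono_neutral_cong_right) (auto simp: indicator_def)
  then show ?thesis by simp
qed

text \<open>
  The rational halfspaces and their complements are countable VC classes; the two one-sided bounds
  give an absolute bound, each at the cost of \<open>\<delta>\<close>. It extends to all halfspaces by taking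
  pointwise limits, in the empirical frequencies and, by dominated convergence, in the
  probabilities.
\<close>

theorem uniform_halfspace_deviation:
  assumes M: "M \<in> distributions d" and n: "1 \<le> n" and \<delta>: "0 < \<delta>" "\<delta> < 1"
  defines "\<Delta> \<equiv> 20 * sqrt (real (d + 1) / n) + sqrt (2 * ln (1 / \<delta>) / n)"
  obtains G where "G \<in> sets (sample_law n M)" "measure (sample_law n M) G \<ge> 1 - 2 * \<delta>"
    "\<And>X u t. X \<in> G \<Longrightarrow> \<bar>emp_frac d n X u t - measure M {y \<in> space M. ip d y u \<le> t}\<bar> \<le> \<Delta>"
proof -
  interpret M: prob_space M using distributionsD[OF M] by simp
  interpret L: prob_space "sample_law n M" unfolding sample_law_def by (intro prob_space_PiM M.prob_space_axioms)
  define C where "C = rational_points d \<times> (\<rat> :: real set)"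
  have C: "countable C" "C \<noteq> {}"
    using countable_rational_points[of d] countable_rat rational_approx[of 1 d "\<lambda>_. 0"]
    by (auto simp: C_def intro!: countable_SIGMA)
  define hs where "hs c = {y \<in> space M. ip d y (fst c) \<le> snd c}" for c :: "point \<times> real"
  define H where "H j = hs (from_nat_into C j)" for j
  define H' where "H' j = space M - H j" for j
  have hs: "hs c \<in> sets M" for c unfolding hs_def by (rule halfspace_in_sets[OF distributionsD(2)[OF M]])
  then have Hs: "H j \<in> sets M" "H' j \<in> sets M" for j by (auto simp: H_def H'_def)
  have XM: "X i \<in> space M" if "X \<in> space (PiM {..<n} (\<lambda>_. M))" "i < n" for X i
    using that by (auto simp: space_PiM)
  have vc: "card S \<le> d + 1"
    if X: "X \<in> space (PiM {..<n} (\<lambda>_. M))" and S: "S \<subseteq> {..<n}"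
      and sh: "shatters (range (\<lambda>j. {i\<in>{..<n}. X i \<in> H j})) S \<or> shatters (range (\<lambda>j. {i\<in>{..<n}. X i \<in> H' j})) S" for X S
  proof (rule ccontr)
    assume "\<not> ?thesis"
    then have "d + 1 < card S" by simp
    moreover have "finite S" using S finite_subset by blast
    ultimately obtain P N where PN: "P \<subseteq> S" "N \<subseteq> S" "P \<inter> N = {}"
      "\<And>u t. (\<And>i. i \<in> P \<Longrightarrow> ip d (X i) u \<le> t) \<Longrightarrow> (\<And>i. i \<in> N \<Longrightarrow> ip d (X i) u > t) \<Longrightarrow> False"
      using radon_partition[of S d X] by metis
    have sep: False if "\<And>i. i \<in> P \<Longrightarrow> X i \<in> H j" "\<And>i. i \<in> N \<Longrightarrow> X i \<notin> H j" for j
    proof (rule PN(4))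
      fix i
      show "ip d (X i) (fst (from_nat_into C j)) \<le> snd (from_nat_into C j)" if "i \<in> P"
        using \<open>\<And>i. i \<in> P \<Longrightarrow> X i \<in> H j\<close>[OF that] by (simp add: H_def hs_def)
      show "ip d (X i) (fst (from_nat_into C j)) > snd (from_nat_into C j)" if "i \<in> N"
        using \<open>\<And>i. i \<in> N \<Longrightarrow> X i \<notin> H j\<close>[OF that] XM[OF X, of i] PN(2) S that by (auto simp: H_def hs_def not_le)
    qed
    from sh show False
    proof
      assume "shatters (range (\<lambda>j. {i\<in>{..<n}. X i \<in> H j})) S"
      then obtain j where j: "{i\<in>{..<n}. X i \<in> H j} \<inter> S = P" using PN(1) unfolding shatters_def by blast
      show False by (rule sep[of j]) (use j PN S in blast)+
    next
      assume "shatters (range (\<lambda>j. {i\<in>{..<n}. X i \<in> H' j})) S"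
      then obtain j where j: "{i\<in>{..<n}. X i \<in> H' j} \<inter> S = N" using PN(2) unfolding shatters_def by blast
      show False
      proof (rule sep[of j])
        fix i assume "i \<in> P"
        then have "i \<in> S" "i < n" "i \<notin> N" using PN S by auto
        then show "X i \<in> H j" using j XM[OF X, of i] by (auto simp: H'_def)
      next
        fix i assume "i \<in> N"
        then show "X i \<notin> H j" using j by (auto simp: H'_def)
      qed
    qed
  qed
  interpret A: vc_sample M H n "d + 1" by unfold_locales (use Hs n vc in auto)
  interpret B: vc_sample M H' n "d + 1" by unfold_locales (use Hs n vc in auto)
  have Mn: "sample_law n M = A.Mn" "sample_law n M = B.Mn" by (simp_all add: sample_law_def A.Mn_def B.Mn_def)
  define G1 where "G1 = {X \<in> space (sample_law n M). \<forall>j. (\<Sum>i<n. indicator (H j) (X i)) / n - M.prob (H j) \<le> \<Delta>}"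
  define G2 where "G2 = {X \<in> space (sample_law n M). \<forall>j. (\<Sum>i<n. indicator (H' j) (X i)) / n - M.prob (H' j) \<le> \<Delta>}"
  have G1: "L.prob G1 \<ge> 1 - \<delta>" and G2: "L.prob G2 \<ge> 1 - \<delta>"
    using A.prob_dev_le[OF \<delta>] B.prob_dev_le[OF \<delta>] by (simp_all add: G1_def G2_def Mn[symmetric] \<Delta>_def)
  have ms: "(\<lambda>X. (\<Sum>i<n. indicator E (X i)) / n - M.prob E) \<in> borel_measurable (sample_law n M)"
    if "E \<in> sets M" for E
  proof -
    have "(\<lambda>X. indicator E (X i) :: real) \<in> borel_measurable (sample_law n M)" if "i < n" for i
      unfolding sample_law_def
      using that \<open>E \<in> sets M\<close> by (intro measurable_compose[OF measurable_component_singleton borel_measurable_indicator]) auto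
    then show ?thesis by (intro borel_measurable_diff borel_measurable_divide borel_measurable_sum) auto
  qed
  have s1: "G1 \<in> L.events" unfolding G1_def using ms[OF Hs(1)] by measurable
  have s2: "G2 \<in> L.events" unfolding G2_def using ms[OF Hs(2)] by measurable
  show ?thesis
  proof (rule that[of "G1 \<inter> G2"])
    show "G1 \<inter> G2 \<in> sets (sample_law n M)" using s1 s2 by simp
    have "L.prob (G1 \<union> G2) = L.prob G1 + L.prob G2 - L.prob (G1 \<inter> G2)"
      using s1 s2 by (simp add: L.finite_measure_Union')  (simp add: L.finite_measure_Diff' Int_commute)
    then show "1 - 2 * \<delta> \<le> L.prob (G1 \<inter> G2)" using G1 G2 L.prob_le_1[of "G1 \<union> G2"] by linarith
    fix X u t assume X: "X \<in> G1 \<inter> G2"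
    then have Xs: "X i \<in> space M" if "i < n" for i
      using that XM[of X i] by (simp add: G1_def sample_law_def)
    obtain v q where vq: "\<And>k. v k \<in> rational_points d" "\<And>k. q k \<in> \<rat>"
      "\<And>y. eventually (\<lambda>k. ip d y (v k) \<le> q k \<longleftrightarrow> ip d y u \<le> t) sequentially"
      using halfspace_rational_limit[of d u t] by blast
    define h where "h = {y \<in> space M. ip d y u \<le> t}"
    define hk where "hk k = {y \<in> space M. ip d y (v k) \<le> q k}" for k
    have hm: "h \<in> sets M" "hk k \<in> sets M" for k
      unfolding h_def hk_def by (rule halfspace_in_sets[OF distributionsD(2)[OF M]])+
    have pw: "(\<lambda>k. indicator (hk k) y :: real) \<longlonglongrightarrow> indicator h y" for y
      by (rule tendsto_eventually, rule eventually_mono[OF vq(3)[of y]]) (auto simp: h_def hk_def indicator_def)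
    have "(\<lambda>k. \<integral>y. indicator (hk k) y \<partial>M :: real) \<longlonglongrightarrow> (\<integral>y. indicator h y \<partial>M)"
      by (rule integral_dominated_convergence[where w="\<lambda>_. 1"]) (use hm pw in auto)
    then have l1: "(\<lambda>k. M.prob (hk k)) \<longlonglongrightarrow> M.prob h" using hm by simp
    have "(\<lambda>k. (\<Sum>i<n. indicator (hk k) (X i)) / n) \<longlonglongrightarrow> (\<Sum>i<n. indicator h (X i) :: real) / n"
      by (intro tendsto_intros pw) (use n in auto)
    with l1 have lim: "(\<lambda>k. \<bar>(\<Sum>i<n. indicator (hk k) (X i)) / n - M.prob (hk k)\<bar>)
        \<longlonglongrightarrow> \<bar>(\<Sum>i<n. indicator h (X i)) / n - M.prob h\<bar>"
      by (intro tendsto_rabs tendsto_diff)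
    have "\<bar>(\<Sum>i<n. indicator (hk k) (X i)) / n - M.prob (hk k)\<bar> \<le> \<Delta>" for k
    proof -
      have "(v k, q k) \<in> range (from_nat_into C)" using vq(1,2) C by (simp add: range_from_nat_into C_def)
      then obtain j where j: "from_nat_into C j = (v k, q k)" by (metis rangeE)
      then have Hj: "H j = hk k" by (simp add: H_def hs_def hk_def)
      have a: "(\<Sum>i<n. indicator (hk k) (X i)) / n - M.prob (hk k) \<le> \<Delta>"
        using X by (auto simp: G1_def Hj[symmetric])
      have "(\<Sum>i<n. indicator (H' j) (X i)) = (\<Sum>i<n. 1 - indicator (hk k) (X i) :: real)"
        using Xs by (intro sum.cong) (auto simp: H'_def Hj indicator_def)
      then have "(\<Sum>i<n. indicator (H' j) (X i)) / n = 1 - (\<Sum>i<n. indicator (hk k) (X i)) / n"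
        using n by (simp add: sum_subtractf diff_divide_distrib)
      moreover have "M.prob (H' j) = 1 - M.prob (hk k)" using M.prob_compl[OF hm(2)[of k]] by (simp add: H'_def Hj)
      moreover have "(\<Sum>i<n. indicator (H' j) (X i)) / n - M.prob (H' j) \<le> \<Delta>"
        using X by (auto simp: G2_def)
      ultimately show ?thesis using a by (simp add: abs_le_iff)
    qed
    then have "\<bar>(\<Sum>i<n. indicator h (X i)) / n - M.prob h\<bar> \<le> \<Delta>"
      by (intro LIMSEQ_le_const2[OF lim]) auto
    moreover have "(\<Sum>i<n. indicator h (X i) :: real) = card {i. i < n \<and> ip d (X i) u \<le> t}"
      unfolding sum_indicator_card using Xs by (intro arg_cong[where f=real] arg_cong[where f=card]) (auto simp: h_def)
    ultimately show "\<bar>emp_frac d n X u t - M.prob {y \<in> space M. ip d y u \<le> t}\<bar> \<le> \<Delta>"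
      by (simp add: emp_frac_def h_def)
  qed
qed

section \<open>Lebesgue measure under affine maps\<close>

abbreviation leb :: "nat set \<Rightarrow> point measure" where
  "leb I \<equiv> PiM I (\<lambda>_. lborel)"

interpretation lb: product_sigma_finite "\<lambda>_::nat. lborel :: real measure" ..

lemma space_leb: "space (leb I) = I \<rightarrow>\<^sub>E UNIV"
  by (simp add: space_PiM)

lemma sets_leb_Rd: "sets (leb {..<d}) = sets (Rd d)"
  unfolding Rd_def by (intro sets_PiM_cong) auto

lemma space_leb_Rd: "space (leb {..<d}) = space (Rd d)"
  by (simp add: space_leb space_Rd)

lemma distr_leb_coordinatewise:
  assumes "finite I" and [measurable]: "\<And>i. g i \<in> borel_measurable borel"
    and g: "\<And>i. distr lborel borel (g i) = lborel"
  shows "distr (leb I) (leb I) (\<lambda>x. \<lambda>i\<in>I. g i (x i)) = leb I"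
proof (rule lb.PiM_eqI[OF assms(1)])
  fix A :: "nat \<Rightarrow> real set" assume A: "\<And>i. i \<in> I \<Longrightarrow> A i \<in> sets lborel"
  have m: "(\<lambda>x. \<lambda>i\<in>I. g i (x i)) \<in> measurable (leb I) (leb I)"
    by (intro measurable_restrict) measurable
  have "emeasure (distr (leb I) (leb I) (\<lambda>x. \<lambda>i\<in>I. g i (x i))) (Pi\<^sub>E I A)
      = emeasure (leb I) ((\<lambda>x. \<lambda>i\<in>I. g i (x i)) -` (Pi\<^sub>E I A) \<inter> space (leb I))"
    using A assms(1) by (intro emeasure_distr m sets_PiM_I_finite) auto
  also have "(\<lambda>x. \<lambda>i\<in>I. g i (x i)) -` (Pi\<^sub>E I A) \<inter> space (leb I) = Pi\<^sub>E I (\<lambda>i. g i -` A i)"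
    by (auto simp: space_leb PiE_iff)
  also have "emeasure (leb I) \<dots> = (\<Prod>i\<in>I. emeasure lborel (g i -` A i))"
    using A assms(1) measurable_sets[of "g _" borel borel] by (intro lb.emeasure_PiM) auto
  also have "\<dots> = (\<Prod>i\<in>I. emeasure lborel (A i))"
  proof (rule prod.cong)
    fix i assume "i \<in> I"
    then have "emeasure (distr lborel borel (g i)) (A i) = emeasure lborel (g i -` A i)"
      using A[of i] by (subst emeasure_distr) auto
    then show "emeasure lborel (g i -` A i) = emeasure lborel (A i)" by (simp add: g)
  qed simp
  finally show "emeasure (distr (leb I) (leb I) (\<lambda>x. \<lambda>i\<in>I. g i (x i))) (Pi\<^sub>E I A) = (\<Prod>i\<in>I. emeasure lborel (A i))" .
qed simp

lemma distr_lborel_minus: "distr lborel borel (\<lambda>t. v - t) = (lborel :: real measure)"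
proof -
  have "distr lborel borel (\<lambda>t. v - t) = distr (distr lborel borel uminus) borel ((+) v)"
    by (subst distr_distr) (auto simp: comp_def)
  then show ?thesis by (simp add: lborel_distr_uminus lborel_distr_plus)
qed

lemma nn_integral_leb_shift:
  assumes "finite I" and f: "f \<in> borel_measurable (leb I)"
  shows "(\<integral>\<^sup>+x. f (\<lambda>i\<in>I. v i + x i) \<partial>leb I) = (\<integral>\<^sup>+x. f x \<partial>leb I)"
proof -
  have "(\<integral>\<^sup>+x. f x \<partial>distr (leb I) (leb I) (\<lambda>x. \<lambda>i\<in>I. v i + x i)) = (\<integral>\<^sup>+x. f (\<lambda>i\<in>I. v i + x i) \<partial>leb I)"
  proof (rule nn_integral_distr)
    show "(\<lambda>x. \<lambda>i\<in>I. v i + x i) \<in> measurable (leb I) (leb I)"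
      by (intro measurable_restrict) measurable
  qed (simp only: measurable_distr_eq1 f)
  moreover have "distr lborel borel (\<lambda>t. v i + t) = lborel" for i
    using lborel_distr_plus[of "v i"] by simp
  ultimately show ?thesis using distr_leb_coordinatewise[OF assms(1), of "\<lambda>i t. v i + t"] by simp
qed

lemma nn_integral_leb_reflect:
  assumes "finite I" and f: "f \<in> borel_measurable (leb I)"
  shows "(\<integral>\<^sup>+x. f (\<lambda>i\<in>I. v i - x i) \<partial>leb I) = (\<integral>\<^sup>+x. f x \<partial>leb I)"
proof -
  have "(\<integral>\<^sup>+x. f x \<partial>distr (leb I) (leb I) (\<lambda>x. \<lambda>i\<in>I. v i - x i)) = (\<integral>\<^sup>+x. f (\<lambda>i\<in>I. v i - x i) \<partial>leb I)"
  proof (rule nn_integral_distr)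
    show "(\<lambda>x. \<lambda>i\<in>I. v i - x i) \<in> measurable (leb I) (leb I)"
      by (intro measurable_restrict) measurable
  qed (simp only: measurable_distr_eq1 f)
  then show ?thesis using distr_leb_coordinatewise[OF assms(1), of "\<lambda>i t. v i - t"] distr_lborel_minus by simp
qed

definition lincomb :: "nat \<Rightarrow> nat \<Rightarrow> (nat \<Rightarrow> point) \<Rightarrow> point \<Rightarrow> point" where
  "lincomb d m b c = (\<lambda>i\<in>{..<d}. \<Sum>j<m. c j * b j i)"

lemma lincomb_in_space [simp]: "lincomb d m b c \<in> space (Rd d)"
  by (simp add: lincomb_def)

lemma lincomb_measurable [measurable]: "lincomb d m b \<in> measurable (leb {..<m}) (leb {..<d})"
  unfolding lincomb_def by (intro measurable_restrict) measurable

text \<open>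
  Both sides are the double integral of \<open>indicator A (T x) * indicator B (T x + y)\<close>, integrated in
  the two possible orders. For fixed \<open>x\<close> the inner integral is the volume of \<open>B\<close> by translation
  invariance. For fixed \<open>y = T w\<close>, which exists by surjectivity, substituting \<open>x - w\<close> for \<open>x\<close>
  moves the shift to \<open>A\<close>. The product form is meaningful without knowing that any of the volumes
  is positive or finite.
\<close>

theorem surjective_linear_scales_lebesgue:
  assumes surj: "\<And>y. y \<in> space (Rd d) \<Longrightarrow> \<exists>x\<in>space (Rd d). lincomb d d b x = y"
    and A: "A \<in> sets (Rd d)" and B: "B \<in> sets (Rd d)"
  defines "T \<equiv> lincomb d d b" and "\<mu> \<equiv> emeasure (leb {..<d})"
  shows "\<mu> (T -` A \<inter> space (Rd d)) * \<mu> B = \<mu> (T -` B \<inter> space (Rd d)) * \<mu> A"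
proof -
  let ?L = "leb {..<d}"
  interpret L: finite_product_sigma_finite "\<lambda>_. lborel" "{..<d}" by standard simp
  interpret P: pair_sigma_finite ?L ?L by unfold_locales
  have T[measurable]: "T \<in> measurable ?L ?L" unfolding T_def by measurable
  have [measurable]: "A \<in> sets ?L" "B \<in> sets ?L" using A B by (simp_all add: sets_leb_Rd)
  have preim: "(\<integral>\<^sup>+x. indicator E (T x) \<partial>?L) = \<mu> (T -` E \<inter> space (Rd d))" if "E \<in> sets ?L" for E
  proof -
    have "(\<integral>\<^sup>+x. indicator E (T x) \<partial>?L) = (\<integral>\<^sup>+x. indicator (T -` E \<inter> space ?L) x \<partial>?L)"
      by (intro nn_integral_cong) (auto simp: indicator_def)
    then show ?thesis using measurable_sets[OF T that] by (simp add: \<mu>_def space_leb_Rd)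
  qed
  define pl where "pl x y = (\<lambda>i\<in>{..<d}. x i + y i)" for x y :: point
  define mi where "mi x y = (\<lambda>i\<in>{..<d}. x i - y i)" for x y :: point
  have c1: "(\<lambda>p. T (fst p) i) \<in> borel_measurable (?L \<Otimes>\<^sub>M ?L)" if "i < d" for i
    using measurable_compose[OF measurable_compose[OF measurable_fst T] measurable_component_singleton[of i]] that
    by simp
  have c2: "(\<lambda>p. snd p i) \<in> borel_measurable (?L \<Otimes>\<^sub>M ?L)" if "i < d" for i
    using measurable_compose[OF measurable_snd measurable_component_singleton[of i]] that by simp
  have plm[measurable]: "(\<lambda>(x, y). pl (T x) y) \<in> measurable (?L \<Otimes>\<^sub>M ?L) ?L"
    unfolding pl_def case_prod_beta by (intro measurable_restrict) (auto intro!: borel_measurable_add borel_measurable_diff c1 c2)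
  have mim[measurable]: "(\<lambda>(x, y). mi (T x) y) \<in> measurable (?L \<Otimes>\<^sub>M ?L) ?L"
    unfolding mi_def case_prod_beta by (intro measurable_restrict) (auto intro!: borel_measurable_add borel_measurable_diff c1 c2)
  have "\<mu> (T -` A \<inter> space (Rd d)) * \<mu> B = (\<integral>\<^sup>+x. indicator A (T x) * (\<integral>\<^sup>+y. indicator B y \<partial>?L) \<partial>?L)"
    using preim[of A] by (simp add: nn_integral_multc \<mu>_def)
  also have "\<dots> = (\<integral>\<^sup>+x. (\<integral>\<^sup>+y. indicator A (T x) * indicator B (pl (T x) y) \<partial>?L) \<partial>?L)"
  proof (rule nn_integral_cong)
    fix x assume "x \<in> space ?L"
    have "(\<integral>\<^sup>+y. indicator B (pl (T x) y) \<partial>?L) = (\<integral>\<^sup>+y. indicator B y \<partial>?L)"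
      unfolding pl_def by (rule nn_integral_leb_shift) auto
    moreover have "(\<lambda>y. indicator B (pl (T x) y) :: ennreal) \<in> borel_measurable ?L"
      using measurable_compose[OF measurable_Pair1'[OF \<open>x \<in> space ?L\<close>] measurable_compose[OF plm borel_measurable_indicator[of B]]] by simp
    ultimately show "indicator A (T x) * (\<integral>\<^sup>+y. indicator B y \<partial>?L) = (\<integral>\<^sup>+y. indicator A (T x) * indicator B (pl (T x) y) \<partial>?L)"
      by (simp add: nn_integral_cmult)
  qed
  also have "\<dots> = (\<integral>\<^sup>+y. (\<integral>\<^sup>+x. indicator A (T x) * indicator B (pl (T x) y) \<partial>?L) \<partial>?L)"
    by (rule P.Fubini'[symmetric]) measurable
  also have "\<dots> = (\<integral>\<^sup>+y. (\<integral>\<^sup>+x. indicator A (mi (T x) y) * indicator B (T x) \<partial>?L) \<partial>?L)"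
  proof (rule nn_integral_cong)
    fix y assume y: "y \<in> space ?L"
    then obtain w where w: "w \<in> space (Rd d)" "T w = y" using surj by (auto simp: space_leb_Rd T_def)
    let ?f = "\<lambda>x. indicator A (T x) * indicator B (pl (T x) y) :: ennreal"
    have "?f \<in> borel_measurable ?L"
      using measurable_compose[OF measurable_Pair2'[OF y] measurable_compose[OF plm borel_measurable_indicator[of B]]]
      by (intro borel_measurable_times_ennreal) auto
    then have "(\<integral>\<^sup>+x. ?f x \<partial>?L) = (\<integral>\<^sup>+x. ?f (\<lambda>j\<in>{..<d}. - w j + x j) \<partial>?L)"
      by (intro nn_integral_leb_shift[symmetric]) auto
    also have "\<dots> = (\<integral>\<^sup>+x. indicator A (mi (T x) y) * indicator B (T x) \<partial>?L)"
    proof (rule nn_integral_cong)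
      fix x assume x: "x \<in> space ?L"
      have 1: "T (\<lambda>j\<in>{..<d}. - w j + x j) = mi (T x) y"
        unfolding w(2)[symmetric] mi_def T_def
        by (rule ext) (simp add: lincomb_def algebra_simps sum_subtractf)
      have "pl (mi (T x) y) y = T x" by (rule ext) (auto simp: pl_def mi_def T_def lincomb_def)
      with 1 show "?f (\<lambda>j\<in>{..<d}. - w j + x j) = indicator A (mi (T x) y) * indicator B (T x)" by simp
    qed
    finally show "(\<integral>\<^sup>+x. ?f x \<partial>?L) = \<dots>" .
  qed
  also have "\<dots> = (\<integral>\<^sup>+x. (\<integral>\<^sup>+y. indicator A (mi (T x) y) * indicator B (T x) \<partial>?L) \<partial>?L)"
    by (rule P.Fubini') measurable
  also have "\<dots> = (\<integral>\<^sup>+x. \<mu> A * indicator B (T x) \<partial>?L)"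
  proof (rule nn_integral_cong)
    fix x assume x: "x \<in> space ?L"
    have "(\<integral>\<^sup>+y. indicator A (mi (T x) y) \<partial>?L) = (\<integral>\<^sup>+y. indicator A y \<partial>?L)"
      unfolding mi_def by (rule nn_integral_leb_reflect) auto
    moreover have "(\<lambda>y. indicator A (mi (T x) y) :: ennreal) \<in> borel_measurable ?L"
      using measurable_compose[OF measurable_Pair1'[OF x] measurable_compose[OF mim borel_measurable_indicator[of A]]] by simp
    ultimately show "(\<integral>\<^sup>+y. indicator A (mi (T x) y) * indicator B (T x) \<partial>?L) = \<mu> A * indicator B (T x)"
      by (simp add: nn_integral_multc \<mu>_def)
  qed
  also have "\<dots> = \<mu> (T -` B \<inter> space (Rd d)) * \<mu> A"
    using preim[of B] by (simp add: nn_integral_cmult mult.commute)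
  finally show ?thesis .
qed

lemma borel_measurable_leb_Rd: "borel_measurable (leb {..<d}) = borel_measurable (Rd d)"
  by (rule measurable_cong_sets[OF sets_leb_Rd refl])

lemma emeasure_leb_box:
  assumes "finite I" "l \<le> u"
  shows "emeasure (leb I) (I \<rightarrow>\<^sub>E {l..u}) = ennreal ((u - l) ^ card I)"
  using assms by (simp add: lb.emeasure_PiM ennreal_power)

text \<open>
  By the scaling law the volume of a preimage under the linear part is the volume times that of
  the preimage of the unit cube. This factor is not \<open>0\<close>, since otherwise the whole space would be
  a null set, and it is finite, since the preimage of the cube lies in a box of side \<open>2R\<close>.
  Determinants are not needed because only the existence of the factor matters.
\<close>

theorem affine_change_of_variables:
  assumes surj: "\<And>y. y \<in> space (Rd d) \<Longrightarrow> \<exists>x\<in>space (Rd d). lincomb d d b x = y"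
    and R: "\<And>x j. x \<in> space (Rd d) \<Longrightarrow> (\<And>i. i < d \<Longrightarrow> \<bar>lincomb d d b x i\<bar> \<le> 1) \<Longrightarrow> j < d \<Longrightarrow> \<bar>x j\<bar> \<le> R"
  obtains r where "r > 0" "\<And>(f :: point \<Rightarrow> real) a. f \<in> borel_measurable (Rd d) \<Longrightarrow>
     (\<integral>x. f (\<lambda>i\<in>{..<d}. a i + lincomb d d b x i) \<partial>leb {..<d}) = r * (\<integral>x. f x \<partial>leb {..<d})"
proof -
  let ?L = "leb {..<d}"
  define T where "T = lincomb d d b"
  have T[measurable]: "T \<in> measurable ?L ?L" unfolding T_def by measurable
  define Q where "Q = {..<d} \<rightarrow>\<^sub>E {0..1::real}"
  have Q: "Q \<in> sets ?L" unfolding Q_def by (intro sets_PiM_I_finite) auto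
  have \<mu>Q: "emeasure ?L Q = 1" unfolding Q_def by (subst emeasure_leb_box) auto
  define c where "c = emeasure ?L (T -` Q \<inter> space (Rd d))"
  have scale: "emeasure ?L (T -` A \<inter> space (Rd d)) = c * emeasure ?L A" if "A \<in> sets (Rd d)" for A
    using surjective_linear_scales_lebesgue[OF surj that Q[unfolded sets_leb_Rd]] by (simp add: c_def T_def \<mu>Q)
  have "c \<noteq> 0"
  proof
    assume "c = 0"
    then have "emeasure ?L (T -` space (Rd d) \<inter> space (Rd d)) = 0" using scale[of "space (Rd d)"] by simp
    moreover have "T -` space (Rd d) \<inter> space (Rd d) = space ?L" by (auto simp: T_def space_leb_Rd)
    moreover have "emeasure ?L Q \<le> emeasure ?L (space ?L)" using Q by (intro emeasure_mono sets.sets_into_space) auto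
    ultimately show False by (simp add: \<mu>Q)
  qed
  moreover have "c < \<infinity>"
  proof -
    define R' where "R' = max R 0"
    have "c \<le> emeasure ?L ({..<d} \<rightarrow>\<^sub>E {-R'..R'})"
      unfolding c_def
    proof (rule emeasure_mono)
      show "T -` Q \<inter> space (Rd d) \<subseteq> {..<d} \<rightarrow>\<^sub>E {- R'..R'}"
      proof
        fix x assume x: "x \<in> T -` Q \<inter> space (Rd d)"
        then have TQ: "T x \<in> {..<d} \<rightarrow>\<^sub>E {0..1}" and xs: "x \<in> space (Rd d)" by (auto simp: Q_def)
        have 1: "\<bar>lincomb d d b x i\<bar> \<le> 1" if "i < d" for i
          using PiE_mem[OF TQ, of i] that by (simp add: T_def)
        have "x j \<in> {-R'..R'}" if "j < d" for j
          using R[OF xs 1 that] unfolding R'_def abs_le_iff by (simp add: le_max_iff_disj)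
        then have "\<forall>j<d. x j \<in> {-R'..R'}" by blast
        then show "x \<in> {..<d} \<rightarrow>\<^sub>E {- R'..R'}" using xs by (auto simp: space_Rd PiE_iff simp del: atLeastAtMost_iff)
      qed
      show "{..<d} \<rightarrow>\<^sub>E {- R'..R'} \<in> sets ?L" by (intro sets_PiM_I_finite) auto
    qed
    also have "\<dots> < \<infinity>" by (subst emeasure_leb_box) (auto simp: R'_def)
    finally show ?thesis .
  qed
  ultimately obtain r where r: "r > 0" "c = ennreal r"
    by (metis ennreal_cases ennreal_0 infinity_ennreal_def order_less_irrefl order_le_less)
  have d: "distr ?L ?L T = density ?L (\<lambda>_. ennreal r)"
  proof (rule measure_eqI)
    fix A assume "A \<in> sets (distr ?L ?L T)"
    then have A: "A \<in> sets ?L" by simp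
    have "emeasure (distr ?L ?L T) A = emeasure ?L (T -` A \<inter> space (Rd d))"
      using A T by (simp add: emeasure_distr space_leb_Rd)
    also have "\<dots> = ennreal r * emeasure ?L A" using scale A by (simp add: sets_leb_Rd r)
    also have "\<dots> = emeasure (density ?L (\<lambda>_. ennreal r)) A"
      using A by (simp add: emeasure_density nn_integral_cmult)
    finally show "emeasure (distr ?L ?L T) A = emeasure (density ?L (\<lambda>_. ennreal r)) A" .
  qed simp
  show ?thesis
  proof (rule that[OF r(1)])
    fix f :: "point \<Rightarrow> real" and a :: point assume "f \<in> borel_measurable (Rd d)"
    then have f: "f \<in> borel_measurable ?L" by (simp add: borel_measurable_leb_Rd)
    define s where "s x = (\<lambda>i\<in>{..<d}. a i + x i)" for x :: point
    have s: "s \<in> measurable ?L ?L" unfolding s_def by (intro measurable_restrict) measurable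
    have sd: "distr ?L ?L s = ?L"
      using distr_leb_coordinatewise[of "{..<d}" "\<lambda>i t. a i + t"] lborel_distr_plus[of "a _"] by (simp add: s_def[abs_def])
    have fs: "(\<lambda>x. f (s x)) \<in> borel_measurable ?L" using measurable_compose[OF s f] .
    have "(\<integral>x. f (s (T x)) \<partial>?L) = (\<integral>x. f (s x) \<partial>distr ?L ?L T)" by (rule integral_distr[symmetric, OF T fs])
    also have "\<dots> = (\<integral>x. r * f (s x) \<partial>?L)"
      unfolding d using fs r by (subst integral_density) auto
    also have "\<dots> = r * (\<integral>x. f (s x) \<partial>?L)" by simp
    also have "(\<integral>x. f (s x) \<partial>?L) = (\<integral>x. f x \<partial>distr ?L ?L s)" by (rule integral_distr[symmetric, OF s f])
    finally show "(\<integral>x. f (\<lambda>i\<in>{..<d}. a i + lincomb d d b x i) \<partial>?L) = r * (\<integral>x. f x \<partial>?L)"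
      unfolding sd unfolding s_def T_def .
  qed
qed

section \<open>Orthonormal systems and convex combinations\<close>

definition orthonormal :: "nat \<Rightarrow> nat \<Rightarrow> (nat \<Rightarrow> point) \<Rightarrow> bool" where
  "orthonormal d m b \<longleftrightarrow> (\<forall>i<m. \<forall>j<m. ip d (b i) (b j) = (if i = j then 1 else 0))"

lemma ip_sum_left: "ip d (\<lambda>i. \<Sum>j\<in>J. c j * b j i) y = (\<Sum>j\<in>J. c j * ip d (b j) y)"
  unfolding ip_def sum_distrib_right sum_distrib_left by (subst sum.swap) (simp add: mult_ac)

lemma ip_diff_left: "ip d (\<lambda>i. x i - y i) z = ip d x z - ip d y z"
  by (simp add: ip_def left_diff_distrib sum_subtractf)

lemma ip_add_left: "ip d (\<lambda>i. x i + y i) z = ip d x z + ip d y z"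
  by (simp add: ip_def distrib_right sum.distrib)

lemma ip_scale_left: "ip d (\<lambda>i. c * x i) z = c * ip d x z"
  by (simp add: ip_def sum_distrib_left mult.assoc)

lemma ip_scale_right: "ip d z (\<lambda>i. c * x i) = c * ip d z x"
  by (simp add: ip_def sum_distrib_left mult_ac)

lemma ip_self_nonneg: "0 \<le> ip d x x"
  by (simp add: ip_def sum_nonneg)

lemma ip_self_zero: "ip d x x = 0 \<Longrightarrow> i < d \<Longrightarrow> x i = 0"
  unfolding ip_def by (subst (asm) sum_nonneg_eq_0_iff) auto

lemma orthonormal_coord:
  assumes "orthonormal d m b" "l < m"
  shows "ip d (\<lambda>i. \<Sum>j<m. c j * b j i) (b l) = c l"
proof -
  have "(\<Sum>j<m. c j * ip d (b j) (b l)) = (\<Sum>j<m. if j = l then c l else 0)"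
    using assms by (intro sum.cong) (auto simp: orthonormal_def)
  then show ?thesis using assms(2) by (simp add: ip_sum_left)
qed

lemma orthonormal_norm:
  assumes "orthonormal d m b"
  shows "ip d (\<lambda>i. \<Sum>j<m. c j * b j i) (\<lambda>i. \<Sum>j<m. c j * b j i) = (\<Sum>j<m. (c j)\<^sup>2)"
proof -
  have "ip d (\<lambda>i. \<Sum>j<m. c j * b j i) (\<lambda>i. \<Sum>j<m. c j * b j i) = (\<Sum>l<m. c l * ip d (b l) (\<lambda>i. \<Sum>j<m. c j * b j i))"
    by (rule ip_sum_left)
  also have "\<dots> = (\<Sum>l<m. c l * c l)"
    using orthonormal_coord[OF assms] by (simp add: ip_commute[of d "b _"])
  finally show ?thesis by (simp add: power2_eq_square)
qed

text \<open>
  The component of \<open>x\<close> orthogonal to the system.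
\<close>

definition residual :: "nat \<Rightarrow> nat \<Rightarrow> (nat \<Rightarrow> point) \<Rightarrow> point \<Rightarrow> point" where
  "residual d m b x = (\<lambda>i. x i - (\<Sum>j<m. ip d x (b j) * b j i))"

lemma residual_orth:
  assumes "orthonormal d m b" "l < m"
  shows "ip d (residual d m b x) (b l) = 0"
  using orthonormal_coord[OF assms] by (simp add: residual_def ip_diff_left)

lemma residual_norm:
  assumes "orthonormal d m b"
  shows "ip d (residual d m b x) (residual d m b x) = ip d x x - (\<Sum>j<m. (ip d x (b j))\<^sup>2)"
proof -
  let ?p = "\<lambda>i. \<Sum>j<m. ip d x (b j) * b j i"
  have "ip d ?p x = (\<Sum>j<m. (ip d x (b j))\<^sup>2)"
    by (simp add: ip_sum_left power2_eq_square ip_commute[of d "b _"])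
  moreover have "ip d ?p ?p = (\<Sum>j<m. (ip d x (b j))\<^sup>2)" by (rule orthonormal_norm[OF assms])
  moreover have "ip d (residual d m b x) (residual d m b x) = ip d x x - ip d ?p x - (ip d x ?p - ip d ?p ?p)"
    unfolding residual_def ip_diff_left ip_diff_right[symmetric] by (simp add: ip_commute)
  ultimately show ?thesis by (simp add: ip_commute[of d x ?p])
qed

definition unit_vec :: "nat \<Rightarrow> point" where
  "unit_vec i = (\<lambda>j. if j = i then 1 else 0)"

lemma ip_unit_vec: "i < d \<Longrightarrow> ip d (unit_vec i) y = y i"
proof -
  assume "i < d"
  have "ip d (unit_vec i) y = (\<Sum>j<d. if j = i then y i else 0)"
    unfolding ip_def by (intro sum.cong) (auto simp: unit_vec_def)
  then show ?thesis using \<open>i < d\<close> by simp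
qed

text \<open>
  The left side is the squared length of the projection of the \<open>i\<close>-th coordinate vector. Summed
  over \<open>i\<close> it is \<open>m\<close>, and this trace replaces dimension theory in the lemmas that follow.
\<close>

lemma bessel_unit_vec:
  assumes "orthonormal d m b" "i < d"
  shows "(\<Sum>j<m. (b j i)\<^sup>2) \<le> 1"
    and "(\<Sum>j<m. (b j i)\<^sup>2) = 1 - ip d (residual d m b (unit_vec i)) (residual d m b (unit_vec i))"
proof -
  have "ip d (unit_vec i) (unit_vec i) = 1" using assms by (simp add: ip_unit_vec) (simp add: unit_vec_def)
  then show eq: "(\<Sum>j<m. (b j i)\<^sup>2) = 1 - ip d (residual d m b (unit_vec i)) (residual d m b (unit_vec i))"
    using residual_norm[OF assms(1), of "unit_vec i"] assms(2) by (simp add: ip_unit_vec)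
  then show "(\<Sum>j<m. (b j i)\<^sup>2) \<le> 1" using ip_self_nonneg[of d "residual d m b (unit_vec i)"] by simp
qed

lemma orthonormal_trace:
  assumes "orthonormal d m b"
  shows "(\<Sum>i<d. \<Sum>j<m. (b j i)\<^sup>2) = m"
proof -
  have "(\<Sum>i<d. \<Sum>j<m. (b j i)\<^sup>2) = (\<Sum>j<m. ip d (b j) (b j))"
    unfolding ip_def by (subst sum.swap) (simp add: power2_eq_square)
  also have "\<dots> = (\<Sum>j<m. 1)" using assms by (intro sum.cong) (auto simp: orthonormal_def)
  finally show ?thesis by simp
qed

lemma orthonormal_le:
  assumes "orthonormal d m b"
  shows "m \<le> d"
proof -
  have "real m \<le> (\<Sum>i<d. 1)"
    unfolding orthonormal_trace[OF assms, symmetric] using bessel_unit_vec(1)[OF assms] by (intro sum_mono) auto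
  then show ?thesis by simp
qed

lemma orthonormal_insert:
  assumes b: "orthonormal d m b" and w: "ip d w w > 0" "\<And>j. j < m \<Longrightarrow> ip d w (b j) = 0"
  shows "orthonormal d (Suc m) (b(m := (\<lambda>i. w i / sqrt (ip d w w))))"
proof -
  define s where "s = 1 / sqrt (ip d w w)"
  have eq: "(\<lambda>i. w i / sqrt (ip d w w)) = (\<lambda>i. s * w i)" by (simp add: s_def)
  have "ip d (\<lambda>i. s * w i) (\<lambda>i. s * w i) = s * (s * ip d w w)"
    by (simp only: ip_scale_left ip_scale_right)
  also have "\<dots> = 1" using w(1) by (simp add: s_def)
  finally have 1: "ip d (\<lambda>i. s * w i) (\<lambda>i. s * w i) = 1" .
  have 2: "ip d (\<lambda>i. s * w i) (b j) = 0" "ip d (b j) (\<lambda>i. s * w i) = 0" if "j < m" for j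
    using w(2)[OF that] by (simp_all add: ip_scale_left ip_scale_right ip_commute[of d "b j" w])
  show ?thesis using b 1 2 unfolding orthonormal_def eq by (auto simp: less_Suc_eq)
qed

text \<open>
  If \<open>m < d\<close>, the trace is less than \<open>d\<close>, so some coordinate vector has a nonzero residual, which
  can be normalized and appended.
\<close>

lemma orthonormal_extend:
  assumes "orthonormal d m b"
  shows "\<exists>b'. orthonormal d d b' \<and> (\<forall>j<m. b' j = b j)"
  using assms
proof (induction "d - m" arbitrary: m b)
  case 0
  then have "m = d" using orthonormal_le by fastforce
  then show ?case using 0 by blast
next
  case (Suc k)
  have "\<exists>i<d. (\<Sum>j<m. (b j i)\<^sup>2) < 1"
  proof (rule ccontr)
    assume "\<not> ?thesis"
    then have "1 \<le> (\<Sum>j<m. (b j i)\<^sup>2)" if "i < d" for i using that by (meson not_le)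
    then have "(\<Sum>i<d. 1) \<le> (\<Sum>i<d. \<Sum>j<m. (b j i)\<^sup>2)" by (intro sum_mono) auto
    then show False using orthonormal_trace[OF Suc.prems] Suc.hyps(2) by simp
  qed
  then obtain i where i: "i < d" "(\<Sum>j<m. (b j i)\<^sup>2) < 1" by blast
  let ?w = "residual d m b (unit_vec i)"
  have "ip d ?w ?w > 0" using bessel_unit_vec(2)[OF Suc.prems i(1)] i(2) by simp
  then have "orthonormal d (Suc m) (b(m := (\<lambda>i. ?w i / sqrt (ip d ?w ?w))))"
    using residual_orth[OF Suc.prems] by (intro orthonormal_insert Suc.prems) auto
  moreover have "k = d - Suc m" using Suc.hyps(2) by simp
  ultimately obtain b' where b': "orthonormal d d b'" "\<forall>j<Suc m. b' j = (b(m := (\<lambda>i. ?w i / sqrt (ip d ?w ?w)))) j"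
    using Suc.hyps(1) by blast
  then have "\<forall>j<m. b' j = b j" by simp
  with b' show ?case by blast
qed

text \<open>
  For \<open>m = d\<close> the trace is \<open>d\<close>, so all coordinate vectors have residual \<open>0\<close>.
\<close>

lemma orthonormal_basis_expansion:
  assumes b: "orthonormal d d b" and i: "i < d"
  shows "x i = (\<Sum>j<d. ip d x (b j) * b j i)"
proof -
  have "(\<Sum>i<d. 1 - (\<Sum>j<d. (b j i)\<^sup>2)) = 0" using orthonormal_trace[OF b] by (simp add: sum_subtractf)
  then have "\<forall>l\<in>{..<d}. 1 - (\<Sum>j<d. (b j l)\<^sup>2) = 0"
    by (subst (asm) sum_nonneg_eq_0_iff) (use bessel_unit_vec(1)[OF b] in auto)
  then have res: "ip d (residual d d b (unit_vec l)) (residual d d b (unit_vec l)) = 0" if "l < d" for l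
    using bessel_unit_vec(2)[OF b that] that by simp
  have e: "unit_vec l i = (\<Sum>j<d. b j l * b j i)" if "l < d" for l
    using ip_self_zero[OF res[OF that] i] that by (simp add: residual_def ip_unit_vec)
  have "x i = (\<Sum>l<d. x l * unit_vec l i)"
    using ip_unit_vec[OF i, of x] by (simp add: ip_def unit_vec_def mult.commute eq_commute)
  also have "\<dots> = (\<Sum>l<d. x l * (\<Sum>j<d. b j l * b j i))" using e by (intro sum.cong) auto
  also have "\<dots> = (\<Sum>j<d. ip d x (b j) * b j i)"
    unfolding ip_def sum_distrib_left sum_distrib_right by (subst sum.swap) (simp add: mult_ac)
  finally show ?thesis .
qed

lemma in_flat_iff: "in_flat d K k a b \<longleftrightarrow> orthonormal d k b \<and> K \<subseteq> flat_param d k a b ` space (Rd k)"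
  by (simp add: in_flat_def orthonormal_def)

lemma orthonormal_unit_vec: "orthonormal d d unit_vec"
  unfolding orthonormal_def by (auto simp: ip_unit_vec) (auto simp: unit_vec_def)

lemma in_flat_whole:
  assumes "K \<subseteq> space (Rd d)"
  shows "in_flat d K d (\<lambda>_. 0) unit_vec"
  unfolding in_flat_iff
proof (intro conjI orthonormal_unit_vec subsetI)
  fix x assume "x \<in> K"
  then have x: "x \<in> space (Rd d)" using assms by auto
  have "x i = (\<Sum>j<d. x j * unit_vec j i)" if "i < d" for i
    using ip_unit_vec[OF that, of x] by (simp add: ip_def unit_vec_def mult.commute eq_commute)
  then have "x = flat_param d d (\<lambda>_. 0) unit_vec x"
    using x by (auto simp: flat_param_def space_Rd PiE_iff extensional_def)
  then show "x \<in> flat_param d d (\<lambda>_. 0) unit_vec ` space (Rd d)" using x by blast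
qed

lemma restrict_point: "x \<in> space (Rd d) \<Longrightarrow> (\<lambda>i\<in>{..<d}. x i) = x"
  by (simp add: space_Rd PiE_def extensional_restrict)

text \<open>
  Convexity for points that are functions restricted to the indices below \<open>d\<close>.
\<close>

definition pconvex :: "nat \<Rightarrow> point set \<Rightarrow> bool" where
  "pconvex d K \<longleftrightarrow> (\<forall>x\<in>K. \<forall>y\<in>K. \<forall>t\<in>{0..1}. (\<lambda>i\<in>{..<d}. (1 - t) * x i + t * y i) \<in> K)"

text \<open>
  Convex combinations of \<open>y0\<close> and the \<open>y j\<close>, with the weight of \<open>y0\<close> left implicit.
\<close>

lemma pconvex_simplex:
  fixes m :: nat
  assumes K: "pconvex d K" "K \<subseteq> space (Rd d)" and y0: "y0 \<in> K" and y: "\<And>j. j < m \<Longrightarrow> y j \<in> K"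
    and t: "\<And>j. j < m \<Longrightarrow> 0 \<le> t j" "(\<Sum>j<m. t j) \<le> 1"
  shows "(\<lambda>i\<in>{..<d}. y0 i + (\<Sum>j<m. t j * (y j i - y0 i))) \<in> K"
  using y t
proof (induction m arbitrary: t)
  case 0
  have "(\<lambda>i\<in>{..<d}. y0 i) = y0" using y0 K(2) by (intro restrict_point) auto
  then show ?case using y0 by simp
next
  case (Suc m)
  show ?case
  proof (cases "t m = 1")
    case True
    have tn: "(\<Sum>j<m. t j) \<le> 0" using Suc.prems(3) True by simp
    have "t j = 0" if "j < m" for j
    proof -
      have "t j \<le> (\<Sum>j<m. t j)" using that Suc.prems(2) by (intro member_le_sum) auto
      then show ?thesis using tn Suc.prems(2)[of j] that by simp
    qed
    then have "(\<lambda>i\<in>{..<d}. y0 i + (\<Sum>j<Suc m. t j * (y j i - y0 i))) = (\<lambda>i\<in>{..<d}. y m i)"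
      using True by (intro restrict_ext) simp
    also have "\<dots> = y m" using Suc.prems(1)[of m] K(2) by (intro restrict_point) auto
    finally show ?thesis using Suc.prems(1)[of m] by simp
  next
    case False
    define s where "s = 1 - t m"
    have "t m \<le> (\<Sum>j<Suc m. t j)" using Suc.prems(2) by (intro member_le_sum) auto
    then have s: "s > 0" "t m \<le> 1" using Suc.prems(3) False by (auto simp: s_def)
    have "(\<lambda>i\<in>{..<d}. y0 i + (\<Sum>j<m. t j / s * (y j i - y0 i))) \<in> K" (is "?z \<in> K")
    proof (rule Suc.IH)
      show "(\<Sum>j<m. t j / s) \<le> 1"
        using Suc.prems(3) s by (simp add: sum_divide_distrib[symmetric] s_def)
    qed (use Suc.prems s in auto)
    moreover have "y m \<in> K" using Suc.prems by simp
    ultimately have "(\<lambda>i\<in>{..<d}. (1 - t m) * ?z i + t m * y m i) \<in> K"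
      using K(1) s Suc.prems(2)[of m] unfolding pconvex_def by auto
    moreover have "(\<lambda>i\<in>{..<d}. (1 - t m) * ?z i + t m * y m i) = (\<lambda>i\<in>{..<d}. y0 i + (\<Sum>j<Suc m. t j * (y j i - y0 i)))"
    proof (rule restrict_ext)
      fix i assume i: "i \<in> {..<d}"
      have "s * (\<Sum>j<m. t j / s * (y j i - y0 i)) = (\<Sum>j<m. t j * (y j i - y0 i))"
        unfolding sum_distrib_left using s by (intro sum.cong) auto
      then show "(1 - t m) * ?z i + t m * y m i = y0 i + (\<Sum>j<Suc m. t j * (y j i - y0 i))"
        using i by (simp add: s_def[symmetric] distrib_left) (simp add: s_def algebra_simps)
    qed
    ultimately show ?thesis by (simp only:)
  qed
qed

section \<open>Positive volume in the affine hull\<close>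

definition flat_preimage :: "nat \<Rightarrow> nat \<Rightarrow> point \<Rightarrow> (nat \<Rightarrow> point) \<Rightarrow> point set \<Rightarrow> point set" where
  "flat_preimage d k a b K = {c\<in>space (Rd k). flat_param d k a b c \<in> K}"

lemma flat_param_in_space [simp]: "flat_param d k a b c \<in> space (Rd d)"
  by (simp add: flat_param_def)

lemma flat_param_measurable: "flat_param d k a b \<in> measurable (Rd k) (Rd d)"
  unfolding flat_param_def Rd_def by (intro measurable_restrict) measurable

lemma flat_preimage_sets: "K \<in> sets (Rd d) \<Longrightarrow> flat_preimage d k a b K \<in> sets (Rd k)"
  using measurable_sets[OF flat_param_measurable, of K d k a b]
  by (simp add: flat_preimage_def vimage_def Int_def conj_commute)

lemma pconvex_flat_preimage:
  assumes "pconvex d K"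
  shows "pconvex k (flat_preimage d k a b K)"
  unfolding pconvex_def
proof (intro ballI)
  fix x y and t :: real
  assume x: "x \<in> flat_preimage d k a b K" and y: "y \<in> flat_preimage d k a b K" and t: "t \<in> {0..1}"
  let ?z = "\<lambda>i\<in>{..<k}. (1 - t) * x i + t * y i"
  have "flat_param d k a b ?z = (\<lambda>i\<in>{..<d}. (1 - t) * flat_param d k a b x i + t * flat_param d k a b y i)"
    unfolding flat_param_def
    by (intro restrict_ext) (simp add: algebra_simps sum.distrib sum_subtractf sum_distrib_left)
  moreover have "(\<lambda>i\<in>{..<d}. (1 - t) * flat_param d k a b x i + t * flat_param d k a b y i) \<in> K"
    using assms x y t unfolding pconvex_def flat_preimage_def by blast
  ultimately show "?z \<in> flat_preimage d k a b K" by (simp add: flat_preimage_def)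
qed

text \<open>
  If in the coordinates of the flat all differences to \<open>y0\<close> lie in the span of the \<open>m\<close> vectors
  \<open>v\<close>, then the images of the \<open>v\<close> are orthonormal directions of an \<open>m\<close>-dimensional flat containing
  \<open>K\<close>.
\<close>

lemma flat_of_subflat:
  assumes fl: "in_flat d K k a b" and v: "orthonormal k m v"
    and span: "\<And>c l. c \<in> flat_preimage d k a b K \<Longrightarrow> l < k \<Longrightarrow> residual k m v (\<lambda>i. c i - y0 i) l = 0"
  shows "\<exists>a' b'. in_flat d K m a' b'"
proof -
  have b: "orthonormal d k b" and K: "K \<subseteq> flat_param d k a b ` space (Rd k)"
    using fl by (auto simp: in_flat_iff)
  define a' where "a' i = a i + (\<Sum>l<k. y0 l * b l i)" for i
  define b' where "b' j i = (\<Sum>l<k. v j l * b l i)" for j i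
  have "ip d (b' i) (b' j) = ip k (v i) (v j)" for i j
  proof -
    have "ip d (b' i) (b' j) = (\<Sum>l<k. v i l * ip d (b l) (b' j))" unfolding b'_def by (rule ip_sum_left)
    also have "\<dots> = (\<Sum>l<k. v i l * v j l)"
    proof (intro sum.cong refl)
      fix l assume "l \<in> {..<k}"
      then have "ip d (b' j) (b l) = v j l" unfolding b'_def by (intro orthonormal_coord[OF b]) auto
      then show "v i l * ip d (b l) (b' j) = v i l * v j l" by (simp add: ip_commute[of d "b l"])
    qed
    finally show ?thesis by (simp add: ip_def)
  qed
  then have on: "orthonormal d m b'" using v by (simp add: orthonormal_def)
  have "K \<subseteq> flat_param d m a' b' ` space (Rd m)"
  proof
    fix z assume z: "z \<in> K"
    then obtain c where c: "c \<in> space (Rd k)" "z = flat_param d k a b c" using K by blast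
    then have cS: "c \<in> flat_preimage d k a b K" using z by (simp add: flat_preimage_def)
    define p where "p j = ip k (\<lambda>i. c i - y0 i) (v j)" for j
    have cl: "c l = y0 l + (\<Sum>j<m. p j * v j l)" if "l < k" for l
      using span[OF cS that] by (simp add: residual_def p_def)
    have "z = flat_param d m a' b' (\<lambda>j\<in>{..<m}. p j)"
      unfolding c(2) flat_param_def
    proof (rule restrict_ext)
      fix i
      have "(\<Sum>l<k. c l * b l i) = (\<Sum>l<k. (y0 l + (\<Sum>j<m. p j * v j l)) * b l i)"
        using cl by (intro sum.cong) auto
      also have "\<dots> = (\<Sum>l<k. y0 l * b l i) + (\<Sum>l<k. \<Sum>j<m. p j * v j l * b l i)"
        by (simp add: distrib_right sum.distrib sum_distrib_right)
      also have "(\<Sum>l<k. \<Sum>j<m. p j * v j l * b l i) = (\<Sum>j<m. p j * b' j i)"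
        unfolding b'_def sum_distrib_left by (subst sum.swap) (simp add: mult_ac)
      finally show "a i + (\<Sum>l<k. c l * b l i) = a' i + (\<Sum>j<m. (\<lambda>j\<in>{..<m}. p j) j * b' j i)"
        by (simp add: a'_def)
    qed
    moreover have "flat_param d m a' b' (\<lambda>j\<in>{..<m}. p j) \<in> flat_param d m a' b' ` space (Rd m)"
      by (rule imageI, rule restrict_in_Rd)
    ultimately show "z \<in> flat_param d m a' b' ` space (Rd m)" by (simp only:)
  qed
  with on show ?thesis by (auto simp: in_flat_iff)
qed

text \<open>
  Gram--Schmidt along \<open>K\<close>: as long as \<open>m < k\<close>, minimality of \<open>k\<close> provides a point of \<open>K\<close> whose
  difference to \<open>y0\<close> is not in the span of the directions found so far. The coefficients \<open>C\<close>
  express the orthonormal vectors by differences of points of \<open>K\<close>, so that these differences span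
  the flat.
\<close>

lemma minimal_flat_spanned:
  assumes fl: "in_flat d K k a b" and min: "\<forall>k' a' b'. in_flat d K k' a' b' \<longrightarrow> k \<le> k'"
    and y0: "y0 \<in> flat_preimage d k a b K" and "m \<le> k"
  shows "\<exists>y v C. (\<forall>j<m. y j \<in> flat_preimage d k a b K) \<and> orthonormal k m v
     \<and> (\<forall>j<m. \<forall>i<k. v j i = (\<Sum>l<m. C j l * (y l i - y0 i)))"
  using \<open>m \<le> k\<close>
proof (induction m)
  case 0
  show ?case by (auto simp: orthonormal_def)
next
  case (Suc m)
  from Suc.IH[OF Suc_leD[OF Suc.prems]] obtain y v C where
    yvC: "\<forall>j<m. y j \<in> flat_preimage d k a b K" and v: "orthonormal k m v"
    and C': "\<forall>j<m. \<forall>i<k. v j i = (\<Sum>l<m. C j l * (y l i - y0 i))" by (elim exE conjE)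
  have y: "\<And>j. j < m \<Longrightarrow> y j \<in> flat_preimage d k a b K" using yvC by simp
  have C: "v j i = (\<Sum>l<m. C j l * (y l i - y0 i))" if "j < m" "i < k" for j i using C' that by simp
  have "\<exists>c\<in>flat_preimage d k a b K. \<exists>l<k. residual k m v (\<lambda>i. c i - y0 i) l \<noteq> 0"
  proof (rule ccontr)
    assume "\<not> ?thesis"
    then have "\<exists>a' b'. in_flat d K m a' b'" by (intro flat_of_subflat[OF fl v]) auto
    then obtain a' b' where "in_flat d K m a' b'" by blast
    then have "k \<le> m" using min by blast
    then show False using Suc.prems by simp
  qed
  then obtain x l where x: "x \<in> flat_preimage d k a b K" "l < k" "residual k m v (\<lambda>i. x i - y0 i) l \<noteq> 0" by blast
  define r where "r = residual k m v (\<lambda>i. x i - y0 i)"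
  define p where "p j = ip k (\<lambda>i. x i - y0 i) (v j)" for j
  define s where "s = sqrt (ip k r r)"
  have rr: "ip k r r > 0"
    using ip_self_zero[of k r l] ip_self_nonneg[of k r] x(2,3) by (auto simp: r_def order_le_less)
  define v' where "v' = v(m := (\<lambda>i. r i / s))"
  have v': "orthonormal k (Suc m) v'"
    unfolding v'_def s_def using rr residual_orth[OF v] by (intro orthonormal_insert v) (auto simp: r_def)
  define y' where "y' = y(m := x)"
  (* the new row of coefficients comes from normalizing x - y0 minus its projection *)
  define C' where "C' j l = (if j < m then (if l < m then C j l else 0)
     else if l < m then - (\<Sum>j<m. p j * C j l) / s else 1 / s)" for j l
  have "v' j i = (\<Sum>l<Suc m. C' j l * (y' l i - y0 i))" if j: "j < Suc m" and i: "i < k" for j i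
  proof (cases "j < m")
    case True
    then show ?thesis using C[OF True i] by (simp add: v'_def C'_def y'_def)
  next
    case False
    then have jm: "j = m" using j by simp
    have "(\<Sum>j<m. p j * v j i) = (\<Sum>j<m. \<Sum>l<m. p j * C j l * (y l i - y0 i))"
      using C[OF _ i] by (intro sum.cong) (auto simp: sum_distrib_left mult.assoc)
    also have "\<dots> = (\<Sum>l<m. (\<Sum>j<m. p j * C j l) * (y l i - y0 i))"
      by (subst sum.swap) (simp add: sum_distrib_right)
    finally have e: "r i = (x i - y0 i) - (\<Sum>l<m. (\<Sum>j<m. p j * C j l) * (y l i - y0 i))"
      by (simp add: r_def residual_def p_def)
    have "(\<Sum>l<m. C' m l * (y' l i - y0 i)) = - (\<Sum>l<m. (\<Sum>j<m. p j * C j l) * (y l i - y0 i)) / s"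
      unfolding sum_negf[symmetric] sum_divide_distrib by (intro sum.cong) (auto simp: C'_def y'_def)
    then show ?thesis by (simp add: jm v'_def e C'_def y'_def diff_divide_distrib)
  qed
  moreover have "y' j \<in> flat_preimage d k a b K" if "j < Suc m" for j
    using that y x(1) by (auto simp: y'_def less_Suc_eq)
  ultimately show ?case using v' by blast
qed

text \<open>
  A convex set contains the simplex of \<open>y0\<close> and the \<open>k\<close> points that span its minimal flat. The map
  sending the unit vectors to the differences \<open>y j - y0\<close> is surjective and maps the cube
  \<open>[0, 1/k]^k\<close> into the set shifted by \<open>-y0\<close>. So the preimage of the shifted set has positive
  volume, and by the scaling law the set itself has.
\<close>

lemma flat_preimage_positive_volume:
  assumes K: "K \<in> sets (Rd d)" "K \<noteq> {}" "pconvex d K"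
    and fl: "in_flat d K k a b" and min: "\<forall>k' a' b'. in_flat d K k' a' b' \<longrightarrow> k \<le> k'"
  shows "emeasure (leb {..<k}) (flat_preimage d k a b K) > 0"
proof -
  let ?S = "flat_preimage d k a b K" and ?\<mu> = "emeasure (leb {..<k})"
  have Ss: "?S \<in> sets (Rd k)" by (rule flat_preimage_sets[OF K(1)])
  have Ssub: "?S \<subseteq> space (Rd k)" by (auto simp: flat_preimage_def)
  obtain y0 where y0: "y0 \<in> ?S"
    using K(2) fl by (auto simp: in_flat_iff flat_preimage_def)
  from minimal_flat_spanned[OF fl min y0 order_refl] obtain y v C where
    yvC: "\<forall>j<k. y j \<in> ?S" and v: "orthonormal k k v"
    and C': "\<forall>j<k. \<forall>i<k. v j i = (\<Sum>l<k. C j l * (y l i - y0 i))" by (elim exE conjE)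
  have y: "\<And>j. j < k \<Longrightarrow> y j \<in> ?S" using yvC by simp
  have C: "v j i = (\<Sum>l<k. C j l * (y l i - y0 i))" if "j < k" "i < k" for j i using C' that by simp
  define w where "w l i = y l i - y0 i" for l i
  have surj: "\<exists>t\<in>space (Rd k). lincomb k k w t = x" if x: "x \<in> space (Rd k)" for x
  proof
    let ?t = "\<lambda>l\<in>{..<k}. \<Sum>j<k. ip k x (v j) * C j l"
    have "lincomb k k w ?t = (\<lambda>i\<in>{..<k}. x i)"
      unfolding lincomb_def
    proof (rule restrict_ext)
      fix i assume i: "i \<in> {..<k}"
      have "(\<Sum>l<k. ?t l * w l i) = (\<Sum>l<k. \<Sum>j<k. ip k x (v j) * C j l * w l i)"
        by (intro sum.cong) (auto simp: sum_distrib_right)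
      also have "\<dots> = (\<Sum>j<k. ip k x (v j) * v j i)"
        using C i by (subst sum.swap) (auto intro!: sum.cong simp: w_def sum_distrib_left mult.assoc)
      also have "\<dots> = x i" using orthonormal_basis_expansion[OF v, of i x] i by simp
      finally show "(\<Sum>l<k. ?t l * w l i) = x i" .
    qed
    then show "lincomb k k w ?t = x" using restrict_point[OF x] by simp
  qed simp
  define B where "B = {x\<in>space (Rd k). (\<lambda>i\<in>{..<k}. y0 i + x i) \<in> ?S}"
  have shm: "(\<lambda>x. \<lambda>i\<in>{..<k}. y0 i + x i) \<in> measurable (Rd k) (Rd k)"
    unfolding Rd_def by (intro measurable_restrict) measurable
  have Bs: "B \<in> sets (Rd k)"
    using measurable_sets[OF shm Ss] by (simp add: B_def vimage_def Int_def conj_commute)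
  have "?\<mu> B = (\<integral>\<^sup>+x. indicator B x \<partial>leb {..<k})"
    using Bs by (simp add: sets_leb_Rd)
  also have "\<dots> = (\<integral>\<^sup>+x. indicator ?S (\<lambda>i\<in>{..<k}. y0 i + x i) \<partial>leb {..<k})"
  proof (rule nn_integral_cong)
    fix x assume "x \<in> space (leb {..<k})"
    then have "x \<in> B \<longleftrightarrow> (\<lambda>i\<in>{..<k}. y0 i + x i) \<in> ?S" by (simp only: B_def mem_Collect_eq space_leb_Rd simp_thms)
    then show "indicator B x = (indicator ?S (\<lambda>i\<in>{..<k}. y0 i + x i) :: ennreal)" by (simp only: indicator_def)
  qed
  also have "\<dots> = (\<integral>\<^sup>+x. indicator ?S x \<partial>leb {..<k})"
    using Ss by (intro nn_integral_leb_shift) (auto simp: borel_measurable_leb_Rd)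
  finally have BS: "?\<mu> B = ?\<mu> ?S" using Ss by (simp add: sets_leb_Rd)
  let ?T = "lincomb k k w"
  define Q where "Q = {..<k} \<rightarrow>\<^sub>E {0..1::real}"
  have Q: "Q \<in> sets (Rd k)" unfolding Q_def sets_leb_Rd[symmetric] by (intro sets_PiM_I_finite) auto
  have \<mu>Q: "?\<mu> Q = 1" unfolding Q_def by (subst emeasure_leb_box) auto
  have "0 < ?\<mu> ({..<k} \<rightarrow>\<^sub>E {0..1 / real k})"
    by (cases "k = 0"; subst emeasure_leb_box; simp)
  also have "\<dots> \<le> ?\<mu> (?T -` B \<inter> space (Rd k))"
  proof (rule emeasure_mono)
    show "?T -` B \<inter> space (Rd k) \<in> sets (leb {..<k})"
      using measurable_sets[OF lincomb_measurable[of k k w], of B] Bs by (simp add: sets_leb_Rd space_leb_Rd)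
    show "{..<k} \<rightarrow>\<^sub>E {0..1 / real k} \<subseteq> ?T -` B \<inter> space (Rd k)"
    proof
      fix t assume t: "t \<in> {..<k} \<rightarrow>\<^sub>E {0..1 / real k}"
      then have tj: "0 \<le> t j" "t j \<le> 1 / k" if "j < k" for j using that PiE_mem[OF t, of j] by auto
      have "(\<Sum>j<k. t j) \<le> real (card {..<k}) * (1 / k)"
        by (rule sum_bounded_above) (use tj in auto)
      also have "\<dots> \<le> 1" by simp
      finally have "(\<lambda>i\<in>{..<k}. y0 i + (\<Sum>j<k. t j * (y j i - y0 i))) \<in> ?S"
        by (intro pconvex_simplex[OF pconvex_flat_preimage[OF K(3)] Ssub y0 y tj(1)])
      moreover have "(\<lambda>i\<in>{..<k}. y0 i + (\<Sum>j<k. t j * (y j i - y0 i))) = (\<lambda>i\<in>{..<k}. y0 i + ?T t i)"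
        by (intro restrict_ext) (simp add: lincomb_def w_def)
      ultimately have "?T t \<in> B" by (simp only: B_def mem_Collect_eq lincomb_in_space simp_thms)
      moreover have "t \<in> space (Rd k)" using t by (auto simp: space_Rd PiE_iff)
      ultimately show "t \<in> ?T -` B \<inter> space (Rd k)" by simp
    qed
  qed
  also have "\<dots> = ?\<mu> (?T -` B \<inter> space (Rd k)) * ?\<mu> Q" by (simp add: \<mu>Q)
  also have "\<dots> = ?\<mu> (?T -` Q \<inter> space (Rd k)) * ?\<mu> B"
    using surjective_linear_scales_lebesgue[OF surj Q Bs] by simp
  finally have "?\<mu> B \<noteq> 0" by auto
  then show ?thesis by (simp add: BS zero_less_iff_neq_zero)
qed

section \<open>Barycenters of convex bodies\<close>

definition sqdist :: "nat \<Rightarrow> point \<Rightarrow> point \<Rightarrow> real" where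
  "sqdist d x y = (\<Sum>i<d. (x i - y i)\<^sup>2)"

text \<open>
  The closed parallel body at distance \<open>r\<close>.
\<close>

definition nbhd :: "nat \<Rightarrow> point set \<Rightarrow> real \<Rightarrow> point set" where
  "nbhd d K r = {x\<in>space (Rd d). \<exists>z\<in>K. sqdist d x z \<le> r\<^sup>2}"

text \<open>
  A non-empty compact convex set. Measurability of the parallel bodies is assumed; the case
  \<open>r = 0\<close> covers the set itself.
\<close>

locale convex_body =
  fixes d :: nat and K :: "point set"
  assumes K_sub: "K \<subseteq> space (Rd d)" and K_ne: "K \<noteq> {}" and K_conv: "pconvex d K"
    and K_bdd: "\<exists>R. \<forall>x\<in>K. \<forall>i<d. \<bar>x i\<bar> \<le> R"
    and K_closed: "\<And>x. x \<in> space (Rd d) \<Longrightarrow> (\<And>e. e > 0 \<Longrightarrow> \<exists>z\<in>K. sqdist d x z < e) \<Longrightarrow> x \<in> K"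
    and nbhd_sets: "\<And>r. nbhd d K r \<in> sets (Rd d)"
begin

lemma sqdist_zero: "x \<in> space (Rd d) \<Longrightarrow> y \<in> space (Rd d) \<Longrightarrow> sqdist d x y \<le> 0 \<Longrightarrow> x = y"
proof -
  assume x: "x \<in> space (Rd d)" and y: "y \<in> space (Rd d)" and le: "sqdist d x y \<le> 0"
  have "sqdist d x y = 0" using le by (intro antisym) (auto simp: sqdist_def sum_nonneg)
  then have "x i = y i" if "i < d" for i
    using that unfolding sqdist_def by (subst (asm) sum_nonneg_eq_0_iff) auto
  then show "x = y" using x y unfolding space_Rd by (intro PiE_ext[of x "{..<d}" "\<lambda>_. UNIV" y]) auto
qed

lemma K_sets: "K \<in> sets (Rd d)"
proof -
  have "nbhd d K 0 = K"
  proof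
    show "nbhd d K 0 \<subseteq> K" using sqdist_zero K_sub by (auto simp: nbhd_def subset_iff)
    show "K \<subseteq> nbhd d K 0" using K_sub by (force simp: nbhd_def sqdist_def)
  qed
  then show ?thesis using nbhd_sets[of 0] by simp
qed

definition k where "k = flat_dim d K"
text \<open>
  The very choice made in the definition of \<open>uniform_dist\<close>, so that statements about it apply to
  the barycenter.
\<close>

definition ab where "ab = (SOME (a, b). in_flat d K k a b)"
definition a where "a = fst ab"
definition b where "b = snd ab"
definition S where "S = flat_preimage d k a b K"

lemma in_flat: "in_flat d K k a b"
proof -
  have "\<exists>a b. in_flat d K k a b"
    unfolding k_def flat_dim_def by (rule LeastI_ex) (use in_flat_whole[OF K_sub] in blast)
  then have "case_prod (in_flat d K k) ab"
    unfolding ab_def by (intro someI_ex[of "case_prod (in_flat d K k)"]) (simp add: split_paired_Ex)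
  then show ?thesis by (simp add: a_def b_def case_prod_beta)
qed

lemma k_minimal: "\<forall>k' a' b'. in_flat d K k' a' b' \<longrightarrow> k \<le> k'"
  unfolding k_def flat_dim_def by (blast intro: Least_le)

lemma b_orth: "orthonormal d k b" and K_flat: "K \<subseteq> flat_param d k a b ` space (Rd k)"
  using in_flat by (auto simp: in_flat_iff)

lemma k_le: "k \<le> d" by (rule orthonormal_le[OF b_orth])

lemma S_sets: "S \<in> sets (Rd k)" unfolding S_def by (rule flat_preimage_sets[OF K_sets])

lemma flat_param_S: "c \<in> S \<Longrightarrow> flat_param d k a b c \<in> K" by (simp add: S_def flat_preimage_def)

lemma S_sub: "S \<subseteq> space (Rd k)" by (auto simp: S_def flat_preimage_def)

lemma K_param: "z \<in> K \<Longrightarrow> \<exists>c\<in>S. z = flat_param d k a b c"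
  using K_flat by (auto simp: S_def flat_preimage_def)

lemma S_bdd: "\<exists>R\<ge>0. \<forall>c\<in>S. \<forall>j<k. \<bar>c j\<bar> \<le> R"
proof -
  obtain R where R: "\<And>x i. x \<in> K \<Longrightarrow> i < d \<Longrightarrow> \<bar>x i\<bar> \<le> R" using K_bdd by blast
  define R' where "R' = (\<Sum>j<k. (\<Sum>i<d. \<bar>b j i\<bar> * (\<bar>R\<bar> + \<bar>a i\<bar>)))"
  have nn: "0 \<le> (\<Sum>i<d. \<bar>b j i\<bar> * (\<bar>R\<bar> + \<bar>a i\<bar>))" for j by (intro sum_nonneg) auto
  have "\<bar>c j\<bar> \<le> R'" if c: "c \<in> S" and j: "j < k" for c j
  proof -
    let ?x = "flat_param d k a b c"
    have "c j = ip d (\<lambda>i. \<Sum>j<k. c j * b j i) (b j)" using orthonormal_coord[OF b_orth j] by simp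
    also have "\<dots> = ip d (b j) (\<lambda>i. ?x i - a i)"
      unfolding ip_commute[of d "b j"] by (rule ip_cong) (auto simp: flat_param_def)
    finally have "\<bar>c j\<bar> \<le> (\<Sum>i<d. \<bar>b j i * (?x i - a i)\<bar>)" unfolding ip_def by (metis sum_abs)
    also have "\<dots> \<le> (\<Sum>i<d. \<bar>b j i\<bar> * (\<bar>R\<bar> + \<bar>a i\<bar>))"
    proof (rule sum_mono)
      fix i assume "i \<in> {..<d}"
      then have "\<bar>?x i\<bar> \<le> R" using R[OF flat_param_S[OF c]] by simp
      then have "\<bar>?x i - a i\<bar> \<le> \<bar>R\<bar> + \<bar>a i\<bar>" by linarith
      then show "\<bar>b j i * (?x i - a i)\<bar> \<le> \<bar>b j i\<bar> * (\<bar>R\<bar> + \<bar>a i\<bar>)" by (simp add: abs_mult mult_left_mono)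
    qed
    also have "\<dots> \<le> R'" unfolding R'_def using j nn by (intro member_le_sum) auto
    finally show ?thesis .
  qed
  moreover have "R' \<ge> 0" unfolding R'_def using nn by (intro sum_nonneg) auto
  ultimately show ?thesis by blast
qed

lemma S_pos: "emeasure (leb {..<k}) S > 0"
  unfolding S_def by (rule flat_preimage_positive_volume[OF K_sets K_ne K_conv in_flat k_minimal])

lemma S_fin: "emeasure (leb {..<k}) S < \<infinity>"
proof -
  obtain R where R: "R \<ge> 0" "\<And>c j. c \<in> S \<Longrightarrow> j < k \<Longrightarrow> \<bar>c j\<bar> \<le> R" using S_bdd by blast
  have "emeasure (leb {..<k}) S \<le> emeasure (leb {..<k}) ({..<k} \<rightarrow>\<^sub>E {-R..R})"
  proof (rule emeasure_mono)
    show "S \<subseteq> {..<k} \<rightarrow>\<^sub>E {-R..R}"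
    proof
      fix c assume c: "c \<in> S"
      then have "c j \<in> {-R..R}" if "j < k" for j using R(2)[OF c that] by (simp add: abs_le_iff)
      then show "c \<in> {..<k} \<rightarrow>\<^sub>E {-R..R}" using S_sub c by (auto simp: space_Rd PiE_iff simp del: atLeastAtMost_iff)
    qed
    show "{..<k} \<rightarrow>\<^sub>E {-R..R} \<in> sets (leb {..<k})" by (intro sets_PiM_I_finite) auto
  qed
  also have "\<dots> < \<infinity>" using R by (subst emeasure_leb_box) auto
  finally show ?thesis .
qed

definition vol where "vol = measure (leb {..<k}) S"

lemma vol_pos: "vol > 0" and emeasure_S: "emeasure (leb {..<k}) S = ennreal vol"
proof -
  show "emeasure (leb {..<k}) S = ennreal vol" unfolding vol_def using S_fin by (intro emeasure_eq_ennreal_measure) auto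
  then show "vol > 0" using S_pos by simp
qed

lemma uniform_dist_eq:
  "uniform_dist d K = distr (uniform_measure (leb {..<k}) S) (Rd d) (flat_param d k a b)"
proof -
  have "flat_param d k a b -` K \<inter> space (leb {..<k}) = S"
    by (auto simp: S_def flat_preimage_def space_leb_Rd)
  then show ?thesis
    unfolding uniform_dist_def Let_def k_def[symmetric] ab_def[symmetric] by (simp add: case_prod_beta a_def b_def)
qed

lemma flat_param_measurable_uniform: "flat_param d k a b \<in> measurable (uniform_measure (leb {..<k}) S) (Rd d)"
  using flat_param_measurable[of d k a b]
  by (simp only: measurable_cong_sets[OF trans[OF sets_uniform_measure sets_leb_Rd] refl])

lemma prob_space_uniform: "prob_space (uniform_measure (leb {..<k}) S)"
  using S_pos S_fin by (intro prob_space_uniform_measure) auto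

lemma prob_space_uniform_dist: "prob_space (uniform_dist d K)"
  unfolding uniform_dist_eq
  by (intro prob_space.prob_space_distr prob_space_uniform flat_param_measurable_uniform)

lemma AE_uniform_dist: "AE x in uniform_dist d K. x \<in> K"
  unfolding uniform_dist_eq
proof (subst AE_distr_iff[OF flat_param_measurable_uniform])
  show "{x \<in> space (Rd d). x \<in> K} \<in> sets (Rd d)" using K_sets by simp
  have "S \<in> sets (leb {..<k})" using S_sets by (simp add: sets_leb_Rd)
  then show "AE c in uniform_measure (leb {..<k}) S. flat_param d k a b c \<in> K"
    by (intro AE_uniform_measureI) (auto intro: flat_param_S)
qed

text \<open>
  The barycenter is a mean of points of \<open>K\<close>, and the functional is linear.
\<close>

lemma barycenter_halfspace:
  assumes c: "\<And>x. x \<in> K \<Longrightarrow> ip d x u \<ge> c"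
  shows "ip d (barycenter d K) u \<ge> c"
proof -
  interpret U: prob_space "uniform_dist d K" by (rule prob_space_uniform_dist)
  obtain R where R: "\<And>x i. x \<in> K \<Longrightarrow> i < d \<Longrightarrow> \<bar>x i\<bar> \<le> R" using K_bdd by blast
  have sU: "sets (uniform_dist d K) = sets (Rd d)" by (simp add: uniform_dist_eq)
  have m: "(\<lambda>x. x i) \<in> borel_measurable (uniform_dist d K)" if "i < d" for i
    using component_measurable_Rd[OF that] by (simp add: measurable_cong_sets[OF sU refl])
  have int: "integrable (uniform_dist d K) (\<lambda>x. x i)" if "i < d" for i
    using AE_uniform_dist R that by (intro U.integrable_const_bound[of _ R] m) auto
  have "c \<le> (\<integral>x. ip d x u \<partial>uniform_dist d K)"
  proof (rule U.integral_ge_const)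
    show "integrable (uniform_dist d K) (\<lambda>x. ip d x u)"
      unfolding ip_def using int by (intro Bochner_Integration.integrable_sum integrable_mult_left) auto
    show "AE x in uniform_dist d K. c \<le> ip d x u" using AE_uniform_dist c by auto
  qed
  also have "\<dots> = (\<Sum>i<d. (\<integral>x. x i \<partial>uniform_dist d K) * u i)"
    unfolding ip_def using int by (subst Bochner_Integration.integral_sum) auto
  also have "\<dots> = ip d (barycenter d K) u" by (simp add: ip_def barycenter_def)
  finally show ?thesis .
qed

lemma barycenter_eq:
  assumes i: "i < d"
  shows "barycenter d K i = (\<integral>c. indicator S c * flat_param d k a b c i \<partial>leb {..<k}) / vol"
proof -
  have "barycenter d K i = (\<integral>x. x i \<partial>uniform_dist d K)" using i by (simp add: barycenter_def)
  also have "\<dots> = (\<integral>c. flat_param d k a b c i \<partial>uniform_measure (leb {..<k}) S)"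
    unfolding uniform_dist_eq using i by (intro integral_distr flat_param_measurable_uniform) auto
  also have "uniform_measure (leb {..<k}) S = density (leb {..<k}) (\<lambda>c. ennreal (indicator S c / vol))"
  proof -
    have "(indicator S c :: ennreal) / ennreal vol = ennreal (indicator S c / vol)" for c
      using divide_ennreal[of 1 vol] vol_pos by (cases "c \<in> S") simp_all
    then show ?thesis unfolding uniform_measure_def emeasure_S by simp
  qed
  also have "(\<integral>c. flat_param d k a b c i \<partial>density (leb {..<k}) (\<lambda>c. ennreal (indicator S c / vol)))
     = (\<integral>c. indicator S c / vol * flat_param d k a b c i \<partial>leb {..<k})"
  proof -
    have "(\<lambda>c. flat_param d k a b c i) \<in> borel_measurable (Rd k)"
      using measurable_compose[OF flat_param_measurable component_measurable_Rd[OF i]] .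
    moreover have "(\<lambda>c. indicator S c / vol) \<in> borel_measurable (Rd k)"
      using S_sets by (intro borel_measurable_divide borel_measurable_indicator borel_measurable_const)
    ultimately show ?thesis
      using vol_pos by (intro integral_real_density) (simp_all add: borel_measurable_leb_Rd)
  qed
  also have "\<dots> = (\<integral>c. indicator S c * flat_param d k a b c i / vol \<partial>leb {..<k})" by (simp add: field_simps)
  finally show ?thesis by simp
qed

text \<open>
  An orthonormal basis of the whole space whose first \<open>k\<close> vectors span the flat.
\<close>

definition B where "B = (SOME B. orthonormal d d B \<and> (\<forall>j<k. B j = b j))"

lemma B_orth: "orthonormal d d B" and B_b: "j < k \<Longrightarrow> B j = b j"
  using someI_ex[OF orthonormal_extend[OF b_orth]] unfolding B_def by auto

text \<open>
  The basis with the directions normal to the flat scaled by \<open>r\<close>, which is the scale at which the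
  parallel body at distance \<open>r\<close> extends in these directions.
\<close>

definition D where "D r j i = (if j < k then B j i else r * B j i)" for r :: real and j i

definition Phi where "Phi r c = (\<lambda>i\<in>{..<d}. a i + lincomb d d (D r) c i)" for r c

definition stretch where "stretch r c j = (if j < k then c j else r * c j)" for r :: real and c :: point and j

lemma lincomb_D: "i < d \<Longrightarrow> lincomb d d (D r) c i = (\<Sum>j<d. stretch r c j * B j i)"
  unfolding lincomb_def by (auto simp: D_def stretch_def intro!: sum.cong)

text \<open>
  Only the existence of a constant Jacobian is needed: it cancels in the quotient of two
  integrals.
\<close>

lemma Phi_change_of_variables:
  assumes r: "r > 0"
  obtains s where "s > 0" "\<And>f :: point \<Rightarrow> real. f \<in> borel_measurable (Rd d) \<Longrightarrow>
     (\<integral>c. f (Phi r c) \<partial>leb {..<d}) = s * (\<integral>x. f x \<partial>leb {..<d})"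
proof -
  (* undoing the scaling multiplies a coordinate by 1 or by 1/r *)
  define q where "q = max 1 (1 / r)"
  have coord: "stretch r c j = ip d (lincomb d d (D r) c) (B j)" if "j < d" for c j
  proof -
    have "stretch r c j = ip d (\<lambda>i. \<Sum>l<d. stretch r c l * B l i) (B j)"
      using orthonormal_coord[OF B_orth that] by simp
    also have "\<dots> = ip d (lincomb d d (D r) c) (B j)"
      using lincomb_D by (intro ip_cong) auto
    finally show ?thesis .
  qed
  show ?thesis
  proof (rule affine_change_of_variables[of d "D r" "q * (\<Sum>j<d. \<Sum>i<d. \<bar>B j i\<bar>)"])
    fix y assume y: "y \<in> space (Rd d)"
    let ?c = "\<lambda>j\<in>{..<d}. if j < k then ip d y (B j) else ip d y (B j) / r"
    have "lincomb d d (D r) ?c = (\<lambda>i\<in>{..<d}. y i)"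
    proof (rule ext)
      fix i
      show "lincomb d d (D r) ?c i = (\<lambda>i\<in>{..<d}. y i) i"
      proof (cases "i < d")
        case True
        have "lincomb d d (D r) ?c i = (\<Sum>j<d. ip d y (B j) * B j i)"
          unfolding lincomb_D[OF True] using r by (intro sum.cong) (auto simp: stretch_def)
        then show ?thesis using orthonormal_basis_expansion[OF B_orth True, of y] True by simp
      qed (simp add: lincomb_def)
    qed
    then show "\<exists>x\<in>space (Rd d). lincomb d d (D r) x = y"
      using restrict_point[OF y] by (intro bexI[of _ ?c]) auto
  next
    fix c j assume c: "\<And>i. i < d \<Longrightarrow> \<bar>lincomb d d (D r) c i\<bar> \<le> 1" and j: "j < d"
    have nn: "0 \<le> (\<Sum>i<d. \<bar>B j i\<bar>)" for j by (simp add: sum_nonneg)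
    have "\<bar>stretch r c j\<bar> \<le> (\<Sum>i<d. \<bar>B j i\<bar>) * 1"
      unfolding coord[OF j] ip_commute[of d _ "B j"] by (rule abs_ip_le) (rule c)
    also have "\<dots> \<le> (\<Sum>j<d. \<Sum>i<d. \<bar>B j i\<bar>)" using j nn by (simp, intro member_le_sum) auto
    finally have st: "\<bar>stretch r c j\<bar> \<le> (\<Sum>j<d. \<Sum>i<d. \<bar>B j i\<bar>)" .
    have "\<bar>c j\<bar> \<le> q * \<bar>stretch r c j\<bar>"
    proof (cases "j < k")
      case True
      have "1 * \<bar>c j\<bar> \<le> q * \<bar>c j\<bar>" by (intro mult_right_mono) (auto simp: q_def)
      then show ?thesis using True by (simp add: stretch_def)
    next
      case False
      have "(1 / r) * \<bar>r * c j\<bar> \<le> q * \<bar>r * c j\<bar>" by (intro mult_right_mono) (auto simp: q_def)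
      then show ?thesis using False r by (simp add: stretch_def abs_mult)
    qed
    also have "\<dots> \<le> q * (\<Sum>j<d. \<Sum>i<d. \<bar>B j i\<bar>)" using st by (intro mult_left_mono) (auto simp: q_def)
    finally show "\<bar>c j\<bar> \<le> q * (\<Sum>j<d. \<Sum>i<d. \<bar>B j i\<bar>)" .
  next
    fix s :: real assume s: "s > 0" and f: "\<And>(f :: point \<Rightarrow> real) a. f \<in> borel_measurable (Rd d) \<Longrightarrow>
       (\<integral>x. f (\<lambda>i\<in>{..<d}. a i + lincomb d d (D r) x i) \<partial>leb {..<d}) = s * (\<integral>x. f x \<partial>leb {..<d})"
    show thesis by (rule that[OF s]) (simp add: Phi_def f)
  qed
qed

lemma Phi_measurable: "Phi r \<in> measurable (Rd d) (Rd d)"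
proof -
  have "(\<lambda>c. a i + lincomb d d (D r) c i) \<in> borel_measurable (Rd d)" if "i < d" for i
    using that by (simp add: lincomb_def)
  then show ?thesis unfolding Phi_def[abs_def] by (subst Rd_def, intro measurable_restrict) auto
qed

definition tail_sq where "tail_sq c = (\<Sum>j\<in>{k..<d}. (c j)\<^sup>2)" for c :: point

text \<open>
  Pythagoras: the tangential part is unchanged, the normal part is scaled by \<open>r\<close>.
\<close>

lemma sqdist_Phi:
  assumes "c' \<in> space (Rd k)"
  shows "sqdist d (Phi r c) (flat_param d k a b c') = (\<Sum>j<k. (c j - c' j)\<^sup>2) + r\<^sup>2 * tail_sq c"
proof -
  define e where "e j = (if j < k then c j - c' j else r * c j)" for j
  have un: "{..<d} = {..<k} \<union> {k..<d}" using k_le by auto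
  have "Phi r c i - flat_param d k a b c' i = (\<Sum>j<d. e j * B j i)" if i: "i < d" for i
  proof -
    have "Phi r c i - flat_param d k a b c' i = (\<Sum>j<d. stretch r c j * B j i) - (\<Sum>j<k. c' j * b j i)"
      using i by (simp add: Phi_def flat_param_def lincomb_D)
    also have "(\<Sum>j<k. c' j * b j i) = (\<Sum>j<d. if j < k then c' j * B j i else 0)"
      using k_le B_b by (intro sum.mono_neutral_cong_left) auto
    finally show ?thesis
      unfolding sum_subtractf[symmetric] by (auto simp: e_def stretch_def algebra_simps intro!: sum.cong)
  qed
  then have "sqdist d (Phi r c) (flat_param d k a b c') = ip d (\<lambda>i. \<Sum>j<d. e j * B j i) (\<lambda>i. \<Sum>j<d. e j * B j i)"
    unfolding sqdist_def ip_def by (intro sum.cong) (auto simp: power2_eq_square)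
  also have "\<dots> = (\<Sum>j<d. (e j)\<^sup>2)" by (rule orthonormal_norm[OF B_orth])
  also have "\<dots> = (\<Sum>j<k. (e j)\<^sup>2) + (\<Sum>j\<in>{k..<d}. (e j)\<^sup>2)" unfolding un by (rule sum.union_disjoint) auto
  finally show ?thesis by (simp add: e_def tail_sq_def power_mult_distrib sum_distrib_left)
qed

lemma Phi_in_space [simp]: "Phi r c \<in> space (Rd d)" by (simp add: Phi_def)

lemma Phi_in_nbhd_iff:
  "Phi r c \<in> nbhd d K r \<longleftrightarrow> (\<exists>c'\<in>S. (\<Sum>j<k. (c j - c' j)\<^sup>2) + r\<^sup>2 * tail_sq c \<le> r\<^sup>2)"
proof -
  have "Phi r c \<in> nbhd d K r \<longleftrightarrow> (\<exists>z\<in>K. sqdist d (Phi r c) z \<le> r\<^sup>2)" by (simp add: nbhd_def)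
  also have "\<dots> \<longleftrightarrow> (\<exists>c'\<in>S. sqdist d (Phi r c) (flat_param d k a b c') \<le> r\<^sup>2)"
    using K_param flat_param_S by metis
  also have "\<dots> \<longleftrightarrow> (\<exists>c'\<in>S. (\<Sum>j<k. (c j - c' j)\<^sup>2) + r\<^sup>2 * tail_sq c \<le> r\<^sup>2)"
    using sqdist_Phi S_sub by (intro bex_cong refl) auto
  finally show ?thesis .
qed

definition head where "head c = (\<lambda>j\<in>{..<k}. c j)" for c :: point

text \<open>
  The body times the unit ball of the normal directions, to which the parallel bodies converge in
  the rescaled coordinates.
\<close>

definition limit_set where "limit_set = {c\<in>space (Rd d). head c \<in> S \<and> tail_sq c \<le> 1}"

lemma tail_sq_nonneg: "0 \<le> tail_sq c" by (simp add: tail_sq_def sum_nonneg)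

lemma S_closed:
  assumes c: "c \<in> space (Rd k)" and e: "\<And>e. e > 0 \<Longrightarrow> \<exists>c'\<in>S. (\<Sum>j<k. (c j - c' j)\<^sup>2) < e"
  shows "c \<in> S"
proof -
  have dist: "sqdist d (flat_param d k a b c) (flat_param d k a b c') = (\<Sum>j<k. (c j - c' j)\<^sup>2)" if "c' \<in> space (Rd k)" for c'
  proof -
    have "sqdist d (flat_param d k a b c) (flat_param d k a b c')
       = ip d (\<lambda>i. \<Sum>j<k. (c j - c' j) * b j i) (\<lambda>i. \<Sum>j<k. (c j - c' j) * b j i)"
      unfolding sqdist_def ip_def
      by (intro sum.cong) (auto simp: flat_param_def power2_eq_square left_diff_distrib sum_subtractf)
    then show ?thesis by (simp only: orthonormal_norm[OF b_orth])
  qed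
  have "flat_param d k a b c \<in> K"
  proof (rule K_closed)
    fix e :: real assume "e > 0"
    then obtain c' where "c' \<in> S" "(\<Sum>j<k. (c j - c' j)\<^sup>2) < e" using e by blast
    then show "\<exists>z\<in>K. sqdist d (flat_param d k a b c) z < e"
      using flat_param_S dist S_sub by (intro bexI[of _ "flat_param d k a b c'"]) auto
  qed simp
  then show ?thesis using c by (simp add: S_def flat_preimage_def)
qed

text \<open>
  If \<open>c\<close> has its tangential part in \<open>S\<close>, the parallel body contains its image exactly when the
  normal part has length at most \<open>1\<close>, for every radius. If the tangential part is outside the
  closed set \<open>S\<close>, it has positive distance from \<open>S\<close>, and small radii exclude it.
\<close>

lemma Phi_in_nbhd_limit:
  assumes c: "c \<in> space (Rd d)"
  shows "eventually (\<lambda>m. Phi (inverse (real (Suc m))) c \<in> nbhd d K (inverse (real (Suc m))) \<longleftrightarrow> c \<in> limit_set) sequentially"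
proof -
  have hk: "(\<Sum>j<k. (c j - c' j)\<^sup>2) = (\<Sum>j<k. (head c j - c' j)\<^sup>2)" for c' by (intro sum.cong) (auto simp: head_def)
  consider "c \<in> limit_set" | "tail_sq c > 1" | "tail_sq c \<le> 1" "head c \<notin> S" using c by (force simp: limit_set_def)
  then show ?thesis
  proof cases
    case 1
    have "Phi r c \<in> nbhd d K r" for r
      unfolding Phi_in_nbhd_iff hk
    proof (rule bexI)
      show "head c \<in> S" using 1 by (simp add: limit_set_def)
      show "(\<Sum>j<k. (head c j - head c j)\<^sup>2) + r\<^sup>2 * tail_sq c \<le> r\<^sup>2"
        using 1 by (simp add: limit_set_def mult_left_le)
    qed
    then show ?thesis using 1 by simp
  next
    case 2
    have "Phi r c \<notin> nbhd d K r" if r: "r > 0" for r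
    proof
      assume "Phi r c \<in> nbhd d K r"
      then obtain c' where "(\<Sum>j<k. (c j - c' j)\<^sup>2) + r\<^sup>2 * tail_sq c \<le> r\<^sup>2" unfolding Phi_in_nbhd_iff by blast
      moreover have "0 \<le> (\<Sum>j<k. (c j - c' j)\<^sup>2)" by (simp add: sum_nonneg)
      moreover have "r\<^sup>2 * 1 < r\<^sup>2 * tail_sq c" using r 2 by (intro mult_strict_left_mono) auto
      ultimately show False by linarith
    qed
    then show ?thesis using 2 by (simp add: limit_set_def)
  next
    case 3
    then obtain e where e: "e > 0" "\<And>c'. c' \<in> S \<Longrightarrow> e \<le> (\<Sum>j<k. (head c j - c' j)\<^sup>2)"
      using S_closed[of "head c"] by (force simp: head_def not_less)
    have "(\<lambda>m. inverse (real (Suc m)) ^ 2) \<longlonglongrightarrow> 0 ^ 2" by (intro tendsto_intros LIMSEQ_inverse_real_of_nat)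
    then have "eventually (\<lambda>m. inverse (real (Suc m)) ^ 2 < e) sequentially" using e(1) by (intro order_tendstoD) auto
    then show ?thesis
    proof (rule eventually_mono)
      fix m assume m: "inverse (real (Suc m)) ^ 2 < e"
      have "Phi (inverse (real (Suc m))) c \<notin> nbhd d K (inverse (real (Suc m)))"
      proof
        assume "Phi (inverse (real (Suc m))) c \<in> nbhd d K (inverse (real (Suc m)))"
        then obtain c' where c': "c' \<in> S" "(\<Sum>j<k. (head c j - c' j)\<^sup>2) + (inverse (real (Suc m)))\<^sup>2 * tail_sq c \<le> (inverse (real (Suc m)))\<^sup>2"
          unfolding Phi_in_nbhd_iff hk by blast
        moreover have "0 \<le> (inverse (real (Suc m)))\<^sup>2 * tail_sq c" using tail_sq_nonneg by simp
        ultimately show False using e(2)[OF c'(1)] m by linarith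
      qed
      then show "Phi (inverse (real (Suc m))) c \<in> nbhd d K (inverse (real (Suc m))) \<longleftrightarrow> c \<in> limit_set"
        using 3 by (simp add: limit_set_def)
    qed
  qed
qed

end

section \<open>The barycenter as a limit of centroids of parallel bodies\<close>

context convex_body
begin

definition coord_bound where "coord_bound = (SOME R. R \<ge> 0 \<and> (\<forall>c\<in>S. \<forall>j<k. \<bar>c j\<bar> \<le> R))"

lemma coord_bound: "coord_bound \<ge> 0" "c \<in> S \<Longrightarrow> j < k \<Longrightarrow> \<bar>c j\<bar> \<le> coord_bound"
  using someI_ex[OF S_bdd[unfolded Bex_def]] unfolding coord_bound_def by auto

definition box where "box = {..<d} \<rightarrow>\<^sub>E {- (coord_bound + 1)..coord_bound + 1}"

lemma box_abs: "c \<in> box \<Longrightarrow> j < d \<Longrightarrow> \<bar>c j\<bar> \<le> coord_bound + 1"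
  unfolding box_def by (drule PiE_mem[where x=j]) auto

lemma box_sets: "box \<in> sets (leb {..<d})"
  unfolding box_def by (intro sets_PiM_I_finite) auto

lemma box_finite: "emeasure (leb {..<d}) box < \<infinity>"
  unfolding box_def using coord_bound(1) by (subst emeasure_leb_box) auto

lemma abs_le_one_if_square: "(x::real)\<^sup>2 \<le> 1 \<Longrightarrow> \<bar>x\<bar> \<le> 1"
  using abs_le_square_iff[of x 1] by simp

text \<open>
  Supplies the integrable bound for dominated convergence, uniformly in the radius.
\<close>

lemma nbhd_in_box:
  assumes r: "0 < r" "r \<le> 1" and c: "c \<in> space (Rd d)" "Phi r c \<in> nbhd d K r"
  shows "c \<in> box"
proof -
  obtain c' where c': "c' \<in> S" "(\<Sum>j<k. (c j - c' j)\<^sup>2) + r\<^sup>2 * tail_sq c \<le> r\<^sup>2"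
    using c(2) unfolding Phi_in_nbhd_iff by blast
  have nn: "0 \<le> (\<Sum>j<k. (c j - c' j)\<^sup>2)" "0 \<le> r\<^sup>2 * tail_sq c" using tail_sq_nonneg by (auto simp: sum_nonneg)
  have r1: "r\<^sup>2 \<le> 1" using r by (simp add: power_le_one)
  have cb: "\<bar>c j\<bar> \<le> coord_bound + 1" if j: "j < d" for j
  proof (cases "j < k")
    case True
    have "(c j - c' j)\<^sup>2 \<le> (\<Sum>j<k. (c j - c' j)\<^sup>2)" using True by (intro member_le_sum) auto
    then have "(c j - c' j)\<^sup>2 \<le> 1" using nn c'(2) r1 by linarith
    then have "\<bar>c j - c' j\<bar> \<le> 1" by (rule abs_le_one_if_square)
    then show ?thesis using coord_bound(2)[OF c'(1) True] by linarith
  next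
    case False
    have "r\<^sup>2 * tail_sq c \<le> r\<^sup>2 * 1" using nn c'(2) by linarith
    then have "tail_sq c \<le> 1" using r by (simp only: mult_le_cancel_left_pos zero_less_power)
    moreover have "(c j)\<^sup>2 \<le> tail_sq c" unfolding tail_sq_def using False j by (intro member_le_sum) auto
    ultimately have "\<bar>c j\<bar> \<le> 1" by (intro abs_le_one_if_square) simp
    then show ?thesis using coord_bound(1) by simp
  qed
  have "c j \<in> {- (coord_bound + 1)..coord_bound + 1}" if "j < d" for j
    using cb[OF that] unfolding atLeastAtMost_iff by linarith
  then show ?thesis using c(1) unfolding box_def by (auto simp: space_Rd PiE_iff simp del: atLeastAtMost_iff)
qed

lemma limit_set_in_box: "limit_set \<subseteq> box"
proof
  fix c assume c: "c \<in> limit_set"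
  have "(\<Sum>j<k. (c j - head c j)\<^sup>2) + 1\<^sup>2 * tail_sq c \<le> 1\<^sup>2"
    using c by (simp add: head_def limit_set_def)
  then have "Phi 1 c \<in> nbhd d K 1" unfolding Phi_in_nbhd_iff using c by (intro bexI[of _ "head c"]) (auto simp: limit_set_def)
  then show "c \<in> box" using c by (intro nbhd_in_box[of 1]) (auto simp: limit_set_def)
qed

lemma head_measurable: "head \<in> measurable (Rd d) (Rd k)"
  unfolding head_def[abs_def] Rd_def using k_le by (intro measurable_restrict measurable_component_singleton) auto

lemma tail_sq_measurable: "tail_sq \<in> borel_measurable (Rd d)"
  unfolding tail_sq_def[abs_def] by (intro borel_measurable_sum borel_measurable_power component_measurable_Rd) auto

lemma limit_set_sets: "limit_set \<in> sets (Rd d)"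
proof -
  have "limit_set = (head -` S \<inter> space (Rd d)) \<inter> {c\<in>space (Rd d). tail_sq c \<le> 1}"
    by (auto simp: limit_set_def)
  moreover have "{c\<in>space (Rd d). tail_sq c \<le> 1} \<in> sets (Rd d)" using tail_sq_measurable by measurable
  ultimately show ?thesis using measurable_sets[OF head_measurable S_sets] by auto
qed

lemma integrable_box:
  fixes f :: "point \<Rightarrow> real"
  assumes f: "f \<in> borel_measurable (Rd d)" and b: "\<And>c. c \<in> box \<Longrightarrow> \<bar>f c\<bar> \<le> M"
    and z: "\<And>c. c \<in> space (Rd d) \<Longrightarrow> c \<notin> box \<Longrightarrow> f c = 0"
  shows "integrable (leb {..<d}) f"
proof (rule Bochner_Integration.integrable_bound)
  show "integrable (leb {..<d}) (\<lambda>c. M * indicator box c)"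
    using box_sets box_finite by (intro integrable_mult_right integrable_real_indicator) auto
  show "f \<in> borel_measurable (leb {..<d})" using f by (simp add: borel_measurable_leb_Rd)
  show "AE c in leb {..<d}. norm (f c) \<le> norm (M * indicator box c)"
  proof (rule AE_I2)
    fix c assume c: "c \<in> space (leb {..<d})"
    show "norm (f c) \<le> norm (M * indicator box c)"
    proof (cases "c \<in> box")
      case True then show ?thesis using b[OF True] by simp
    next
      case False then show ?thesis using z c by (simp add: space_leb_Rd)
    qed
  qed
qed

lemma nbhd_integral_limit:
  fixes G :: "real \<Rightarrow> point \<Rightarrow> real"
  assumes G: "\<And>r. G r \<in> borel_measurable (Rd d)" and bd: "\<And>r c. 0 < r \<Longrightarrow> r \<le> 1 \<Longrightarrow> c \<in> box \<Longrightarrow> \<bar>G r c\<bar> \<le> M"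
    and G0: "\<And>c. c \<in> space (Rd d) \<Longrightarrow> (\<lambda>m. G (inverse (real (Suc m))) c) \<longlonglongrightarrow> G0 c" and G0m: "G0 \<in> borel_measurable (Rd d)"
  shows "(\<lambda>m. \<integral>c. G (inverse (real (Suc m))) c * indicator (nbhd d K (inverse (real (Suc m)))) (Phi (inverse (real (Suc m))) c) \<partial>leb {..<d})
     \<longlonglongrightarrow> (\<integral>c. G0 c * indicator limit_set c \<partial>leb {..<d})"
proof (rule integral_dominated_convergence)
  have r: "0 < inverse (real (Suc m))" "inverse (real (Suc m)) \<le> 1" for m
    by (auto simp: inverse_le_1_iff)
  show "(\<lambda>c. G0 c * indicator limit_set c) \<in> borel_measurable (leb {..<d})"
    using G0m limit_set_sets by (simp add: borel_measurable_leb_Rd)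
  show "integrable (leb {..<d}) (\<lambda>c. M * indicator box c)"
    using box_sets box_finite by (intro integrable_mult_right integrable_real_indicator) auto
  fix m
  show "(\<lambda>c. G (inverse (real (Suc m))) c * indicator (nbhd d K (inverse (real (Suc m)))) (Phi (inverse (real (Suc m))) c)) \<in> borel_measurable (leb {..<d})"
    unfolding borel_measurable_leb_Rd
    by (intro borel_measurable_times G measurable_compose[OF Phi_measurable] borel_measurable_indicator nbhd_sets)
  show "AE c in leb {..<d}. norm (G (inverse (real (Suc m))) c * indicator (nbhd d K (inverse (real (Suc m)))) (Phi (inverse (real (Suc m))) c)) \<le> M * indicator box c"
  proof (rule AE_I2)
    fix c assume "c \<in> space (leb {..<d})"
    then have c: "c \<in> space (Rd d)" by (simp add: space_leb_Rd)
    show "norm (G (inverse (real (Suc m))) c * indicator (nbhd d K (inverse (real (Suc m)))) (Phi (inverse (real (Suc m))) c)) \<le> M * indicator box c"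
    proof (cases "Phi (inverse (real (Suc m))) c \<in> nbhd d K (inverse (real (Suc m)))")
      case True
      then have cb: "c \<in> box" by (rule nbhd_in_box[OF r c])
      then show ?thesis using True bd[OF r cb] by simp
    next
      case False
      have "M * indicator box c \<ge> 0" using bd[OF r, of c m] by (cases "c \<in> box") (auto intro: order_trans[OF abs_ge_zero])
      with False show ?thesis by simp
    qed
  qed
next
  show "AE c in leb {..<d}. (\<lambda>m. G (inverse (real (Suc m))) c * indicator (nbhd d K (inverse (real (Suc m)))) (Phi (inverse (real (Suc m))) c))
      \<longlonglongrightarrow> G0 c * indicator limit_set c"
  proof (rule AE_I2)
    fix c assume "c \<in> space (leb {..<d})"
    then have c: "c \<in> space (Rd d)" by (simp add: space_leb_Rd)
    have "(\<lambda>m. indicator (nbhd d K (inverse (real (Suc m)))) (Phi (inverse (real (Suc m))) c) :: real) \<longlonglongrightarrow> indicator limit_set c"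
      by (rule tendsto_eventually, rule eventually_mono[OF Phi_in_nbhd_limit[OF c]]) (auto simp: indicator_def)
    then show "(\<lambda>m. G (inverse (real (Suc m))) c * indicator (nbhd d K (inverse (real (Suc m)))) (Phi (inverse (real (Suc m))) c))
      \<longlonglongrightarrow> G0 c * indicator limit_set c" by (intro tendsto_mult G0 c)
  qed
qed

text \<open>
  The volume of the unit ball in the normal directions.
\<close>

definition tail_vol :: real where "tail_vol = (\<integral>y. indicator {y. tail_sq y \<le> 1} y \<partial>leb {k..<d})"

lemma tail_set_sets: "{y\<in>space (leb {k..<d}). tail_sq y \<le> 1} \<in> sets (leb {k..<d})"
proof -
  have "(\<lambda>y. tail_sq y) \<in> borel_measurable (leb {k..<d})"
    unfolding tail_sq_def
  proof (intro borel_measurable_sum borel_measurable_power)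
    fix j assume "j \<in> {k..<d}"
    then show "(\<lambda>y. y j) \<in> borel_measurable (leb {k..<d})"
      using measurable_component_singleton[of j "{k..<d}" "\<lambda>_. lborel"] by simp
  qed
  then show ?thesis by measurable
qed

text \<open>
  The ball contains a cube and is contained in one.
\<close>

lemma tail_vol_pos: "tail_vol > 0"
proof -
  let ?L = "leb {k..<d}" and ?E = "{y\<in>space (leb {k..<d}). tail_sq y \<le> 1}"
  have tail_vol: "tail_vol = measure ?L ?E"
  proof -
    have "tail_vol = (\<integral>y. indicator ?E y \<partial>?L)" unfolding tail_vol_def by (intro Bochner_Integration.integral_cong) (auto simp: indicator_def)
    also have "\<dots> = measure ?L (?E \<inter> space ?L)" by (rule Bochner_Integration.integral_indicator)
    also have "?E \<inter> space ?L = ?E" by auto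
    finally show ?thesis .
  qed
  (* a side with d q <= 1, so that the cube of side q fits into the ball *)
  define q where "q = 1 / real (Suc d)"
  have q: "0 < q" "q \<le> 1" by (auto simp: q_def)
  have "?E \<subseteq> {k..<d} \<rightarrow>\<^sub>E {-1..1}"
  proof
    fix y assume y: "y \<in> ?E"
    have "y j \<in> {-1..1}" if "j \<in> {k..<d}" for j
    proof -
      have "(y j)\<^sup>2 \<le> tail_sq y" unfolding tail_sq_def using that by (intro member_le_sum) auto
      then have "\<bar>y j\<bar> \<le> 1" using y by (intro abs_le_one_if_square) simp
      then show ?thesis by (simp add: abs_le_iff)
    qed
    then show "y \<in> {k..<d} \<rightarrow>\<^sub>E {-1..1}" using y by (auto simp: space_leb PiE_iff simp del: atLeastAtMost_iff)
  qed
  then have "emeasure ?L ?E \<le> emeasure ?L ({k..<d} \<rightarrow>\<^sub>E {-1..1})" by (intro emeasure_mono sets_PiM_I_finite) auto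
  also have "\<dots> < \<infinity>" by (subst emeasure_leb_box) auto
  finally have fin: "emeasure ?L ?E < \<infinity>" .
  have "{k..<d} \<rightarrow>\<^sub>E {0..q} \<subseteq> ?E"
  proof
    fix y assume y: "y \<in> {k..<d} \<rightarrow>\<^sub>E {0..q}"
    have "(y j)\<^sup>2 \<le> q" if "j \<in> {k..<d}" for j
    proof -
      have "0 \<le> y j" "y j \<le> q" using PiE_mem[OF y that] by auto
      then have "y j * y j \<le> q * 1" using q by (intro mult_mono) auto
      then show ?thesis by (simp add: power2_eq_square)
    qed
    then have "tail_sq y \<le> real (card {k..<d}) * q" unfolding tail_sq_def by (intro sum_bounded_above)
    also have "\<dots> \<le> real d * q" using q by (intro mult_right_mono) auto
    also have "\<dots> \<le> 1" by (simp add: q_def)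
    finally show "y \<in> ?E" using y by (auto simp: space_leb PiE_iff)
  qed
  then have "emeasure ?L ({k..<d} \<rightarrow>\<^sub>E {0..q}) \<le> emeasure ?L ?E" by (intro emeasure_mono tail_set_sets)
  moreover have "0 < emeasure ?L ({k..<d} \<rightarrow>\<^sub>E {0..q})" using q by (subst emeasure_leb_box) auto
  ultimately have "0 < emeasure ?L ?E" by (rule less_le_trans[rotated])
  then show ?thesis unfolding tail_vol using fin by (simp add: emeasure_eq_ennreal_measure less_top)
qed

text \<open>
  Fubini for the product structure of the limit set.
\<close>

lemma integral_limit_set:
  fixes h :: "point \<Rightarrow> real"
  assumes h: "h \<in> borel_measurable (Rd k)" and bd: "\<And>c. c \<in> S \<Longrightarrow> \<bar>h c\<bar> \<le> M"
  shows "(\<integral>c. h (head c) * indicator limit_set c \<partial>leb {..<d}) = (\<integral>c. indicator S c * h c \<partial>leb {..<k}) * tail_vol"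
proof -
  have un: "{..<d} = {..<k} \<union> {k..<d}" using k_le by auto
  let ?f = "\<lambda>c. h (head c) * indicator limit_set c"
  have "integrable (leb {..<d}) ?f"
  proof (rule integrable_box)
    show "?f \<in> borel_measurable (Rd d)"
      using measurable_compose[OF head_measurable h] limit_set_sets by simp
    show "\<bar>?f c\<bar> \<le> max M 0" if "c \<in> box" for c
      using bd[of "head c"] by (auto simp: indicator_def limit_set_def le_max_iff_disj)
    show "?f c = 0" if "c \<notin> box" for c using that limit_set_in_box by (auto simp: indicator_def)
  qed
  then have "(\<integral>c. ?f c \<partial>leb {..<d}) = (\<integral>x. (\<integral>y. ?f (merge {..<k} {k..<d} (x, y)) \<partial>leb {k..<d}) \<partial>leb {..<k})"
    unfolding un by (intro lb.product_integral_fold) auto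
  also have "\<dots> = (\<integral>x. indicator S x * h x * tail_vol \<partial>leb {..<k})"
  proof (rule Bochner_Integration.integral_cong[OF refl])
    fix x assume x: "x \<in> space (leb {..<k})"
    have "(\<integral>y. ?f (merge {..<k} {k..<d} (x, y)) \<partial>leb {k..<d})
      = (\<integral>y. (indicator S x * h x) * indicator {y. tail_sq y \<le> 1} y \<partial>leb {k..<d})"
    proof (rule Bochner_Integration.integral_cong[OF refl])
      fix y assume y: "y \<in> space (leb {k..<d})"
      let ?c = "merge {..<k} {k..<d} (x, y)"
      have "?c \<in> space (Rd d)" using x y k_le by (auto simp: space_leb space_Rd PiE_iff merge_def extensional_def)
      moreover have hd: "head ?c = x"
      proof
        fix j show "head ?c j = x j" using x by (auto simp: head_def merge_def space_leb PiE_iff extensional_def)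
      qed
      moreover have "tail_sq ?c = tail_sq y" unfolding tail_sq_def by (intro sum.cong) (auto simp: merge_def)
      ultimately have "?c \<in> limit_set \<longleftrightarrow> x \<in> S \<and> tail_sq y \<le> 1" by (simp add: limit_set_def)
      then show "?f ?c = (indicator S x * h x) * indicator {y. tail_sq y \<le> 1} y"
        using hd by (auto simp: indicator_def)
    qed
    then show "(\<integral>y. ?f (merge {..<k} {k..<d} (x, y)) \<partial>leb {k..<d}) = indicator S x * h x * tail_vol"
      by (simp add: tail_vol_def)
  qed
  finally show ?thesis by simp
qed

text \<open>
  In the rescaled coordinates numerator and denominator converge to integrals over the product of
  the body and a ball of normal directions, where the coordinate function no longer depends on the
  normal part. The factor \<open>tail_vol\<close> cancels. The left side makes no reference to the affine hull.
\<close>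

theorem barycenter_parallel_limit:
  assumes i: "i < d"
  shows "(\<lambda>m. (\<integral>x. x i * indicator (nbhd d K (inverse (real (Suc m)))) x \<partial>leb {..<d})
            / (\<integral>x. indicator (nbhd d K (inverse (real (Suc m)))) x \<partial>leb {..<d})) \<longlonglongrightarrow> barycenter d K i"
proof -
  let ?r = "\<lambda>m. inverse (real (Suc m))"
  define I where "I m = (\<integral>c. Phi (?r m) c i * indicator (nbhd d K (?r m)) (Phi (?r m) c) \<partial>leb {..<d})" for m
  define J where "J m = (\<integral>c. 1 * indicator (nbhd d K (?r m)) (Phi (?r m) c) \<partial>leb {..<d} :: real)" for m
  have fm: "(\<lambda>c. flat_param d k a b c i) \<in> borel_measurable (Rd k)"
    using measurable_compose[OF flat_param_measurable component_measurable_Rd[OF i]] .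
  have eq: "(\<integral>x. x i * indicator (nbhd d K (?r m)) x \<partial>leb {..<d}) / (\<integral>x. indicator (nbhd d K (?r m)) x \<partial>leb {..<d}) = I m / J m" for m
  proof -
    have "?r m > 0" by simp
    then obtain s where s: "s > 0" "\<And>f :: point \<Rightarrow> real. f \<in> borel_measurable (Rd d) \<Longrightarrow>
       (\<integral>c. f (Phi (?r m) c) \<partial>leb {..<d}) = s * (\<integral>x. f x \<partial>leb {..<d})"
      using Phi_change_of_variables by blast
    have "I m = s * (\<integral>x. x i * indicator (nbhd d K (?r m)) x \<partial>leb {..<d})"
      unfolding I_def by (rule s(2)) (intro borel_measurable_times component_measurable_Rd i borel_measurable_indicator nbhd_sets)
    moreover have "J m = s * (\<integral>x. indicator (nbhd d K (?r m)) x \<partial>leb {..<d})"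
      unfolding J_def mult_1 by (rule s(2)) (intro borel_measurable_indicator nbhd_sets)
    ultimately show ?thesis using s(1) by simp
  qed
  have "I \<longlonglongrightarrow> (\<integral>c. flat_param d k a b (head c) i * indicator limit_set c \<partial>leb {..<d})"
    unfolding I_def
  proof (rule nbhd_integral_limit)
    show "(\<lambda>c. Phi r c i) \<in> borel_measurable (Rd d)" for r
      by (rule measurable_compose[OF Phi_measurable component_measurable_Rd[OF i]])
    show "(\<lambda>c. flat_param d k a b (head c) i) \<in> borel_measurable (Rd d)"
      by (rule measurable_compose[OF head_measurable fm])
    show "\<bar>Phi r c i\<bar> \<le> \<bar>a i\<bar> + (\<Sum>j<d. (coord_bound + 1) * \<bar>B j i\<bar>)" if r: "0 < r" "r \<le> 1" and c: "c \<in> box" for r c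
    proof -
      have "\<bar>stretch r c j\<bar> \<le> coord_bound + 1" if "j < d" for j
      proof -
        have "\<bar>r\<bar> * \<bar>c j\<bar> \<le> 1 * \<bar>c j\<bar>" using r by (intro mult_right_mono) auto
        then show ?thesis using box_abs[OF c that] by (auto simp: stretch_def abs_mult)
      qed
      then have "\<bar>\<Sum>j<d. stretch r c j * B j i\<bar> \<le> (\<Sum>j<d. (coord_bound + 1) * \<bar>B j i\<bar>)"
        by (intro order_trans[OF sum_abs] sum_mono) (auto simp: abs_mult intro!: mult_right_mono)
      then show ?thesis using i by (simp add: Phi_def lincomb_D)
    qed
    show "(\<lambda>m. Phi (?r m) c i) \<longlonglongrightarrow> flat_param d k a b (head c) i" if "c \<in> space (Rd d)" for c
    proof -
      have "(\<lambda>m. stretch (?r m) c j) \<longlonglongrightarrow> (if j < k then c j else 0)" for j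
        unfolding stretch_def using tendsto_mult[OF LIMSEQ_inverse_real_of_nat tendsto_const[of "c j"]] by simp
      then have "(\<lambda>m. a i + (\<Sum>j<d. stretch (?r m) c j * B j i)) \<longlonglongrightarrow> a i + (\<Sum>j<d. (if j < k then c j else 0) * B j i)"
        by (intro tendsto_intros)
      moreover have "(\<Sum>j<d. (if j < k then c j else 0) * B j i) = (\<Sum>j<k. head c j * b j i)"
        using k_le B_b by (intro sum.mono_neutral_cong_right) (auto simp: head_def)
      ultimately show ?thesis using i by (simp add: Phi_def lincomb_D flat_param_def)
    qed
  qed
  also have "(\<integral>c. flat_param d k a b (head c) i * indicator limit_set c \<partial>leb {..<d})
      = (\<integral>c. indicator S c * flat_param d k a b c i \<partial>leb {..<k}) * tail_vol"
  proof -
    obtain R where "\<And>x. x \<in> K \<Longrightarrow> \<bar>x i\<bar> \<le> R" using K_bdd i by blast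
    then show ?thesis using fm flat_param_S by (intro integral_limit_set[of "\<lambda>c. flat_param d k a b c i" R]) auto
  qed
  finally have I: "I \<longlonglongrightarrow> (\<integral>c. indicator S c * flat_param d k a b c i \<partial>leb {..<k}) * tail_vol" .
  have "J \<longlonglongrightarrow> (\<integral>c. 1 * indicator limit_set c \<partial>leb {..<d})"
    unfolding J_def by (rule nbhd_integral_limit[of "\<lambda>_ _. 1" 1]) auto
  also have "(\<integral>c. 1 * indicator limit_set c \<partial>leb {..<d} :: real) = (\<integral>c. indicator S c * 1 \<partial>leb {..<k}) * tail_vol"
    by (rule integral_limit_set[of "\<lambda>_. 1" 1]) auto
  also have "(\<integral>c. indicator S c * 1 \<partial>leb {..<k}) = vol"
    using S_sets by (simp add: vol_def sets_leb_Rd)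
  finally have J: "J \<longlonglongrightarrow> vol * tail_vol" .
  have "(\<lambda>m. I m / J m) \<longlonglongrightarrow> (\<integral>c. indicator S c * flat_param d k a b c i \<partial>leb {..<k}) * tail_vol / (vol * tail_vol)"
    using vol_pos tail_vol_pos by (intro tendsto_divide I J) auto
  also have "(\<integral>c. indicator S c * flat_param d k a b c i \<partial>leb {..<k}) * tail_vol / (vol * tail_vol) = barycenter d K i"
    using tail_vol_pos by (simp add: barycenter_eq[OF i])
  finally show ?thesis unfolding eq .
qed

end

section \<open>Level sets of the empirical depth\<close>

lemma bounded_points_convergent_subsequence:
  fixes z :: "nat \<Rightarrow> point"
  assumes "\<And>l i. i < d \<Longrightarrow> \<bar>z l i\<bar> \<le> R i"
  shows "\<exists>s w. strict_mono s \<and> (\<forall>i<d. (\<lambda>l. z (s l) i) \<longlonglongrightarrow> w i)"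
  using assms
proof (induction d)
  case 0
  show ?case by (intro exI[of _ id]) (auto simp: strict_mono_def)
next
  case (Suc d)
  have "\<exists>s w. strict_mono s \<and> (\<forall>i<d. (\<lambda>l. z (s l) i) \<longlonglongrightarrow> w i)"
    by (rule Suc.IH) (simp add: Suc.prems)
  then obtain s w where s: "strict_mono (s :: nat \<Rightarrow> nat)" and w: "\<And>i. i < d \<Longrightarrow> (\<lambda>l. z (s l) i) \<longlonglongrightarrow> w i"
    by blast
  have "bounded (range (\<lambda>l. z (s l) d))"
    using Suc.prems[of d] by (intro boundedI[of _ "R d"]) auto
  then obtain v t where t: "strict_mono (t :: nat \<Rightarrow> nat)" "((\<lambda>l. z (s l) d) \<circ> t) \<longlonglongrightarrow> v"
    using bounded_imp_convergent_subsequence by metis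
  have "(\<lambda>l. z (s (t l)) i) \<longlonglongrightarrow> (w(d := v)) i" if "i < Suc d" for i
  proof (cases "i = d")
    case True then show ?thesis using t(2) by (simp add: comp_def)
  next
    case False
    then have "(\<lambda>l. z (s l) i) \<longlonglongrightarrow> w i" using that w by simp
    from LIMSEQ_subseq_LIMSEQ[OF this t(1)] show ?thesis using False by (simp add: comp_def)
  qed
  then show ?case using strict_mono_o[OF s t(1)] by (intro exI[of _ "s \<circ> t"] exI[of _ "w(d := v)"]) (simp add: comp_def)
qed

text \<open>
  The points of empirical depth at least \<open>m/n\<close>. The direction \<open>u\<close> ranges over all functions
  instead of the unit sphere, which is harmless because the condition is invariant under positive
  scaling and \<open>u = 0\<close> counts all sample points.
\<close>

definition level_set :: "nat \<Rightarrow> nat \<Rightarrow> (nat \<Rightarrow> point) \<Rightarrow> nat \<Rightarrow> point set" where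
  "level_set d n X m = {x\<in>space (Rd d). \<forall>u. m \<le> card {i. i < n \<and> ip d (X i) u \<le> ip d x u}}"

text \<open>
  Closed inequalities survive limits, so the count can only jump up in the limit.
\<close>

lemma card_count_limit:
  fixes f :: "nat \<Rightarrow> nat \<Rightarrow> real"
  assumes f: "\<And>i. i < n \<Longrightarrow> (\<lambda>l. f l i) \<longlonglongrightarrow> F i" and g: "g \<longlonglongrightarrow> G"
    and m: "\<And>l. m \<le> card {i. i < n \<and> f l i \<le> g l}"
  shows "m \<le> card {i. i < n \<and> F i \<le> G}"
proof -
  have "eventually (\<lambda>l. F i > G \<longrightarrow> f l i > g l) sequentially" if i: "i < n" for i
  proof (cases "F i > G")
    case True
    have "(\<lambda>l. f l i - g l) \<longlonglongrightarrow> F i - G" by (intro tendsto_diff f g i)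
    then have "eventually (\<lambda>l. f l i - g l > 0) sequentially" using True by (intro order_tendstoD) auto
    then show ?thesis by (rule eventually_mono) auto
  qed simp
  then have "eventually (\<lambda>l. \<forall>i\<in>{..<n}. F i > G \<longrightarrow> f l i > g l) sequentially"
    by (intro eventually_ball_finite) auto
  then obtain l where l: "\<forall>i\<in>{..<n}. F i > G \<longrightarrow> f l i > g l" by (auto simp: eventually_sequentially)
  have "m \<le> card {i. i < n \<and> f l i \<le> g l}" by (rule m)
  also have "\<dots> \<le> card {i. i < n \<and> F i \<le> G}" using l by (intro card_mono) (auto simp: not_less[symmetric])
  finally show ?thesis .
qed

lemma tendsto_ip_left: "(\<And>i. i < d \<Longrightarrow> (\<lambda>l. z l i) \<longlonglongrightarrow> w i) \<Longrightarrow> (\<lambda>l. ip d (z l) u) \<longlonglongrightarrow> ip d w u"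
  unfolding ip_def by (intro tendsto_sum tendsto_mult tendsto_const) auto

lemma tendsto_ip_right: "(\<And>i. i < d \<Longrightarrow> (\<lambda>l. z l i) \<longlonglongrightarrow> w i) \<Longrightarrow> (\<lambda>l. ip d u (z l)) \<longlonglongrightarrow> ip d u w"
  unfolding ip_def by (intro tendsto_sum tendsto_mult tendsto_const) auto

definition rational_point :: "nat \<Rightarrow> nat \<Rightarrow> point" where
  "rational_point d = from_nat_into (rational_points d)"

lemma range_rational_point: "range (rational_point d) = rational_points d"
proof -
  obtain v where "v \<in> rational_points d" using rational_approx[of 1 d "\<lambda>_. 0"] by force
  then show ?thesis unfolding rational_point_def
    by (intro range_from_nat_into countable_rational_points) auto
qed

lemma rational_point_approx:
  assumes "\<epsilon> > 0"
  shows "\<exists>j. \<forall>i<d. \<bar>rational_point d j i - u i\<bar> \<le> \<epsilon>"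
proof -
  obtain v where v: "v \<in> rational_points d" "\<And>i. i < d \<Longrightarrow> \<bar>v i - u i\<bar> \<le> \<epsilon>"
    using rational_approx[OF assms] by blast
  then obtain j where "v = rational_point d j" using range_rational_point by (metis rangeE)
  then show ?thesis using v by blast
qed

lemma rational_point_seq:
  obtains j where "\<And>i. i < d \<Longrightarrow> (\<lambda>l. rational_point d (j l) i) \<longlonglongrightarrow> u i"
proof -
  have "\<exists>j. \<forall>i<d. \<bar>rational_point d j i - u i\<bar> \<le> inverse (real (Suc l))" for l
    by (rule rational_point_approx) simp
  then obtain j where j: "\<And>l i. i < d \<Longrightarrow> \<bar>rational_point d (j l) i - u i\<bar> \<le> inverse (real (Suc l))" by metis
  have "(\<lambda>l. rational_point d (j l) i) \<longlonglongrightarrow> u i" if "i < d" for i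
  proof (rule LIM_zero_cancel, rule Lim_null_comparison[OF _ LIMSEQ_inverse_real_of_nat])
    show "\<forall>\<^sub>F l in sequentially. norm (rational_point d (j l) i - u i) \<le> inverse (real (Suc l))"
      using j[OF that] by simp
  qed
  then show ?thesis using that by blast
qed

lemma level_rational_directions:
  fixes X :: "nat \<Rightarrow> point"
  assumes "\<And>j. m \<le> card {i. i < n \<and> ip d (X i) (rational_point d j) \<le> ip d x (rational_point d j)}"
  shows "m \<le> card {i. i < n \<and> ip d (X i) u \<le> ip d x u}"
proof -
  obtain j where j: "\<And>i. i < d \<Longrightarrow> (\<lambda>l. rational_point d (j l) i) \<longlonglongrightarrow> u i" using rational_point_seq[of d u] by blast
  have lim: "(\<lambda>l. ip d y (rational_point d (j l))) \<longlonglongrightarrow> ip d y u" for y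
    by (rule tendsto_ip_right) (rule j)
  show ?thesis
  proof (rule card_count_limit)
    show "(\<lambda>l. ip d (X i) (rational_point d (j l))) \<longlonglongrightarrow> ip d (X i) u" for i by (rule lim)
    show "(\<lambda>l. ip d x (rational_point d (j l))) \<longlonglongrightarrow> ip d x u" by (rule lim)
    show "m \<le> card {i. i < n \<and> ip d (X i) (rational_point d (j l)) \<le> ip d x (rational_point d (j l))}" for l
      by (rule assms)
  qed
qed

text \<open>
  A countable description of the parallel bodies, using only rational points and directions. A
  point \<open>z\<close> of the level set within distance \<open>r\<close> need not be rational, but a rational point close
  to it satisfies all conditions with a slack \<open>1/(l + 1)\<close>, proportional to the size of the
  direction in the depth conditions. Conversely, a limit of points with vanishing slack belongs to
  the level set.
\<close>

lemma nbhd_level_set_iff: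
  assumes x: "x \<in> space (Rd d)"
  shows "x \<in> nbhd d (level_set d n X m) r \<longleftrightarrow>
    (\<forall>l. \<exists>q. sqdist d x (rational_point d q) \<le> r\<^sup>2 + inverse (real (Suc l)) \<and>
       (\<forall>j. m \<le> card {i. i < n \<and> ip d (X i) (rational_point d j)
            \<le> ip d (rational_point d q) (rational_point d j) + (\<Sum>i<d. \<bar>rational_point d j i\<bar>) * inverse (real (Suc l))}))"
    (is "_ \<longleftrightarrow> (\<forall>l. \<exists>q. ?P l q)")
proof
  assume "x \<in> nbhd d (level_set d n X m) r"
  then obtain z where z: "z \<in> level_set d n X m" "sqdist d x z \<le> r\<^sup>2" by (auto simp: nbhd_def)
  show "\<forall>l. \<exists>q. ?P l q"
  proof
    fix l
    define L where "L = inverse (real (Suc l))"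
    define A where "A = (\<Sum>i<d. 2 * \<bar>x i - z i\<bar> + 1)"
    have A: "A \<ge> 0" unfolding A_def by (intro sum_nonneg) auto
    have L: "0 < L" "L \<le> 1" by (auto simp: L_def inverse_le_1_iff)
    (* small enough for both the distance and the depth conditions to stay within the slack L *)
    define e where "e = L / (1 + A)"
    have "e * 1 \<le> e * (1 + A)" using A L by (intro mult_left_mono) (auto simp: e_def)
    then have eL: "e \<le> L" using A by (simp add: e_def)
    have e: "e > 0" "e \<le> 1" "e * A \<le> L" using A L eL by (auto simp: e_def field_simps)
    obtain q where q: "\<And>i. i < d \<Longrightarrow> \<bar>rational_point d q i - z i\<bar> \<le> e"
      using rational_point_approx[OF e(1)] by blast
    let ?y = "rational_point d q"
    have "sqdist d x ?y \<le> (\<Sum>i<d. (x i - z i)\<^sup>2 + e * (2 * \<bar>x i - z i\<bar> + 1))"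
      unfolding sqdist_def
    proof (rule sum_mono)
      fix i assume i: "i \<in> {..<d}"
      define t where "t = z i - ?y i"
      have t: "\<bar>t\<bar> \<le> e" using q[of i] i by (simp add: t_def abs_minus_commute)
      have "(x i - ?y i)\<^sup>2 = (x i - z i)\<^sup>2 + 2 * (x i - z i) * t + t\<^sup>2" by (simp add: t_def power2_eq_square algebra_simps)
      also have "2 * (x i - z i) * t \<le> 2 * \<bar>x i - z i\<bar> * e"
      proof -
        have "2 * (x i - z i) * t \<le> \<bar>2 * (x i - z i) * t\<bar>" by simp
        also have "\<dots> = 2 * \<bar>x i - z i\<bar> * \<bar>t\<bar>" by (simp only: abs_mult abs_numeral)
        also have "\<dots> \<le> 2 * \<bar>x i - z i\<bar> * e" using t by (intro mult_left_mono) auto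
        finally show ?thesis .
      qed
      also have "t\<^sup>2 \<le> e"
      proof -
        have "\<bar>t\<bar> * \<bar>t\<bar> \<le> e * 1" using t e by (intro mult_mono) auto
        then show ?thesis by (simp add: power2_eq_square abs_mult[symmetric])
      qed
      finally show "(x i - ?y i)\<^sup>2 \<le> (x i - z i)\<^sup>2 + e * (2 * \<bar>x i - z i\<bar> + 1)" by (simp add: algebra_simps)
    qed
    also have "\<dots> = sqdist d x z + e * A" unfolding sqdist_def A_def sum.distrib[of "\<lambda>i. (x i - z i)\<^sup>2"] sum_distrib_left ..
    also have "\<dots> \<le> r\<^sup>2 + L" using z(2) e(3) by linarith
    finally have 1: "sqdist d x ?y \<le> r\<^sup>2 + L" .
    have 2: "m \<le> card {i. i < n \<and> ip d (X i) u \<le> ip d ?y u + (\<Sum>i<d. \<bar>u i\<bar>) * L}" for u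
    proof -
      have "\<bar>ip d u (\<lambda>i. z i - ?y i)\<bar> \<le> (\<Sum>i<d. \<bar>u i\<bar>) * L"
        using q eL by (intro abs_ip_le) (force simp: abs_minus_commute)
      then have "ip d z u \<le> ip d ?y u + (\<Sum>i<d. \<bar>u i\<bar>) * L"
        unfolding ip_commute[of d _ u] ip_diff_right[symmetric] abs_le_iff by linarith
      then have "card {i. i < n \<and> ip d (X i) u \<le> ip d z u} \<le> card {i. i < n \<and> ip d (X i) u \<le> ip d ?y u + (\<Sum>i<d. \<bar>u i\<bar>) * L}"
        by (intro card_mono) auto
      moreover have "m \<le> card {i. i < n \<and> ip d (X i) u \<le> ip d z u}" using z(1) by (simp add: level_set_def)
      ultimately show ?thesis by linarith
    qed
    show "\<exists>q. ?P l q" using 1 2 unfolding L_def by blast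
  qed
next
  assume "\<forall>l. \<exists>q. ?P l q"
  then have "\<exists>q. \<forall>l. ?P l (q l)" by (rule choice)
  then obtain q where q: "\<forall>l. ?P l (q l)" by (elim exE)
  define z where "z l = rational_point d (q l)" for l
  have zd: "sqdist d x (z l) \<le> r\<^sup>2 + inverse (real (Suc l))" for l
    unfolding z_def using spec[OF q, of l] by (rule conjunct1)
  have zc: "m \<le> card {i. i < n \<and> ip d (X i) (rational_point d j)
            \<le> ip d (z l) (rational_point d j) + (\<Sum>i<d. \<bar>rational_point d j i\<bar>) * inverse (real (Suc l))}" for l j
    unfolding z_def using conjunct2[OF spec[OF q, of l]] by (rule spec)
  have "\<bar>z l i\<bar> \<le> \<bar>x i\<bar> + (r\<^sup>2 + 2)" if i: "i < d" for l i
  proof -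
    have "(x i - z l i)\<^sup>2 \<le> sqdist d x (z l)" unfolding sqdist_def using i by (intro member_le_sum) auto
    also have "\<dots> \<le> r\<^sup>2 + 1" using zd[of l] inverse_le_1_iff[of "real (Suc l)"] by auto
    finally have s: "(x i - z l i)\<^sup>2 \<le> r\<^sup>2 + 1" .
    have "0 \<le> (\<bar>x i - z l i\<bar> - 1)\<^sup>2" by simp
    then have "2 * \<bar>x i - z l i\<bar> \<le> (x i - z l i)\<^sup>2 + 1" by (simp add: power2_eq_square algebra_simps abs_mult[symmetric])
    then have "2 * \<bar>x i - z l i\<bar> \<le> r\<^sup>2 + 2" using s by linarith
    moreover have "\<bar>z l i\<bar> \<le> \<bar>x i\<bar> + \<bar>x i - z l i\<bar>" by linarith
    moreover have "0 \<le> r\<^sup>2" by simp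
    moreover have "B \<le> C + (D + 2)" if "2 * A \<le> D + 2" "B \<le> C + A" "0 \<le> D" for A B C D :: real
      using that by linarith
    ultimately show ?thesis by blast
  qed
  then have "\<exists>s w. strict_mono (s :: nat \<Rightarrow> nat) \<and> (\<forall>i<d. (\<lambda>l. z (s l) i) \<longlonglongrightarrow> w i)"
    by (intro bounded_points_convergent_subsequence[where R = "\<lambda>i. \<bar>x i\<bar> + (r\<^sup>2 + 2)"])
  then obtain s w
    where s: "strict_mono (s :: nat \<Rightarrow> nat)" and ww: "\<forall>i<d. (\<lambda>l. z (s l) i) \<longlonglongrightarrow> w i"
    by (elim exE conjE)
  have w: "(\<lambda>l. z (s l) i) \<longlonglongrightarrow> w i" if "i < d" for i using ww that by simp
  have inv: "(\<lambda>l. inverse (real (Suc (s l)))) \<longlonglongrightarrow> 0"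
    using LIMSEQ_subseq_LIMSEQ[OF LIMSEQ_inverse_real_of_nat s] by (simp add: comp_def)
  define w' where "w' = (\<lambda>i\<in>{..<d}. w i)"
  have w': "(\<lambda>l. z (s l) i) \<longlonglongrightarrow> w' i" if "i < d" for i using w that by (simp add: w'_def)
  have "sqdist d x w' \<le> r\<^sup>2"
  proof (rule LIMSEQ_le)
    show "(\<lambda>l. sqdist d x (z (s l))) \<longlonglongrightarrow> sqdist d x w'"
      unfolding sqdist_def using w' by (intro tendsto_sum tendsto_power tendsto_diff tendsto_const) auto
    show "(\<lambda>l. r\<^sup>2 + inverse (real (Suc (s l)))) \<longlonglongrightarrow> r\<^sup>2"
      using tendsto_add[OF tendsto_const[of "r\<^sup>2"] inv] by simp
    show "\<exists>N. \<forall>l\<ge>N. sqdist d x (z (s l)) \<le> r\<^sup>2 + inverse (real (Suc (s l)))"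
      by (intro exI allI impI) (rule zd)
  qed
  moreover have "w' \<in> level_set d n X m"
    unfolding level_set_def
  proof (intro CollectI conjI allI)
    show "w' \<in> space (Rd d)" unfolding w'_def by simp
    fix u
    show "m \<le> card {i. i < n \<and> ip d (X i) u \<le> ip d w' u}"
    proof (rule level_rational_directions)
      fix j
      let ?u = "rational_point d j"
      have "(\<lambda>l. ip d (z (s l)) ?u + (\<Sum>i<d. \<bar>?u i\<bar>) * inverse (real (Suc (s l)))) \<longlonglongrightarrow> ip d w' ?u + (\<Sum>i<d. \<bar>?u i\<bar>) * 0"
        by (intro tendsto_add tendsto_mult tendsto_const inv tendsto_ip_left w')
      then have lim: "(\<lambda>l. ip d (z (s l)) ?u + (\<Sum>i<d. \<bar>?u i\<bar>) * inverse (real (Suc (s l)))) \<longlonglongrightarrow> ip d w' ?u" by simp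
      show "m \<le> card {i. i < n \<and> ip d (X i) ?u \<le> ip d w' ?u}"
      proof (rule card_count_limit)
        show "(\<lambda>l. ip d (X i) ?u) \<longlonglongrightarrow> ip d (X i) ?u" for i by (rule tendsto_const)
        show "(\<lambda>l. ip d (z (s l)) ?u + (\<Sum>i<d. \<bar>?u i\<bar>) * inverse (real (Suc (s l)))) \<longlonglongrightarrow> ip d w' ?u" by (rule lim)
        show "m \<le> card {i. i < n \<and> ip d (X i) ?u \<le> ip d (z (s l)) ?u + (\<Sum>i<d. \<bar>?u i\<bar>) * inverse (real (Suc (s l)))}" for l
          by (rule zc)
      qed
    qed
  qed
  ultimately show "x \<in> nbhd d (level_set d n X m) r" using x unfolding nbhd_def by blast
qed

lemma pred_card_ge:
  fixes P :: "'w \<Rightarrow> nat \<Rightarrow> bool"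
  assumes "\<And>i. i < n \<Longrightarrow> Measurable.pred N (\<lambda>w. P w i)"
  shows "Measurable.pred N (\<lambda>w. m \<le> card {i. i < n \<and> P w i})"
proof -
  have eq: "real (card {i. i < n \<and> P w i}) = (\<Sum>i<n. if P w i then 1 else 0)" for w
  proof -
    have "(\<Sum>i<n. if P w i then 1 else 0 :: real) = (\<Sum>i\<in>{i. i < n \<and> P w i}. 1)"
      by (intro sum.mono_neutral_cong_right) auto
    then show ?thesis by simp
  qed
  have "(\<lambda>w. \<Sum>i<n. if P w i then 1 else 0 :: real) \<in> borel_measurable N"
  proof (intro borel_measurable_sum)
    fix i assume "i \<in> {..<n}"
    then have [measurable]: "Measurable.pred N (\<lambda>w. P w i)" using assms by simp
    show "(\<lambda>w. if P w i then 1 else 0 :: real) \<in> borel_measurable N" by measurable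
  qed
  then have "Measurable.pred N (\<lambda>w. real m \<le> (\<Sum>i<n. if P w i then 1 else 0))" by measurable
  then show ?thesis unfolding of_nat_le_iff[symmetric, where 'a = real] eq .
qed

text \<open>
  Joint measurability in the sample and the point, as Fubini's theorem requires.
\<close>

lemma nbhd_level_set_measurable:
  assumes X: "\<And>i e. i < n \<Longrightarrow> e < d \<Longrightarrow> (\<lambda>w. X w i e) \<in> borel_measurable N"
    and x: "\<And>e. e < d \<Longrightarrow> (\<lambda>w. x w e) \<in> borel_measurable N" and xs: "\<And>w. w \<in> space N \<Longrightarrow> x w \<in> space (Rd d)"
  shows "Measurable.pred N (\<lambda>w. x w \<in> nbhd d (level_set d n (X w) m) r)"
proof -
  have ipX: "(\<lambda>w. ip d (X w i) u) \<in> borel_measurable N" if "i < n" for i u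
    unfolding ip_def using that by (intro borel_measurable_sum borel_measurable_times X) auto
  have sq: "(\<lambda>w. sqdist d (x w) z) \<in> borel_measurable N" for z
    unfolding sqdist_def by (intro borel_measurable_sum borel_measurable_power borel_measurable_diff x) auto
  define R where "R w \<longleftrightarrow> (\<forall>l. \<exists>q. sqdist d (x w) (rational_point d q) \<le> r\<^sup>2 + inverse (real (Suc l)) \<and>
       (\<forall>j. m \<le> card {i. i < n \<and> ip d (X w i) (rational_point d j)
            \<le> ip d (rational_point d q) (rational_point d j) + (\<Sum>i<d. \<bar>rational_point d j i\<bar>) * inverse (real (Suc l))}))" for w
  have eq: "x w \<in> nbhd d (level_set d n (X w) m) r \<longleftrightarrow> R w" if "w \<in> space N" for w
    unfolding R_def by (rule nbhd_level_set_iff[OF xs[OF that]])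
  have "Measurable.pred N R"
    unfolding R_def[abs_def]
  proof (intro pred_intros_countable pred_intros_logic pred_card_ge)
    show "Measurable.pred N (\<lambda>w. sqdist d (x w) (rational_point d q) \<le> r\<^sup>2 + inverse (real (Suc l)))" for l q
      using sq by measurable
    show "Measurable.pred N (\<lambda>w. ip d (X w i) (rational_point d j)
            \<le> ip d (rational_point d q) (rational_point d j) + (\<Sum>i<d. \<bar>rational_point d j i\<bar>) * inverse (real (Suc l)))"
      if "i < n" for l q j i
      using ipX[OF that] by measurable
  qed
  then show ?thesis by (subst measurable_cong[where g = R]) (rule eq)
qed

section \<open>Measurability of the sample median\<close>

lemma nbhd_level_set_sets: "nbhd d (level_set d n X m) r \<in> sets (Rd d)"
proof -
  have "Measurable.pred (Rd d) (\<lambda>w. w \<in> nbhd d (level_set d n X m) r)"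
    by (rule nbhd_level_set_measurable[where X = "\<lambda>_. X" and x = "\<lambda>w. w"]) auto
  then have "{w \<in> space (Rd d). w \<in> nbhd d (level_set d n X m) r} \<in> sets (Rd d)" by (rule predE)
  moreover have "{w \<in> space (Rd d). w \<in> nbhd d (level_set d n X m) r} = nbhd d (level_set d n X m) r"
    by (auto simp: nbhd_def)
  ultimately show ?thesis by simp
qed

lemma ip_restrict: "ip d (\<lambda>i\<in>{..<d}. f i) u = ip d f u"
  by (rule ip_cong) auto

text \<open>
  In each coordinate direction and its opposite there is a sample point beyond \<open>x\<close>.
\<close>

lemma level_set_bounded:
  assumes m: "1 \<le> m" and x: "x \<in> level_set d n X m" and e: "e < d"
  shows "\<bar>x e\<bar> \<le> (\<Sum>i<n. \<bar>X i e\<bar>)"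
proof -
  have ex: "\<exists>i<n. ip d (X i) u \<le> ip d x u" for u
  proof (rule ccontr)
    assume "\<not> ?thesis"
    then have "{i. i < n \<and> ip d (X i) u \<le> ip d x u} = {}" by auto
    moreover have "m \<le> card {i. i < n \<and> ip d (X i) u \<le> ip d x u}" using x by (simp add: level_set_def)
    ultimately have "m \<le> card ({} :: nat set)" by (simp only:)
    then show False using m by simp
  qed
  have le: "\<bar>X i e\<bar> \<le> (\<Sum>i<n. \<bar>X i e\<bar>)" if "i < n" for i using that by (intro member_le_sum) auto
  have ipu: "ip d y (unit_vec e) = y e" "ip d y (\<lambda>j. - unit_vec e j) = - y e" for y
  proof -
    show "ip d y (unit_vec e) = y e" using ip_unit_vec[OF e, of y] by (simp add: ip_commute)
    then show "ip d y (\<lambda>j. - unit_vec e j) = - y e" by (simp add: ip_def sum_negf)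
  qed
  obtain i where i: "i < n" "X i e \<le> x e" using ex[of "unit_vec e"] unfolding ipu by blast
  obtain j where j: "j < n" "- X j e \<le> - x e" using ex[of "\<lambda>j. - unit_vec e j"] unfolding ipu by blast
  show ?thesis using le[OF i(1)] le[OF j(1)] i(2) j(2) unfolding abs_le_iff by linarith
qed

text \<open>
  On a segment a linear functional is at least its smaller value at the two ends.
\<close>

lemma level_set_pconvex: "pconvex d (level_set d n X m)"
  unfolding pconvex_def
proof (intro ballI)
  fix x y and t :: real assume x: "x \<in> level_set d n X m" and y: "y \<in> level_set d n X m" and t: "t \<in> {0..1}"
  show "(\<lambda>i\<in>{..<d}. (1 - t) * x i + t * y i) \<in> level_set d n X m"
    unfolding level_set_def mem_Collect_eq ip_restrict
  proof (intro conjI allI restrict_in_Rd)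
    fix u
    have eq: "ip d (\<lambda>i. (1 - t) * x i + t * y i) u = (1 - t) * ip d x u + t * ip d y u"
      by (simp only: ip_add_left ip_scale_left)
    define c where "c = min (ip d x u) (ip d y u)"
    have "(1 - t) * c + t * c \<le> (1 - t) * ip d x u + t * ip d y u"
      using t by (intro add_mono mult_left_mono) (auto simp: c_def)
    moreover have "(1 - t) * c + t * c = c" by (simp add: algebra_simps)
    ultimately have cle: "c \<le> ip d (\<lambda>i. (1 - t) * x i + t * y i) u" unfolding eq by (simp only:)
    have "m \<le> card {i. i < n \<and> ip d (X i) u \<le> c}"
      using x y unfolding c_def min_def level_set_def by simp
    also have "\<dots> \<le> card {i. i < n \<and> ip d (X i) u \<le> ip d (\<lambda>i. (1 - t) * x i + t * y i) u}"
      using cle by (intro card_mono) auto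
    finally show "m \<le> card {i. i < n \<and> ip d (X i) u \<le> ip d (\<lambda>i. (1 - t) * x i + t * y i) u}" .
  qed
qed

lemma sqdist_coord: "i < d \<Longrightarrow> (x i - z i)\<^sup>2 \<le> sqdist d x z"
  unfolding sqdist_def by (rule member_le_sum) auto

lemma level_set_closed:
  assumes x: "x \<in> space (Rd d)" and e: "\<And>e. e > 0 \<Longrightarrow> \<exists>z\<in>level_set d n X m. sqdist d x z < e"
  shows "x \<in> level_set d n X m"
proof -
  have "\<exists>z. z \<in> level_set d n X m \<and> sqdist d x z < (inverse (real (Suc l)))\<^sup>2" for l
    using e[of "(inverse (real (Suc l)))\<^sup>2"] by auto
  then obtain z where z: "\<And>l. z l \<in> level_set d n X m" "\<And>l. sqdist d x (z l) < (inverse (real (Suc l)))\<^sup>2" by metis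
  have lim: "(\<lambda>l. z l i) \<longlonglongrightarrow> x i" if i: "i < d" for i
  proof (rule LIM_zero_cancel, rule Lim_null_comparison[OF _ LIMSEQ_inverse_real_of_nat])
    have "\<bar>z l i - x i\<bar> \<le> inverse (real (Suc l))" for l
    proof -
      have "(x i - z l i)\<^sup>2 \<le> (inverse (real (Suc l)))\<^sup>2" using sqdist_coord[OF i, of x "z l"] z(2)[of l] by linarith
      then have "\<bar>x i - z l i\<bar> \<le> \<bar>inverse (real (Suc l))\<bar>" by (simp only: abs_le_square_iff)
      then show ?thesis by (simp add: abs_minus_commute)
    qed
    then show "\<forall>\<^sub>F l in sequentially. norm (z l i - x i) \<le> inverse (real (Suc l))" by simp
  qed
  have "m \<le> card {i. i < n \<and> ip d (X i) u \<le> ip d x u}" for u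
  proof (rule card_count_limit)
    show "(\<lambda>l. ip d (X i) u) \<longlonglongrightarrow> ip d (X i) u" for i by (rule tendsto_const)
    show "(\<lambda>l. ip d (z l) u) \<longlonglongrightarrow> ip d x u" by (rule tendsto_ip_left) (rule lim)
    show "m \<le> card {i. i < n \<and> ip d (X i) u \<le> ip d (z l) u}" for l using z(1)[of l] by (simp add: level_set_def)
  qed
  then show ?thesis using x by (simp add: level_set_def)
qed

lemma level_set_convex_body:
  assumes "1 \<le> m" "level_set d n X m \<noteq> {}"
  shows "convex_body d (level_set d n X m)"
proof unfold_locales
  show "level_set d n X m \<subseteq> space (Rd d)" by (auto simp: level_set_def)
  show "\<exists>R. \<forall>x\<in>level_set d n X m. \<forall>i<d. \<bar>x i\<bar> \<le> R"
  proof (intro exI ballI allI impI)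
    fix x i assume x: "x \<in> level_set d n X m" and i: "i < d"
    have "\<bar>x i\<bar> \<le> (\<Sum>j<n. \<bar>X j i\<bar>)" by (rule level_set_bounded[OF assms(1) x i])
    also have "\<dots> \<le> (\<Sum>i<d. \<Sum>j<n. \<bar>X j i\<bar>)"
      using i by (intro member_le_sum) (auto intro: sum_nonneg)
    finally show "\<bar>x i\<bar> \<le> (\<Sum>i<d. \<Sum>j<n. \<bar>X j i\<bar>)" .
  qed
  show "x \<in> level_set d n X m"
    if "x \<in> space (Rd d)" "\<And>e. e > 0 \<Longrightarrow> \<exists>z\<in>level_set d n X m. sqdist d x z < e" for x
    by (rule level_set_closed) (use that in blast)+
qed (use assms level_set_pconvex nbhd_level_set_sets in auto)

lemma level_set_mono: "m \<le> m' \<Longrightarrow> level_set d n X m' \<subseteq> level_set d n X m"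
  by (auto simp: level_set_def intro: order_trans)

lemma level_set_one: "1 \<le> n \<Longrightarrow> X 0 \<in> space (Rd d) \<Longrightarrow> X 0 \<in> level_set d n X 1"
proof -
  assume n: "1 \<le> n" and X: "X 0 \<in> space (Rd d)"
  have "1 \<le> card {i. i < n \<and> ip d (X i) u \<le> ip d (X 0) u}" for u
    using n card_mono[of "{i. i < n \<and> ip d (X i) u \<le> ip d (X 0) u}" "{0}"] by auto
  then show ?thesis using X by (simp add: level_set_def)
qed

lemma level_set_empty: "level_set d n X (Suc n) = {}"
proof -
  have "card {i. i < n \<and> P i} \<le> n" for P using card_mono[of "{..<n}" "{i. i < n \<and> P i}"] by auto
  then show ?thesis by (force simp: level_set_def not_less_eq_eq[symmetric])
qed

text \<open>
  The largest count attained as depth; its level set consists of the deepest points.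
\<close>

definition top_level :: "nat \<Rightarrow> nat \<Rightarrow> (nat \<Rightarrow> point) \<Rightarrow> nat \<Rightarrow> bool" where
  "top_level d n X m \<longleftrightarrow> level_set d n X m \<noteq> {} \<and> level_set d n X (Suc m) = {}"

lemma top_level_exists:
  assumes "1 \<le> n" "X 0 \<in> space (Rd d)"
  shows "\<exists>m\<in>{1..n}. top_level d n X m"
proof -
  define P where "P m \<longleftrightarrow> level_set d n X m \<noteq> {}" for m
  have P1: "P 1" using level_set_one[of n X d] assms by (auto simp: P_def)
  have "\<forall>m. P m \<longrightarrow> m < Suc n"
  proof (intro allI impI)
    fix m assume "P m"
    then show "m < Suc n" using level_set_mono[of "Suc n" m d n X] level_set_empty[of d n X]
      by (cases "Suc n \<le> m") (auto simp: P_def)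
  qed
  then obtain m where m: "P m" "\<And>m'. P m' \<Longrightarrow> m' \<le> m" "m < Suc n"
    using ex_has_greatest_nat[of P 1 "\<lambda>m. m" "Suc n"] P1 by blast
  have "\<not> P (Suc m)" using m(2)[of "Suc m"] by auto
  then show ?thesis using m P1 by (intro bexI[of _ m]) (auto simp: top_level_def P_def)
qed

lemma empirical_measure:
  assumes n: "1 \<le> n" and X: "\<And>i. i < n \<Longrightarrow> X i \<in> space (Rd d)"
  shows "measure (empirical d n X) {y \<in> space (empirical d n X). ip d y u \<le> t} = emp_frac d n X u t"
proof -
  have sp: "space (empirical d n X) = space (Rd d)" by (simp add: empirical_def)
  have m: "X \<in> measurable (uniform_count_measure {..<n}) (Rd d)"
    using X by (auto simp: measurable_def space_uniform_count_measure sets_uniform_count_measure)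
  have "measure (empirical d n X) {y \<in> space (Rd d). ip d y u \<le> t}
      = measure (uniform_count_measure {..<n}) (X -` {y \<in> space (Rd d). ip d y u \<le> t} \<inter> {..<n})"
    unfolding empirical_def using measure_distr[OF m halfspace_in_sets[OF refl, of d u t]]
    by (simp add: space_uniform_count_measure)
  also have "X -` {y \<in> space (Rd d). ip d y u \<le> t} \<inter> {..<n} = {i. i < n \<and> ip d (X i) u \<le> t}" using X by auto
  also have "measure (uniform_count_measure {..<n}) {i. i < n \<and> ip d (X i) u \<le> t} = emp_frac d n X u t"
    by (subst measure_uniform_count_measure) (auto simp: emp_frac_def)
  finally show ?thesis by (simp add: sp)
qed

lemma L2_set_ip: "L2_set u {..<d} = sqrt (ip d u u)"
  by (simp add: L2_set_def ip_def power2_eq_square)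

lemma unit_sphere_normalize:
  assumes "ip d u u > 0"
  shows "(\<lambda>i\<in>{..<d}. u i / sqrt (ip d u u)) \<in> unit_sphere d"
proof -
  let ?v = "\<lambda>i. inverse (sqrt (ip d u u)) * u i"
  have "ip d (\<lambda>i\<in>{..<d}. ?v i) (\<lambda>i\<in>{..<d}. ?v i) = ip d ?v ?v" by (rule ip_cong) auto
  also have "\<dots> = inverse (sqrt (ip d u u)) * (inverse (sqrt (ip d u u)) * ip d u u)"
    by (simp only: ip_scale_left ip_scale_right)
  also have "\<dots> = 1" using assms by (simp add: field_simps)
  finally have "(\<lambda>i\<in>{..<d}. ?v i) \<in> unit_sphere d"
    by (simp only: unit_sphere_def mem_Collect_eq L2_set_ip restrict_in_Rd real_sqrt_one simp_thms)
  then show ?thesis by (simp only: divide_inverse mult.commute)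
qed

lemma unit_sphere_nonempty: "1 \<le> d \<Longrightarrow> unit_sphere d \<noteq> {}"
  using unit_sphere_normalize[of d "unit_vec 0"] ip_unit_vec[of 0 d "unit_vec 0"] by (auto simp: unit_vec_def)

lemma unit_sphere_ip_scale:
  "ip d y (\<lambda>i\<in>{..<d}. u i / s) = ip d y u / s"
  unfolding ip_def sum_divide_distrib by (intro sum.cong) auto

lemma hdepth_le:
  assumes "u \<in> unit_sphere d"
  shows "hdepth d P x \<le> measure P {y \<in> space P. ip d y u \<le> ip d x u}"
  unfolding hdepth_def using assms by (intro cINF_lower bdd_belowI[of _ 0]) auto

lemma hdepth_ge:
  assumes "1 \<le> d" "\<And>u. u \<in> unit_sphere d \<Longrightarrow> c \<le> measure P {y \<in> space P. ip d y u \<le> ip d x u}"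
  shows "c \<le> hdepth d P x"
  unfolding hdepth_def using assms unit_sphere_nonempty by (intro cINF_greatest) auto

lemma hdepth_le_direction:
  assumes u: "ip d u u > 0"
  shows "hdepth d P x \<le> measure P {y \<in> space P. ip d y u \<le> ip d x u}"
proof -
  let ?u = "\<lambda>i\<in>{..<d}. u i / sqrt (ip d u u)"
  have "hdepth d P x \<le> measure P {y \<in> space P. ip d y ?u \<le> ip d x ?u}"
    by (rule hdepth_le[OF unit_sphere_normalize[OF u]])
  also have "{y \<in> space P. ip d y ?u \<le> ip d x ?u} = {y \<in> space P. ip d y u \<le> ip d x u}"
    using u by (simp add: unit_sphere_ip_scale divide_le_cancel)
  finally show ?thesis .
qed

lemma ip_zero_direction: "\<not> ip d u u > 0 \<Longrightarrow> ip d y u = 0"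
proof -
  assume "\<not> ip d u u > 0"
  then have "ip d u u = 0" using ip_self_nonneg[of d u] by simp
  then have "u i = 0" if "i < d" for i using ip_self_zero that by blast
  then show "ip d y u = 0" by (simp add: ip_def)
qed

context
  fixes d n :: nat and X :: "nat \<Rightarrow> point"
  assumes d: "1 \<le> d" and n: "1 \<le> n" and X: "\<And>i. i < n \<Longrightarrow> X i \<in> space (Rd d)"
begin

lemma hdepth_empirical_ge:
  assumes x: "x \<in> level_set d n X m"
  shows "real m / n \<le> hdepth d (empirical d n X) x"
proof (rule hdepth_ge[OF d])
  fix u
  have "m \<le> card {i. i < n \<and> ip d (X i) u \<le> ip d x u}" using x by (simp add: level_set_def)
  then show "real m / n \<le> measure (empirical d n X) {y \<in> space (empirical d n X). ip d y u \<le> ip d x u}"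
    using n by (simp add: empirical_measure[OF n X] emp_frac_def divide_right_mono)
qed

lemma hdepth_empirical_le:
  assumes x: "x \<in> space (Rd d)" "x \<notin> level_set d n X (Suc m)" and m: "m \<le> n"
  shows "hdepth d (empirical d n X) x \<le> real m / n"
proof -
  obtain u where u: "card {i. i < n \<and> ip d (X i) u \<le> ip d x u} \<le> m" using x by (auto simp: level_set_def not_less_eq_eq)
  show ?thesis
  proof (cases "ip d u u > 0")
    case True
    have "hdepth d (empirical d n X) x \<le> emp_frac d n X u (ip d x u)"
      using hdepth_le_direction[OF True, of "empirical d n X" x] by (simp add: empirical_measure[OF n X])
    also have "\<dots> \<le> real m / n" unfolding emp_frac_def using u by (intro divide_right_mono) auto
    finally show ?thesis .
  next
    case False
    then have "{i. i < n \<and> ip d (X i) u \<le> ip d x u} = {..<n}" by (auto simp: ip_zero_direction)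
    then have "m = n" using u m by simp
    obtain v where v: "v \<in> unit_sphere d" using unit_sphere_nonempty[OF d] by blast
    have "hdepth d (empirical d n X) x \<le> emp_frac d n X v (ip d x v)"
      using hdepth_le[OF v, of "empirical d n X" x] by (simp add: empirical_measure[OF n X])
    also have "\<dots> \<le> real n / n" unfolding emp_frac_def
      using card_mono[of "{..<n}" "{i. i < n \<and> ip d (X i) v \<le> ip d x v}"] by (intro divide_right_mono) auto
    finally show ?thesis using \<open>m = n\<close> by simp
  qed
qed

lemma level_set_if_hdepth_ge:
  assumes x: "x \<in> space (Rd d)" and m: "1 \<le> m" "m \<le> n" and ge: "real m / n \<le> hdepth d (empirical d n X) x"
  shows "x \<in> level_set d n X m"
proof (rule ccontr)
  assume "x \<notin> level_set d n X m"
  then have "x \<notin> level_set d n X (Suc (m - 1))" using m by simp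
  then have "hdepth d (empirical d n X) x \<le> real (m - 1) / n" using x m by (intro hdepth_empirical_le) auto
  then have "real m / n \<le> real (m - 1) / n" using ge by linarith
  then show False using m n by (simp add: divide_le_cancel)
qed

text \<open>
  Empirical depths are multiples of \<open>1/n\<close>, so the maximal depth is \<open>m/n\<close> for the top level \<open>m\<close>.
\<close>

lemma median_set_empirical:
  assumes m: "m \<in> {1..n}" "top_level d n X m"
  shows "median_set d (empirical d n X) = level_set d n X m"
proof
  have up: "hdepth d (empirical d n X) y \<le> real m / n" if "y \<in> space (Rd d)" for y
    using m that by (intro hdepth_empirical_le) (auto simp: top_level_def)
  show "level_set d n X m \<subseteq> median_set d (empirical d n X)"
  proof
    fix x assume x: "x \<in> level_set d n X m"
    then have "hdepth d (empirical d n X) y \<le> hdepth d (empirical d n X) x" if "y \<in> space (Rd d)" for y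
      using up[OF that] hdepth_empirical_ge[OF x] by linarith
    then show "x \<in> median_set d (empirical d n X)" using x by (simp add: median_set_def level_set_def)
  qed
  show "median_set d (empirical d n X) \<subseteq> level_set d n X m"
  proof
    fix x assume x: "x \<in> median_set d (empirical d n X)"
    obtain y where y: "y \<in> level_set d n X m" using m by (auto simp: top_level_def)
    then have "y \<in> space (Rd d)" by (simp add: level_set_def)
    then have "hdepth d (empirical d n X) y \<le> hdepth d (empirical d n X) x" using x by (simp add: median_set_def)
    then show "x \<in> level_set d n X m"
      using x m hdepth_empirical_ge[OF y] by (intro level_set_if_hdepth_ge) (auto simp: median_set_def)
  qed
qed

end

text \<open>
  The limit of the centroids of the parallel bodies of a level set. It is defined for every sample
  and level, also when it does not represent a barycenter, so that it is a measurable function of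
  the sample.
\<close>

definition level_centroid :: "nat \<Rightarrow> nat \<Rightarrow> nat \<Rightarrow> (nat \<Rightarrow> point) \<Rightarrow> nat \<Rightarrow> real" where
  "level_centroid d n m X i = lim (\<lambda>l.
     (\<integral>x. x i * indicator (nbhd d (level_set d n X m) (inverse (real (Suc l)))) x \<partial>leb {..<d})
      / (\<integral>x. indicator (nbhd d (level_set d n X m) (inverse (real (Suc l)))) x \<partial>leb {..<d}))"

lemma halfspace_median_empirical:
  assumes "1 \<le> d" "1 \<le> n" "\<And>i. i < n \<Longrightarrow> X i \<in> space (Rd d)" and m: "m \<in> {1..n}" "top_level d n X m" and i: "i < d"
  shows "halfspace_median d (empirical d n X) i = level_centroid d n m X i"
proof -
  interpret convex_body d "level_set d n X m"
    using m by (intro level_set_convex_body) (auto simp: top_level_def)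
  have "median_set d (empirical d n X) = level_set d n X m" by (rule median_set_empirical) (use assms in auto)
  then have "halfspace_median d (empirical d n X) i = barycenter d (level_set d n X m) i"
    by (simp add: halfspace_median_def)
  also have "\<dots> = level_centroid d n m X i"
    unfolding level_centroid_def by (rule limI[symmetric]) (rule barycenter_parallel_limit[OF i])
  finally show ?thesis .
qed

context
  fixes N :: "(nat \<Rightarrow> point) measure" and d n :: nat
  assumes comp: "\<And>i e. i < n \<Longrightarrow> e < d \<Longrightarrow> (\<lambda>X. X i e) \<in> borel_measurable N"
begin

text \<open>
  The set is nonempty iff the origin is at some integer distance from it.
\<close>

lemma level_set_nonempty_measurable: "Measurable.pred N (\<lambda>X. level_set d n X m \<noteq> {})"
proof -
  let ?o = "\<lambda>i\<in>{..<d}. 0 :: real"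
  have eq: "level_set d n X m \<noteq> {} \<longleftrightarrow> (\<exists>k::nat. ?o \<in> nbhd d (level_set d n X m) (real k))" for X
  proof
    assume "level_set d n X m \<noteq> {}"
    then obtain z where z: "z \<in> level_set d n X m" by blast
    obtain k :: nat where k: "sqdist d ?o z \<le> real k" using real_arch_simple by blast
    have kk: "real k \<le> (real k)\<^sup>2" by (cases "k = 0") (auto simp: power2_eq_square)
    have "?o \<in> nbhd d (level_set d n X m) (real k)" unfolding nbhd_def
      by (intro CollectI conjI restrict_in_Rd bexI[where x = z] order_trans[OF k kk] z)
    then show "\<exists>k::nat. ?o \<in> nbhd d (level_set d n X m) (real k)" by blast
  qed (auto simp: nbhd_def)
  have "Measurable.pred N (\<lambda>X. ?o \<in> nbhd d (level_set d n X m) (real k))" for k :: nat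
    by (rule nbhd_level_set_measurable[where x = "\<lambda>_. ?o"]) (use comp in auto)
  then show ?thesis unfolding eq by measurable
qed

lemma level_centroid_measurable:
  assumes i: "i < d"
  shows "(\<lambda>X. level_centroid d n m X i) \<in> borel_measurable N"
proof -
  interpret L: finite_product_sigma_finite "\<lambda>_. lborel" "{..<d}" by standard simp
  let ?NL = "N \<Otimes>\<^sub>M leb {..<d}"
  have x: "(\<lambda>p. snd p e) \<in> borel_measurable ?NL" if "e < d" for e
    using measurable_compose[OF measurable_snd measurable_component_singleton[of e]] that by simp
  have p: "Measurable.pred ?NL (\<lambda>p. snd p \<in> nbhd d (level_set d n (fst p) m) r)" for r
  proof (rule nbhd_level_set_measurable[where X = "\<lambda>p. fst p" and x = "\<lambda>p. snd p"])
    show "(\<lambda>p. fst p j e) \<in> borel_measurable ?NL" if "j < n" "e < d" for j e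
      by (rule measurable_compose[OF measurable_fst comp[OF that]])
    show "snd w \<in> space (Rd d)" if "w \<in> space ?NL" for w
      using that by (auto simp: space_pair_measure space_leb_Rd[symmetric])
  qed (rule x)
  have ind: "(\<lambda>p. indicator (nbhd d (level_set d n (fst p) m) r) (snd p) :: real) \<in> borel_measurable ?NL" for r
    using p[of r] unfolding indicator_def by measurable
  have "(\<lambda>X. \<integral>x. x i * indicator (nbhd d (level_set d n X m) r) x \<partial>leb {..<d}) \<in> borel_measurable N" for r
  proof (rule L.borel_measurable_lebesgue_integral)
    show "(\<lambda>(X, x). x i * indicator (nbhd d (level_set d n X m) r) x) \<in> borel_measurable ?NL"
      using borel_measurable_times[OF x[OF i] ind[of r]] by (simp add: case_prod_beta)
  qed
  moreover have "(\<lambda>X. \<integral>x. indicator (nbhd d (level_set d n X m) r) x \<partial>leb {..<d} :: real) \<in> borel_measurable N" for r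
  proof (rule L.borel_measurable_lebesgue_integral)
    show "(\<lambda>(X, x). indicator (nbhd d (level_set d n X m) r) x :: real) \<in> borel_measurable ?NL"
      using ind[of r] by (simp add: case_prod_beta)
  qed
  ultimately show ?thesis
    unfolding level_centroid_def by (intro borel_measurable_lim_metric borel_measurable_divide)
qed

end

lemma lp_norm_cong:
  assumes "\<And>i. i < d \<Longrightarrow> x i = y i"
  shows "lp_norm d p x = lp_norm d p y"
proof -
  have "(\<lambda>i. \<bar>x i\<bar>) ` {..<d} = (\<lambda>i. \<bar>y i\<bar>) ` {..<d}" using assms by (intro image_cong) auto
  moreover have "(\<Sum>i<d. \<bar>x i\<bar> powr real_of_ereal p) = (\<Sum>i<d. \<bar>y i\<bar> powr real_of_ereal p)"
    using assms by (intro sum.cong) auto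
  ultimately show ?thesis by (simp add: lp_norm_def)
qed

lemma lp_norm_measurable:
  assumes "\<And>i. i < d \<Longrightarrow> (\<lambda>w. f w i) \<in> borel_measurable N"
  shows "(\<lambda>w. lp_norm d p (f w)) \<in> borel_measurable N"
proof (cases "p = \<infinity>")
  case True
  have "(\<lambda>w. Max ((\<lambda>i. \<bar>f w i\<bar>) ` {..<d})) \<in> borel_measurable N"
    by (rule borel_measurable_Max) (use assms in auto)
  then show ?thesis using True by (simp add: lp_norm_def)
next
  case False
  have "(\<lambda>w. (\<Sum>i<d. \<bar>f w i\<bar> powr real_of_ereal p) powr (1 / real_of_ereal p)) \<in> borel_measurable N"
  proof -
    have "(\<lambda>w. \<bar>f w i\<bar> powr real_of_ereal p) \<in> borel_measurable N" if "i < d" for i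
      using assms[OF that] by measurable
    then have "(\<lambda>w. \<Sum>i<d. \<bar>f w i\<bar> powr real_of_ereal p) \<in> borel_measurable N"
      by (intro borel_measurable_sum) auto
    then show ?thesis by measurable
  qed
  then show ?thesis using False by (simp add: lp_norm_def)
qed

text \<open>
  The event is a finite union over the top level \<open>m\<close>; on each part the sample median is the level
  centroid.
\<close>

theorem median_error_event_measurable:
  assumes M: "M \<in> distributions d" and d: "1 \<le> d" and n: "1 \<le> n"
  shows "{X \<in> space (sample_law n M). lp_norm d p (\<lambda>i. halfspace_median d (empirical d n X) i - v i) \<le> c} \<in> sets (sample_law n M)"
proof -
  let ?N = "sample_law n M"
  have Xs: "X i \<in> space (Rd d)" if "X \<in> space ?N" "i < n" for X i
    using that distributionsD(3)[OF M] by (auto simp: sample_law_def space_PiM)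
  have comp: "(\<lambda>X. X i e) \<in> borel_measurable ?N" if "i < n" "e < d" for i e
  proof -
    have "(\<lambda>x. x e) \<in> borel_measurable M"
      using component_measurable_Rd[OF that(2)] by (simp add: measurable_cong_sets[OF distributionsD(2)[OF M] refl])
    then show ?thesis unfolding sample_law_def using that(1)
      by (intro measurable_compose[OF measurable_component_singleton]) auto
  qed
  have "lp_norm d p (\<lambda>i. halfspace_median d (empirical d n X) i - v i) \<le> c \<longleftrightarrow>
     (\<exists>m\<in>{1..n}. (level_set d n X m \<noteq> {} \<and> \<not> level_set d n X (Suc m) \<noteq> {}) \<and> lp_norm d p (\<lambda>i. level_centroid d n m X i - v i) \<le> c)"
    (is "_ \<longleftrightarrow> ?R X") if X: "X \<in> space ?N" for X
  proof -
    have eq: "lp_norm d p (\<lambda>i. halfspace_median d (empirical d n X) i - v i) = lp_norm d p (\<lambda>i. level_centroid d n m X i - v i)"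
      if "m \<in> {1..n}" "top_level d n X m" for m
      by (rule lp_norm_cong) (use halfspace_median_empirical[OF d n Xs[OF X] that] in auto)
    obtain m where m: "m \<in> {1..n}" "top_level d n X m"
      using top_level_exists[OF n, of X d] Xs[OF X, of 0] n by auto
    show ?thesis
    proof
      assume "lp_norm d p (\<lambda>i. halfspace_median d (empirical d n X) i - v i) \<le> c"
      then have "lp_norm d p (\<lambda>i. level_centroid d n m X i - v i) \<le> c" using eq[OF m] by simp
      then show "?R X" using m by (intro bexI[of _ m]) (simp_all add: top_level_def)
    next
      assume "?R X"
      then obtain m' where m'n: "m' \<in> {1..n}" and t: "level_set d n X m' \<noteq> {} \<and> \<not> level_set d n X (Suc m') \<noteq> {}"
        and le: "lp_norm d p (\<lambda>i. level_centroid d n m' X i - v i) \<le> c" by (elim bexE conjE) (rule that, auto)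
      have m': "m' \<in> {1..n}" "top_level d n X m'" using m'n t by (simp_all add: top_level_def)
      show "lp_norm d p (\<lambda>i. halfspace_median d (empirical d n X) i - v i) \<le> c" using eq[OF m'] le by simp
    qed
  qed
  then have "{X \<in> space ?N. lp_norm d p (\<lambda>i. halfspace_median d (empirical d n X) i - v i) \<le> c} = {X \<in> space ?N. ?R X}"
    by blast
  also have "\<dots> \<in> sets ?N"
  proof -
    have ne: "Measurable.pred ?N (\<lambda>X. level_set d n X m \<noteq> {})" for m
      by (rule level_set_nonempty_measurable) (rule comp)
    have "(\<lambda>X. lp_norm d p (\<lambda>i. level_centroid d n m X i - v i)) \<in> borel_measurable ?N" for m
      by (intro lp_norm_measurable borel_measurable_diff borel_measurable_const level_centroid_measurable comp)
    then have le: "Measurable.pred ?N (\<lambda>X. lp_norm d p (\<lambda>i. level_centroid d n m X i - v i) \<le> c)" for m by measurable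
    have "Measurable.pred ?N (\<lambda>X. (level_set d n X m \<noteq> {} \<and> \<not> level_set d n X (Suc m) \<noteq> {})
        \<and> lp_norm d p (\<lambda>i. level_centroid d n m X i - v i) \<le> c)" for m
      using ne[of m] ne[of "Suc m"] le[of m] by measurable
    then have "Measurable.pred ?N ?R" by (intro pred_intros_finite) auto
    then show ?thesis by (rule predE)
  qed
  finally show ?thesis .
qed

section \<open>Projections of alpha-symmetric distributions\<close>

text \<open>
  The case of equality in Hoelder's inequality, with the sign reversed. For \<open>\<alpha> > 1\<close> it is
  \<open>u i = - sgn (x i) \<bar>x i\<bar> powr (\<beta> - 1)\<close>; for \<open>\<alpha> \<le> 1\<close> a signed unit vector at the largest
  coordinate of \<open>x\<close>.
\<close>

lemma dual_direction:
  assumes \<alpha>: "\<alpha> > 0" and d: "1 \<le> d"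
  obtains u where "u \<in> space (Rd d)" "lp_norm d (ereal \<alpha>) u > 0 \<or> lp_norm d (conj_exponent \<alpha>) x = 0"
    "ip d x u = - (lp_norm d (conj_exponent \<alpha>) x * lp_norm d (ereal \<alpha>) u)"
proof (cases "\<alpha> > 1")
  case True
  define \<beta> where "\<beta> = \<alpha> / (\<alpha> - 1)"
  have \<beta>: "\<beta> > 1" "(\<beta> - 1) * \<alpha> = \<beta>" "1 / \<beta> + 1 / \<alpha> = 1" using True by (auto simp: \<beta>_def field_simps)
  define S where "S = (\<Sum>i<d. \<bar>x i\<bar> powr \<beta>)"
  have S0: "S \<ge> 0" unfolding S_def by (intro sum_nonneg) auto
  have nx: "lp_norm d (conj_exponent \<alpha>) x = S powr (1 / \<beta>)"
    using True by (simp add: lp_norm_def conj_exponent_def S_def \<beta>_def)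
  let ?u = "\<lambda>i\<in>{..<d}. - sgn (x i) * \<bar>x i\<bar> powr (\<beta> - 1)"
  have "(\<Sum>i<d. \<bar>?u i\<bar> powr \<alpha>) = S"
    unfolding S_def
  proof (intro sum.cong refl)
    fix i assume "i \<in> {..<d}"
    then show "\<bar>?u i\<bar> powr \<alpha> = \<bar>x i\<bar> powr \<beta>"
      by (cases "x i = 0") (simp_all add: abs_mult abs_sgn_eq powr_powr \<beta>(2))
  qed
  then have nu: "lp_norm d (ereal \<alpha>) ?u = S powr (1 / \<alpha>)" by (simp add: lp_norm_def)
  have "ip d x ?u = - S"
    unfolding ip_def S_def sum_negf[symmetric]
  proof (intro sum.cong refl)
    fix i assume i: "i \<in> {..<d}"
    have "\<bar>x i\<bar> * \<bar>x i\<bar> powr (\<beta> - 1) = \<bar>x i\<bar> powr \<beta>"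
      by (cases "x i = 0") (simp_all add: powr_mult_base)
    moreover have "x i * sgn (x i) = \<bar>x i\<bar>" by (simp add: abs_sgn)
    ultimately show "x i * ?u i = - (\<bar>x i\<bar> powr \<beta>)"
      using i by (simp add: mult.assoc[symmetric])
  qed
  moreover have "S powr (1 / \<beta>) * S powr (1 / \<alpha>) = S" using S0 \<beta>(3) by (cases "S = 0") (auto simp flip: powr_add)
  moreover have "S powr (1 / \<alpha>) > 0 \<or> S powr (1 / \<beta>) = 0" using S0 by (cases "S = 0") auto
  ultimately show ?thesis by (intro that[of ?u]) (simp_all only: nx nu restrict_in_Rd)
next
  case False
  then have ce: "conj_exponent \<alpha> = \<infinity>" by (simp add: conj_exponent_def)
  have "Max ((\<lambda>i. \<bar>x i\<bar>) ` {..<d}) \<in> (\<lambda>i. \<bar>x i\<bar>) ` {..<d}" using d by (intro Max_in) (auto simp: lessThan_empty_iff)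
  then obtain i where i: "i < d" "Max ((\<lambda>i. \<bar>x i\<bar>) ` {..<d}) = \<bar>x i\<bar>" by auto
  have nx: "lp_norm d (conj_exponent \<alpha>) x = \<bar>x i\<bar>" by (simp add: ce lp_norm_def i)
  define s :: real where "s = (if x i \<ge> 0 then -1 else 1)"
  let ?u = "\<lambda>j\<in>{..<d}. if j = i then s else 0"
  have "(\<Sum>j<d. \<bar>?u j\<bar> powr \<alpha>) = (\<Sum>j<d. if j = i then 1 else 0)"
    using \<alpha> by (intro sum.cong) (auto simp: s_def)
  then have nu: "lp_norm d (ereal \<alpha>) ?u = 1" using i by (simp add: lp_norm_def)
  have "ip d x ?u = (\<Sum>j<d. if j = i then x i * s else 0)" unfolding ip_def by (intro sum.cong) auto
  then have "ip d x ?u = - \<bar>x i\<bar>" using i by (simp add: s_def)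
  then show ?thesis by (intro that[of ?u]) (simp_all only: nx nu restrict_in_Rd mult_1_right zero_less_one simp_thms)
qed

lemma lp_norm_scale:
  assumes \<alpha>: "\<alpha> > 0"
  shows "lp_norm d (ereal \<alpha>) (\<lambda>i\<in>{..<d}. s * u i) = \<bar>s\<bar> * lp_norm d (ereal \<alpha>) u"
proof -
  have "(\<Sum>i<d. \<bar>(\<lambda>i\<in>{..<d}. s * u i) i\<bar> powr \<alpha>) = \<bar>s\<bar> powr \<alpha> * (\<Sum>i<d. \<bar>u i\<bar> powr \<alpha>)"
    unfolding sum_distrib_left by (intro sum.cong) (auto simp: abs_mult powr_mult)
  then show ?thesis using \<alpha> by (simp add: lp_norm_def powr_mult sum_nonneg powr_powr)
qed

lemma lp_norm_unit_vec:
  assumes "\<alpha> > 0" "0 < d"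
  shows "lp_norm d (ereal \<alpha>) (\<lambda>i\<in>{..<d}. s * unit_vec 0 i) = \<bar>s\<bar>"
proof -
  have "(\<Sum>i<d. \<bar>unit_vec 0 i\<bar> powr \<alpha>) = (\<Sum>i<d. if i = 0 then 1 else 0)"
    using assms by (intro sum.cong) (auto simp: unit_vec_def)
  then have "lp_norm d (ereal \<alpha>) (unit_vec 0) = 1" using assms by (simp add: lp_norm_def)
  then show ?thesis by (simp add: lp_norm_scale[OF assms(1)])
qed

lemma lp_norm_pos:
  assumes "\<alpha> > 0" "i < d" "u i \<noteq> 0"
  shows "lp_norm d (ereal \<alpha>) u > 0"
proof -
  have "0 < \<bar>u i\<bar> powr \<alpha>" using assms by simp
  also have "\<dots> \<le> (\<Sum>i<d. \<bar>u i\<bar> powr \<alpha>)" using assms by (intro member_le_sum) auto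
  finally show ?thesis using assms by (simp add: lp_norm_def)
qed

locale alpha_sym =
  fixes d :: nat and \<alpha> :: real and P :: "point measure"
  assumes d: "2 \<le> d" and \<alpha>: "\<alpha> > 0" and P: "P \<in> distributions d" and sym: "alpha_symmetric d \<alpha> P"
begin

sublocale prob_space P using distributionsD[OF P] by simp

lemma borel_P: "f \<in> borel_measurable P \<longleftrightarrow> f \<in> borel_measurable (Rd d)"
  by (simp add: measurable_cong_sets[OF distributionsD(2)[OF P] refl])

definition proj where "proj u = distr P borel (\<lambda>x. ip d x u)"

lemma ip_borel: "(\<lambda>x. ip d x u) \<in> borel_measurable P"
  unfolding borel_P by (rule ip_measurable_Rd)

lemma real_distribution_proj: "real_distribution (proj u)"
  unfolding proj_def by (intro real_distribution_distr ip_borel)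

lemma first_coord_borel: "(\<lambda>x. x 0) \<in> borel_measurable P"
  unfolding borel_P by (rule component_measurable_Rd) (use d in simp)

lemma char_proj:
  assumes \<phi>: "\<forall>t\<in>space (Rd d). (CLINT x|P. iexp (ip d t x)) = \<phi> (lp_norm d (ereal \<alpha>) t)"
  shows "char (proj u) s = \<phi> (\<bar>s\<bar> * lp_norm d (ereal \<alpha>) u)"
proof -
  have "char (proj u) s = (CLINT x|P. iexp (s * ip d x u))"
    unfolding char_def proj_def by (rule integral_distr[OF ip_borel]) measurable
  also have "\<dots> = (CLINT x|P. iexp (ip d (\<lambda>i\<in>{..<d}. s * u i) x))"
    by (simp only: ip_restrict ip_scale_left ip_commute[of d _ u])
  also have "\<dots> = \<phi> (\<bar>s\<bar> * lp_norm d (ereal \<alpha>) u)"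
    using \<phi>[rule_format, OF restrict_in_Rd, of "\<lambda>i. s * u i"] by (simp only: lp_norm_scale[OF \<alpha>])
  finally show ?thesis .
qed

text \<open>
  The characteristic function of the projection on \<open>u\<close> depends on \<open>u\<close> only through its \<open>\<alpha>\<close>-norm,
  and \<open>c\<close> times the first unit vector has the same \<open>\<alpha>\<close>-norm. The sign of \<open>c\<close> is free, which
  contains the symmetry of the first marginal.
\<close>

lemma proj_eq_scaled: "proj u = distr P borel (\<lambda>x. c * x 0)" if c: "\<bar>c\<bar> = lp_norm d (ereal \<alpha>) u"
proof -
  obtain \<phi> where \<phi>: "\<forall>t\<in>space (Rd d). (CLINT x|P. iexp (ip d t x)) = \<phi> (lp_norm d (ereal \<alpha>) t)"
    using sym by (auto simp: alpha_symmetric_def)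
  let ?v = "\<lambda>i\<in>{..<d}. c * unit_vec 0 i"
  have "proj u = proj ?v"
  proof (rule Levy_uniqueness[OF real_distribution_proj real_distribution_proj], rule ext)
    show "char (proj u) s = char (proj ?v) s" for s
      unfolding char_proj[OF \<phi>] using d lp_norm_unit_vec[OF \<alpha>, of d c] by (simp add: c)
  qed
  also have "proj ?v = distr P borel (\<lambda>x. c * x 0)"
  proof -
    have "ip d x ?v = c * x 0" for x
      unfolding ip_commute[of d x] ip_restrict ip_scale_left using d by (simp add: ip_unit_vec)
    then show ?thesis unfolding proj_def by simp
  qed
  finally show ?thesis .
qed

lemma prob_proj:
  assumes c: "\<bar>c\<bar> = lp_norm d (ereal \<alpha>) u" and A: "A \<in> sets borel"
  shows "prob {x\<in>space P. ip d x u \<in> A} = prob {x\<in>space P. c * x 0 \<in> A}"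
proof -
  have "measure (proj u) A = prob {x\<in>space P. ip d x u \<in> A}"
    unfolding proj_def using measure_distr[OF ip_borel A] by (simp add: vimage_def Int_def conj_commute)
  moreover have "measure (distr P borel (\<lambda>x. c * x 0)) A = prob {x\<in>space P. c * x 0 \<in> A}"
    using first_coord_borel by (subst measure_distr[OF _ A]) (auto simp: vimage_def Int_def conj_commute)
  ultimately show ?thesis by (simp add: proj_eq_scaled[OF c])
qed

definition F where "F = first_marginal_cdf P"

lemma F_eq: "F t = prob {x\<in>space P. x 0 \<le> t}"
  unfolding F_def first_marginal_cdf_def cdf_def
  using measure_distr[OF first_coord_borel, of "{..t}"] by (simp add: vimage_def Int_def conj_commute)

lemma F_mono: "s \<le> t \<Longrightarrow> F s \<le> F t"
  unfolding F_eq using first_coord_borel by (intro finite_measure_mono) auto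

lemma halfspace_prob:
  assumes u: "lp_norm d (ereal \<alpha>) u > 0"
  shows "prob {x\<in>space P. ip d x u \<le> t} = F (t / lp_norm d (ereal \<alpha>) u)"
  using prob_proj[of "lp_norm d (ereal \<alpha>) u" u "{..t}"] u
  by (simp add: F_eq pos_le_divide_eq mult.commute)

text \<open>
  The hyperplanes orthogonal to \<open>(1, r, r\<^sup>2, \<dots>)\<close> for \<open>r = 0, 1, 2, \<dots>\<close> all have the same
  probability \<open>p\<close>. A nonzero point lies on at most \<open>d\<close> of them, because they correspond to roots
  of the polynomial with its coordinates as coefficients. So \<open>m p \<le> d\<close> for all \<open>m\<close>.
\<close>

lemma no_atom:
  assumes 0: "prob {\<lambda>i\<in>{..<d}. 0} = 0"
  shows "prob {x\<in>space P. x 0 = 0} = 0"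
proof -
  let ?z = "\<lambda>i\<in>{..<d}. 0 :: real"
  define p where "p = prob {x\<in>space P. x 0 = 0}"
  define u where "u k i = real k ^ i" for k i :: nat
  define E where "E k = {x\<in>space P. ip d x (u k) = 0}" for k
  have z_sets: "{?z} \<in> sets P"
  proof -
    have "{?z} = {..<d} \<rightarrow>\<^sub>E {0}" by (auto simp: PiE_iff extensional_def fun_eq_iff)
    also have "\<dots> \<in> sets (Rd d)" unfolding Rd_def by (intro sets_PiM_I_finite) auto
    finally show ?thesis by (simp add: distributionsD(2)[OF P])
  qed
  have E_sets: "E k \<in> sets P" for k unfolding E_def using ip_borel by measurable
  have pE: "prob (E k) = p" for k
  proof -
    have un: "lp_norm d (ereal \<alpha>) (u k) > 0" using d \<alpha> by (intro lp_norm_pos[of _ 0]) (auto simp: u_def)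
    have "prob (E k) = prob {x\<in>space P. lp_norm d (ereal \<alpha>) (u k) * x 0 \<in> {0}}"
      unfolding E_def using prob_proj[of "lp_norm d (ereal \<alpha>) (u k)" "u k" "{0}"] un by simp
    then show ?thesis using un by (simp add: p_def)
  qed
  have count: "card {k. k < m \<and> x \<in> E k} \<le> d" if x: "x \<in> space P" "x \<noteq> ?z" for x m
  proof -
    have "\<exists>i<d. x i \<noteq> 0"
    proof (rule ccontr)
      assume "\<not> ?thesis"
      then have "x = ?z" using x(1) distributionsD(3)[OF P] by (auto simp: space_Rd PiE_iff extensional_def fun_eq_iff)
      then show False using x(2) by simp
    qed
    then obtain i where i: "i < d" "x i \<noteq> 0" by blast
    (* x lies in E k iff k is a root of this polynomial *)
    define q where "q = (\<Sum>j<d. monom (x j) j)"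
    have "coeff q i = x i" unfolding q_def using i by (simp add: coeff_sum)
    then have q: "q \<noteq> 0" using i by auto
    have "degree q \<le> d" unfolding q_def by (intro degree_sum_le) (auto intro: order_trans[OF degree_monom_le])
    have root: "poly q (real k) = 0" if "x \<in> E k" for k
      using that by (simp add: q_def poly_sum poly_monom E_def ip_def u_def)
    have "card {k. k < m \<and> x \<in> E k} = card (real ` {k. k < m \<and> x \<in> E k})"
      by (rule card_image[symmetric]) simp
    also have "\<dots> \<le> card {y. poly q y = 0}" using root poly_roots_finite[OF q] by (intro card_mono) auto
    also have "\<dots> \<le> degree q" using q by (rule card_poly_roots_bound)
    finally show ?thesis using \<open>degree q \<le> d\<close> by simp
  qed
  have "real m * p \<le> real d" for m :: nat
  proof -
    have "real m * p = (\<Sum>k<m. prob (E k))" by (simp add: pE)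
    also have "\<dots> = (\<Sum>k<m. \<integral>x. indicator (E k) x \<partial>P)" using E_sets by simp
    also have "\<dots> = (\<integral>x. (\<Sum>k<m. indicator (E k) x) \<partial>P)"
      using E_sets by (intro Bochner_Integration.integral_sum[symmetric] integrable_real_indicator) (auto simp: less_top[symmetric])
    also have "\<dots> \<le> (\<integral>x. real d + real m * indicator {?z} x \<partial>P)"
    proof (rule integral_mono)
      show "integrable P (\<lambda>x. \<Sum>k<m. indicator (E k) x :: real)"
        using E_sets by (intro Bochner_Integration.integrable_sum integrable_real_indicator) (auto simp: less_top[symmetric])
      show "integrable P (\<lambda>x. real d + real m * indicator {?z} x)"
        using z_sets by (intro Bochner_Integration.integrable_add integrable_mult_right integrable_real_indicator) (auto simp: less_top[symmetric])
      fix x assume x: "x \<in> space P"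
      have "(\<Sum>k<m. indicator (E k) x :: real) = card {k. k < m \<and> x \<in> E k}"
        using sum_indicator_card[of "{k. x \<in> E k}" "\<lambda>k. k" m] by (simp add: indicator_def)
      also have "\<dots> \<le> real d + real m * indicator {?z} x"
      proof (cases "x = ?z")
        case True
        have "card {k. k < m \<and> x \<in> E k} \<le> m" using card_mono[of "{..<m}" "{k. k < m \<and> x \<in> E k}"] by auto
        then show ?thesis using True by simp
      next
        case False then show ?thesis using count[OF x False] by simp
      qed
      finally show "(\<Sum>k<m. indicator (E k) x) \<le> real d + real m * indicator {?z} x" .
    qed
    also have "\<dots> = real d + real m * prob {?z}"
      using z_sets by (subst Bochner_Integration.integral_add) (auto simp: prob_space less_top[symmetric])
    finally show ?thesis by (simp add: 0)
  qed
  then have "p \<le> 0"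
    using reals_Archimedean3[of p] by (meson not_le)
  then show ?thesis using measure_nonneg[of P] by (simp add: p_def measure_le_0_iff)
qed

text \<open>
  The first marginal is symmetric and has no atom at \<open>0\<close>.
\<close>

lemma F_zero:
  assumes "prob {\<lambda>i\<in>{..<d}. 0} = 0"
  shows "F 0 = 1 / 2"
proof -
  have m: "{x\<in>space P. x 0 \<le> 0} \<in> sets P" "{x\<in>space P. x 0 \<ge> 0} \<in> sets P" "{x\<in>space P. x 0 = 0} \<in> sets P"
    using first_coord_borel by measurable
  let ?e = "\<lambda>i\<in>{..<d}. 1 * unit_vec 0 i"
  have n: "lp_norm d (ereal \<alpha>) ?e = 1" using lp_norm_unit_vec[OF \<alpha>, of d 1] d by simp
  have "prob {x\<in>space P. 1 * x 0 \<in> {..0}} = prob {x\<in>space P. (-1) * x 0 \<in> {..0}}"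
    using prob_proj[of 1 ?e "{..0}"] prob_proj[of "-1" ?e "{..0}"] n by simp
  then have "prob {x\<in>space P. x 0 \<le> 0} = prob {x\<in>space P. x 0 \<ge> 0}" by simp
  moreover have "prob ({x\<in>space P. x 0 \<le> 0} \<union> {x\<in>space P. x 0 \<ge> 0})
      = prob {x\<in>space P. x 0 \<le> 0} + prob {x\<in>space P. x 0 \<ge> 0} - prob ({x\<in>space P. x 0 \<le> 0} \<inter> {x\<in>space P. x 0 \<ge> 0})"
    using m by (simp add: finite_measure_Union') (simp add: finite_measure_Diff' Int_commute)
  moreover have "{x\<in>space P. x 0 \<le> 0} \<union> {x\<in>space P. x 0 \<ge> 0} = space P" by auto
  moreover have "{x\<in>space P. x 0 \<le> 0} \<inter> {x\<in>space P. x 0 \<ge> 0} = {x\<in>space P. x 0 = 0}" by auto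
  ultimately have "1 = 2 * prob {x\<in>space P. x 0 \<le> 0}" using no_atom[OF assms] by (simp add: prob_space)
  then show ?thesis by (simp add: F_eq)
qed

end

section \<open>The error of the sample median\<close>

lemma measure_mixture:
  assumes P: "P \<in> distributions d" and Q: "Q \<in> distributions d" and \<epsilon>: "0 \<le> \<epsilon>" "\<epsilon> \<le> 1" and B: "B \<in> sets P"
  shows "measure (mixture \<epsilon> P Q) B = (1 - \<epsilon>) * measure P B + \<epsilon> * measure Q B"
proof -
  interpret P: prob_space P using distributionsD[OF P] by simp
  interpret Q: prob_space Q using distributionsD[OF Q] by simp
  have s: "sets Q = sets P" using distributionsD(2)[OF P] distributionsD(2)[OF Q] by simp
  have "emeasure (mixture \<epsilon> P Q) B = ennreal ((1 - \<epsilon>) * measure P B + \<epsilon> * measure Q B)"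
    using \<epsilon> by (simp add: emeasure_mixture[OF s B] P.emeasure_eq_measure Q.emeasure_eq_measure ennreal_mult[symmetric]
        flip: ennreal_plus)
  then show ?thesis using \<epsilon> by (intro measure_eq_emeasure_eq_ennreal) auto
qed

locale symmetric_population = alpha_sym +
  fixes \<gamma> \<kappa> :: real
  assumes \<gamma>: "\<gamma> > 0" and \<kappa>: "\<kappa> > 0" and no_mass_at_origin: "prob {\<lambda>i\<in>{..<d}. 0} = 0"
    and growth: "\<kappa> \<le> (INF t\<in>{t. 0 < \<bar>t\<bar> \<and> \<bar>t\<bar> < \<gamma>}. \<bar>first_marginal_cdf P t - first_marginal_cdf P 0\<bar> / \<bar>t\<bar>)"
begin

lemma F_growth:
  assumes t: "0 < t" "t < \<gamma>"
  shows "F (- t) \<le> 1 / 2 - \<kappa> * t"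
proof -
  have "(INF t\<in>{t. 0 < \<bar>t\<bar> \<and> \<bar>t\<bar> < \<gamma>}. \<bar>first_marginal_cdf P t - first_marginal_cdf P 0\<bar> / \<bar>t\<bar>)
      \<le> \<bar>first_marginal_cdf P (- t) - first_marginal_cdf P 0\<bar> / \<bar>- t\<bar>"
    using t by (intro cINF_lower bdd_belowI[of _ 0]) auto
  then have "\<kappa> \<le> \<bar>F (- t) - F 0\<bar> / t" using growth t by (simp add: F_def)
  then have "\<kappa> * t \<le> \<bar>F (- t) - F 0\<bar>" using t by (simp add: pos_le_divide_eq)
  moreover have "F (- t) \<le> F 0" using t by (intro F_mono) simp
  ultimately show ?thesis using F_zero[OF no_mass_at_origin] by simp
qed

text \<open>
  The growth condition is only available within \<open>\<gamma>\<close> of \<open>0\<close>; monotonicity of \<open>F\<close> extends its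
  consequence to all smaller arguments because \<open>\<tau>/\<kappa> < \<gamma>\<close>.
\<close>

lemma quantile_lower_bound:
  assumes v: "1 / 2 - \<tau> \<le> F v" and \<tau>: "0 \<le> \<tau>" "\<tau> < \<gamma> * \<kappa>"
  shows "- (\<tau> / \<kappa>) \<le> v"
proof (rule ccontr)
  assume "\<not> ?thesis"
  then have v1: "\<tau> / \<kappa> < - v" by simp
  have v2: "\<tau> / \<kappa> < \<gamma>" using \<tau> \<kappa> by (simp add: pos_divide_less_eq)
  obtain t where t: "\<tau> / \<kappa> < t" "t < min (- v) \<gamma>" using v1 v2 dense[of "\<tau> / \<kappa>" "min (- v) \<gamma>"] by auto
  have "0 \<le> \<tau> / \<kappa>" using \<tau> \<kappa> by simp
  then have "F (- t) \<le> 1 / 2 - \<kappa> * t" using t by (intro F_growth) auto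
  moreover have "F v \<le> F (- t)" using t by (intro F_mono) simp
  moreover have "\<tau> < \<kappa> * t" using t(1) \<kappa> by (simp add: pos_divide_less_eq mult.commute)
  ultimately show False using v by linarith
qed

lemma direction_lower_bound:
  assumes u: "lp_norm d (ereal \<alpha>) u > 0" and ge: "1 / 2 - \<tau> \<le> prob {y\<in>space P. ip d y u \<le> ip d x u}"
    and \<tau>: "0 \<le> \<tau>" "\<tau> < \<gamma> * \<kappa>"
  shows "- (\<tau> / \<kappa>) * lp_norm d (ereal \<alpha>) u \<le> ip d x u"
proof -
  have "- (\<tau> / \<kappa>) \<le> ip d x u / lp_norm d (ereal \<alpha>) u"
    using ge \<tau> by (intro quantile_lower_bound) (simp_all add: halfspace_prob[OF u])
  then show ?thesis using u by (simp only: pos_le_divide_eq)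
qed

definition origin :: point where "origin = (\<lambda>i\<in>{..<d}. 0)"

lemma ip_origin: "ip d origin u = 0"
  unfolding origin_def ip_restrict by (simp add: ip_def)

lemma sphere_lp_pos: "u \<in> unit_sphere d \<Longrightarrow> lp_norm d (ereal \<alpha>) u > 0"
proof -
  assume u: "u \<in> unit_sphere d"
  have "\<exists>i<d. u i \<noteq> 0"
  proof (rule ccontr)
    assume "\<not> ?thesis"
    then have "ip d u u = 0" by (simp add: ip_def)
    then show False using u by (simp add: unit_sphere_def L2_set_ip)
  qed
  then show ?thesis using lp_norm_pos[OF \<alpha>] by blast
qed

lemma halfspace_prob_origin: "u \<in> unit_sphere d \<Longrightarrow> prob {y\<in>space P. ip d y u \<le> 0} = 1 / 2"
  using halfspace_prob[OF sphere_lp_pos, of u 0] F_zero[OF no_mass_at_origin] by simp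

lemma hdepth_origin: "1 / 2 \<le> hdepth d P origin"
  by (rule hdepth_ge) (use d in \<open>auto simp: ip_origin halfspace_prob_origin\<close>)

lemma hdepth_le_half: "hdepth d P y \<le> 1 / 2"
proof -
  obtain w where w: "ip d y w \<le> 0" "ip d w w > 0"
  proof (cases "ip d y (unit_vec 0) \<le> 0")
    case True
    have "ip d (unit_vec 0) (unit_vec 0) > 0" using d ip_unit_vec[of 0 d "unit_vec 0"] by (simp add: unit_vec_def)
    then show ?thesis using that[of "unit_vec 0"] True by blast
  next
    case False
    have e: "ip d z (\<lambda>i. (-1) * unit_vec 0 i) = - ip d z (unit_vec 0)" for z unfolding ip_scale_right by simp
    have "ip d (unit_vec 0) (unit_vec 0) > 0" using d ip_unit_vec[of 0 d "unit_vec 0"] by (simp add: unit_vec_def)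
    then have "ip d (\<lambda>i. (-1) * unit_vec 0 i) (\<lambda>i. (-1) * unit_vec 0 i) > 0"
      unfolding ip_scale_right ip_scale_left by simp
    moreover have "ip d y (\<lambda>i. (-1) * unit_vec 0 i) \<le> 0" unfolding e using False by simp
    ultimately show ?thesis by (rule that[rotated])
  qed
  have "\<exists>i<d. w i \<noteq> 0"
  proof (rule ccontr)
    assume "\<not> ?thesis"
    then have "ip d w w = 0" by (simp add: ip_def)
    then show False using w(2) by simp
  qed
  then have lp: "lp_norm d (ereal \<alpha>) w > 0" using lp_norm_pos[OF \<alpha>] by blast
  have "hdepth d P y \<le> prob {z\<in>space P. ip d z w \<le> ip d y w}" by (rule hdepth_le_direction[OF w(2)])
  also have "\<dots> = F (ip d y w / lp_norm d (ereal \<alpha>) w)" by (rule halfspace_prob[OF lp])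
  also have "\<dots> \<le> F 0" using w(1) lp by (intro F_mono) (simp add: divide_nonpos_pos)
  finally show ?thesis using F_zero[OF no_mass_at_origin] by simp
qed

text \<open>
  Every halfspace with the origin on its boundary has probability \<open>1/2\<close>, and every other point
  lies on the boundary of a halfspace of smaller probability, by the growth condition with
  \<open>\<tau> = 0\<close>.
\<close>

lemma median_set_population: "median_set d P = {origin}"
proof
  show "{origin} \<subseteq> median_set d P"
  proof -
    have "origin \<in> space (Rd d)" unfolding origin_def by (rule restrict_in_Rd)
    moreover have "hdepth d P y \<le> hdepth d P origin" for y by (rule order_trans[OF hdepth_le_half hdepth_origin])
    ultimately show ?thesis by (simp add: median_set_def)
  qed
  show "median_set d P \<subseteq> {origin}"
  proof
    fix x assume x: "x \<in> median_set d P"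
    have "hdepth d P origin \<le> hdepth d P x" using x by (simp add: median_set_def origin_def)
    then have hx: "1 / 2 \<le> hdepth d P x" using hdepth_origin by linarith
    have nn: "0 \<le> ip d x u" if u: "lp_norm d (ereal \<alpha>) u > 0" "ip d u u > 0" for u
    proof -
      have "1 / 2 - 0 \<le> prob {y\<in>space P. ip d y u \<le> ip d x u}" using hx hdepth_le_direction[OF u(2), of P x] by linarith
      then show ?thesis using direction_lower_bound[OF u(1), of 0 x] \<gamma> \<kappa> by simp
    qed
    have "x i = 0" if i: "i < d" for i
    proof -
      have e: "ip d (unit_vec i) (unit_vec i) = 1" using i ip_unit_vec[OF i, of "unit_vec i"] by (simp add: unit_vec_def)
      have "0 \<le> ip d x (\<lambda>j. c * unit_vec i j)" if c: "c \<noteq> 0" for c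
      proof (rule nn)
        show "lp_norm d (ereal \<alpha>) (\<lambda>j. c * unit_vec i j) > 0" using i c by (intro lp_norm_pos[OF \<alpha> i]) (simp add: unit_vec_def)
        show "ip d (\<lambda>j. c * unit_vec i j) (\<lambda>j. c * unit_vec i j) > 0"
          unfolding ip_scale_left ip_scale_right e using c by (simp add: zero_less_mult_iff linorder_neq_iff disj_commute)
      qed
      then have "0 \<le> c * x i" if "c \<noteq> 0" for c
        using that unfolding ip_scale_right ip_commute[of d x] ip_unit_vec[OF i] by blast
      from this[of 1] this[of "-1"] show ?thesis by simp
    qed
    then have "x = origin" using x by (auto simp: median_set_def origin_def space_Rd PiE_iff extensional_def fun_eq_iff)
    then show "x \<in> {origin}" by simp
  qed
qed

lemma halfspace_median_population:
  assumes i: "i < d"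
  shows "halfspace_median d P i = 0"
proof -
  have o: "origin \<in> space (Rd d)" by (simp add: origin_def)
  interpret convex_body d "{origin}"
  proof unfold_locales
    show "pconvex d {origin}" by (auto simp: pconvex_def origin_def)
    show "\<exists>R. \<forall>x\<in>{origin}. \<forall>i<d. \<bar>x i\<bar> \<le> R" by (auto simp: origin_def)
    show "x \<in> {origin}" if x: "x \<in> space (Rd d)" and e: "\<And>e. e > 0 \<Longrightarrow> \<exists>z\<in>{origin}. sqdist d x z < e" for x
    proof -
      have "sqdist d x origin \<le> 0" by (rule field_le_epsilon) (use e in \<open>force intro: less_imp_le\<close>)
      then have "(x i - origin i)\<^sup>2 \<le> 0" if "i < d" for i using sqdist_coord[OF that, of x origin] by linarith
      then have "x i = 0" if "i < d" for i using that by (simp add: origin_def)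
      then show ?thesis using x by (auto simp: origin_def space_Rd PiE_iff extensional_def fun_eq_iff)
    qed
    show "nbhd d {origin} r \<in> sets (Rd d)" for r
    proof -
      have "(\<lambda>x. sqdist d x origin) \<in> borel_measurable (Rd d)"
        unfolding sqdist_def by (intro borel_measurable_sum borel_measurable_power borel_measurable_diff) auto
      then have "{x\<in>space (Rd d). sqdist d x origin \<le> r\<^sup>2} \<in> sets (Rd d)" by measurable
      then show ?thesis by (simp add: nbhd_def)
    qed
  qed (use o in auto)
  have "c * barycenter d {origin} i \<ge> 0" for c
  proof -
    have "ip d (barycenter d {origin}) (\<lambda>j. c * unit_vec i j) \<ge> 0"
      by (rule barycenter_halfspace) (simp add: ip_origin)
    then show ?thesis unfolding ip_scale_right ip_commute[of d _ "unit_vec i"] ip_unit_vec[OF i] .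
  qed
  from this[of 1] this[of "-1"] show ?thesis by (simp add: halfspace_median_def median_set_population)
qed

text \<open>
  The deterministic core: the origin has depth at least \<open>(1 - \<epsilon>)/2 - \<Delta>\<close> in the sample, so the
  deepest points do too. Moving from the sample to the mixture costs another \<open>\<Delta>\<close>, and from the
  mixture to \<open>P\<close> at most \<open>\<epsilon>\<close>. This bounds every deepest point in every direction, hence the
  barycenter, and finally its dual norm.
\<close>

theorem median_error_on_deviation_event:
  assumes Q: "Q \<in> distributions d" and \<epsilon>: "0 \<le> \<epsilon>" "\<epsilon> < 1" and n: "1 \<le> n" and X: "\<And>i. i < n \<Longrightarrow> X i \<in> space (Rd d)"
    and dev: "\<And>u t. \<bar>emp_frac d n X u t - measure (mixture \<epsilon> P Q) {y \<in> space (mixture \<epsilon> P Q). ip d y u \<le> t}\<bar> \<le> \<Delta>"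
    and \<tau>: "(\<epsilon> + 2 * \<Delta>) / (1 - \<epsilon>) < \<gamma> * \<kappa>"
  shows "lp_norm d (conj_exponent \<alpha>) (\<lambda>i. halfspace_median d (empirical d n X) i - halfspace_median d P i)
     \<le> (\<epsilon> + 2 * \<Delta>) / (1 - \<epsilon>) / \<kappa>"
proof -
  define \<tau>' where "\<tau>' = (\<epsilon> + 2 * \<Delta>) / (1 - \<epsilon>)"
  have \<Delta>: "0 \<le> \<Delta>" using dev[of undefined undefined] abs_ge_zero order_trans by blast
  have \<tau>0: "0 \<le> \<tau>'" using \<epsilon> \<Delta> by (simp add: \<tau>'_def)
  interpret Q: prob_space Q using distributionsD[OF Q] by simp
  have d1: "1 \<le> d" using d by simp
  define h where "h u t = {y \<in> space P. ip d y u \<le> t}" for u t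
  have hs: "h u t \<in> sets P" for u t unfolding h_def by (rule halfspace_in_sets[OF distributionsD(2)[OF P]])
  have mix: "measure (mixture \<epsilon> P Q) {y \<in> space (mixture \<epsilon> P Q). ip d y u \<le> t} = (1 - \<epsilon>) * prob (h u t) + \<epsilon> * Q.prob (h u t)" for u t
    using measure_mixture[OF P Q _ _ hs] \<epsilon> by (simp add: h_def)
  have lower: "(1 - \<epsilon>) * prob (h u t) - \<Delta> \<le> emp_frac d n X u t" for u t
  proof -
    have "0 \<le> \<epsilon> * Q.prob (h u t)" using \<epsilon> by simp
    then show ?thesis using dev[of u t] unfolding mix abs_le_iff by linarith
  qed
  have upper: "emp_frac d n X u t \<le> (1 - \<epsilon>) * prob (h u t) + \<epsilon> + \<Delta>" for u t
  proof -
    have "\<epsilon> * Q.prob (h u t) \<le> \<epsilon>" using \<epsilon> by (simp add: mult_left_le)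
    then show ?thesis using dev[of u t] unfolding mix abs_le_iff by linarith
  qed
  obtain m where m: "m \<in> {1..n}" "top_level d n X m"
    using top_level_exists[OF n, of X d] X[of 0] n by auto
  have "(1 - \<epsilon>) / 2 - \<Delta> \<le> hdepth d (empirical d n X) origin"
  proof (rule hdepth_ge[OF d1])
    fix u assume u: "u \<in> unit_sphere d"
    have "(1 - \<epsilon>) * prob (h u 0) = (1 - \<epsilon>) / 2" unfolding h_def halfspace_prob_origin[OF u] by simp
    then have "(1 - \<epsilon>) / 2 - \<Delta> \<le> emp_frac d n X u 0" using lower[of u 0] by (simp only:)
    then show "(1 - \<epsilon>) / 2 - \<Delta> \<le> measure (empirical d n X) {y \<in> space (empirical d n X). ip d y u \<le> ip d origin u}"
      by (simp only: ip_origin empirical_measure[OF n X])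
  qed
  also have "\<dots> \<le> real m / n"
    using m by (intro hdepth_empirical_le d1 n X) (auto simp: top_level_def origin_def)
  finally have mge: "(1 - \<epsilon>) / 2 - \<Delta> \<le> real m / n" .
  interpret convex_body d "level_set d n X m"
    using m by (intro level_set_convex_body) (auto simp: top_level_def)
  let ?med = "halfspace_median d (empirical d n X)"
  have med: "?med = barycenter d (level_set d n X m)"
    unfolding halfspace_median_def by (subst median_set_empirical[OF d1 n X m]) auto
  have bound: "- (\<tau>' / \<kappa>) * lp_norm d (ereal \<alpha>) u \<le> ip d ?med u" if u: "lp_norm d (ereal \<alpha>) u > 0" for u
    unfolding med
  proof (rule barycenter_halfspace)
    fix x assume x: "x \<in> level_set d n X m"
    have "real m / n \<le> emp_frac d n X u (ip d x u)"
      using x n by (auto simp: emp_frac_def level_set_def intro!: divide_right_mono)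
    then have "(1 - \<epsilon>) / 2 - \<Delta> \<le> (1 - \<epsilon>) * prob (h u (ip d x u)) + \<epsilon> + \<Delta>"
      using mge upper[of u "ip d x u"] by linarith
    then have "(1 - \<epsilon>) * (1 / 2 - prob (h u (ip d x u))) \<le> \<epsilon> + 2 * \<Delta>" by (simp add: algebra_simps)
    then have "1 / 2 - prob (h u (ip d x u)) \<le> \<tau>'" using \<epsilon> by (simp add: \<tau>'_def pos_le_divide_eq mult.commute)
    then show "- (\<tau>' / \<kappa>) * lp_norm d (ereal \<alpha>) u \<le> ip d x u"
      using \<tau> \<tau>0 by (intro direction_lower_bound[OF u]) (simp_all add: h_def \<tau>'_def)
  qed
  let ?x = "\<lambda>i. ?med i - halfspace_median d P i"
  obtain u where u: "lp_norm d (ereal \<alpha>) u > 0 \<or> lp_norm d (conj_exponent \<alpha>) ?x = 0"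
    "ip d ?x u = - (lp_norm d (conj_exponent \<alpha>) ?x * lp_norm d (ereal \<alpha>) u)"
    using dual_direction[OF \<alpha> d1, of ?x] by blast
  have ipx: "ip d ?x u = ip d ?med u" by (rule ip_cong) (simp_all add: halfspace_median_population)
  show ?thesis
  proof (cases "lp_norm d (conj_exponent \<alpha>) ?x = 0")
    case True
    moreover have "0 \<le> \<tau>' / \<kappa>" using \<tau>0 \<kappa> by simp
    ultimately show ?thesis unfolding \<tau>'_def by (simp only:)
  next
    case False
    then have up: "lp_norm d (ereal \<alpha>) u > 0" using u(1) by simp
    have "lp_norm d (conj_exponent \<alpha>) ?x * lp_norm d (ereal \<alpha>) u \<le> (\<tau>' / \<kappa>) * lp_norm d (ereal \<alpha>) u"
      using bound[OF up] u(2) ipx by simp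
    then have "lp_norm d (conj_exponent \<alpha>) ?x \<le> \<tau>' / \<kappa>" using up by (simp only: mult_le_cancel_right_pos)
    then show ?thesis by (simp add: \<tau>'_def)
  qed
qed

end

text \<open>
  Crude numerical bounds for the two constants, sufficient to cover three times the deviation
  bound.
\<close>

section \<open>Constants and conclusion\<close>

lemma C1_ge: "75 \<le> C1"
proof -
  have e: "1 \<le> exp (1::real)" "0 < 1 - exp (-1::real)" "1 - exp (-1::real) \<le> 1" by auto
  have "60 * 3 * 1 \<le> 60 * pi * exp (1::real)" using pi_gt3 e(1) by (intro mult_mono) auto
  also have "\<dots> \<le> 60 * pi * exp 1 / (1 - exp (-1))"
    using e by (simp add: pos_le_divide_eq mult_left_le)
  finally have "4\<^sup>2 \<le> 60 * pi * exp 1 / (1 - exp (-1::real))" by simp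
  then have "4 \<le> sqrt (60 * pi * exp 1 / (1 - exp (-1)))" by (rule real_le_rsqrt)
  then show ?thesis by (simp add: C1_def)
qed

lemma C2_ge: "3 * sqrt 2 \<le> C2"
proof -
  have "sqrt 2 \<le> sqrt 6" by simp
  moreover have "0 \<le> sqrt (2 :: real)" by simp
  moreover have "3 * a \<le> (9 * a + 4 * b) / 4" if "a \<le> b" "0 \<le> a" for a b :: real using that by simp
  ultimately show ?thesis unfolding C2_def by blast
qed

text \<open>
  The dimension enters the deviation bound through \<open>d + 1 \<le> (5/4)\<^sup>2 d\<close>, and \<open>3 \<cdot> 20 \<cdot> 5/4 = 75\<close>.
\<close>

lemma deviation_le_constants:
  fixes \<epsilon> l :: real
  assumes d: "2 \<le> d" and n: "1 \<le> n" and l: "0 \<le> l"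
  defines "\<Delta> \<equiv> 20 * sqrt (real (d + 1) / n) + sqrt (2 * l / n)"
  shows "0 \<le> \<Delta>" "3 * \<Delta> \<le> 75 * sqrt (real d / real n) + 3 * sqrt 2 * sqrt (l / real n)"
    "3 * \<Delta> \<le> C1 * sqrt (real d / real n) + C2 * sqrt (l / real n)"
proof -
  show "0 \<le> \<Delta>" using l by (simp add: \<Delta>_def)
  have "real (d + 1) / n \<le> (5/4)\<^sup>2 * (real d / n)"
  proof -
    have "real (d + 1) \<le> (5/4)\<^sup>2 * real d" using d by (simp add: power2_eq_square)
    then show ?thesis using divide_right_mono[of "real (d + 1)" "(5/4)\<^sup>2 * real d" "real n"] by simp
  qed
  then have "sqrt (real (d + 1) / n) \<le> sqrt ((5/4)\<^sup>2 * (real d / n))" by (rule real_sqrt_le_mono)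
  also have "\<dots> = 5/4 * sqrt (real d / n)" by (simp only: real_sqrt_mult real_sqrt_abs abs_divide abs_numeral)
  finally have a: "sqrt (real (d + 1) / n) \<le> 5/4 * sqrt (real d / n)" .
  have b: "sqrt (2 * l / n) = sqrt 2 * sqrt (l / n)" by (simp only: times_divide_eq_right[symmetric] real_sqrt_mult)
  show m: "3 * \<Delta> \<le> 75 * sqrt (real d / real n) + 3 * sqrt 2 * sqrt (l / real n)"
  proof -
    have "3 * (20 * x + y) \<le> 75 * w + 3 * y" if "x \<le> 5 / 4 * w" for x y w :: real using that by simp
    from this[OF a, of "sqrt 2 * sqrt (l / n)"] show ?thesis unfolding \<Delta>_def b by (simp only: mult.assoc)
  qed
  also have "\<dots> \<le> C1 * sqrt (real d / real n) + C2 * sqrt (l / real n)"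
    using C1_ge C2_ge l by (intro add_mono mult_right_mono) auto
  finally show "3 * \<Delta> \<le> C1 * sqrt (real d / real n) + C2 * sqrt (l / real n)" .
qed

theorem theorem4:
  fixes \<alpha> \<gamma> \<kappa> :: real
  assumes "\<alpha> > 0" and "\<gamma> > 0" and "\<kappa> > 0" and "\<gamma> * \<kappa> \<le> 1 / 2"
  shows "\<exists>C>0. \<forall>d\<ge>2. \<forall>\<epsilon>\<in>{0<..<1/3}. \<forall>\<delta>\<in>{0<..<1/2}. \<forall>n\<ge>1.
    \<epsilon> / (1 - \<epsilon>) < \<gamma> * \<kappa> \<longrightarrow>
    C1 * sqrt (real d / real n) + C2 * sqrt (ln (1 / \<delta>) / real n) < \<gamma> * \<kappa> - \<epsilon> / (1 - \<epsilon>) \<longrightarrow>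
    (INF (P, Q) \<in> symmetric_class d \<alpha> \<gamma> \<kappa> \<times> distributions d.
       emeasure (sample_law n (mixture \<epsilon> P Q))
         {X \<in> space (sample_law n (mixture \<epsilon> P Q)).
            lp_norm d (conj_exponent \<alpha>)
              (\<lambda>i. halfspace_median d (empirical d n X) i - halfspace_median d P i)
            \<le> C * (\<epsilon> + sqrt (real d / real n) + sqrt (ln (1 / \<delta>) / real n))})
      \<ge> ennreal (1 - 2 * \<delta>)"
proof (intro exI[of _ "75 / \<kappa>"] conjI allI ballI impI)
  show "0 < 75 / \<kappa>" using assms by simp
next
  fix d n :: nat and \<epsilon> \<delta> :: real
  assume d: "2 \<le> d" and \<epsilon>: "\<epsilon> \<in> {0<..<1/3}" and \<delta>: "\<delta> \<in> {0<..<1/2}" and n: "1 \<le> n"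
    and cond: "C1 * sqrt (real d / real n) + C2 * sqrt (ln (1 / \<delta>) / real n) < \<gamma> * \<kappa> - \<epsilon> / (1 - \<epsilon>)"
  define l where "l = ln (1 / \<delta>)"
  have l: "0 \<le> l" using \<delta> by (simp add: l_def)
  define \<Delta> where "\<Delta> = 20 * sqrt (real (d + 1) / n) + sqrt (2 * l / n)"
  note \<Delta> = deviation_le_constants[OF d n l, folded \<Delta>_def]
  define \<tau> where "\<tau> = (\<epsilon> + 2 * \<Delta>) / (1 - \<epsilon>)"
  have \<epsilon>1: "2 / 3 \<le> 1 - \<epsilon>" "0 < \<epsilon>" using \<epsilon> by auto
  (* As epsilon < 1/3, dividing 2 Delta by 1 - epsilon gives at most 3 Delta. *)
  have "3 * \<Delta> * (2 / 3) \<le> 3 * \<Delta> * (1 - \<epsilon>)" using \<epsilon>1 \<Delta>(1) by (intro mult_left_mono) auto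
  then have "2 * \<Delta> / (1 - \<epsilon>) \<le> 3 * \<Delta>" using \<epsilon>1 by (simp add: pos_divide_le_eq)
  then have \<tau>: "\<tau> \<le> \<epsilon> / (1 - \<epsilon>) + 3 * \<Delta>" by (simp add: \<tau>_def add_divide_distrib)
  have small: "\<tau> < \<gamma> * \<kappa>" using \<tau> \<Delta>(3) cond unfolding l_def by linarith
  have "\<epsilon> * 1 \<le> \<epsilon> * (2 * (1 - \<epsilon>))" using \<epsilon>1 by (intro mult_left_mono) auto
  then have "\<epsilon> / (1 - \<epsilon>) \<le> 2 * \<epsilon>" using \<epsilon>1 by (simp add: pos_divide_le_eq mult_ac)
  moreover have "3 * sqrt 2 \<le> 75" using real_sqrt_le_mono[of 2 4] by simp
  then have "3 * sqrt 2 * sqrt (l / n) \<le> 75 * sqrt (l / n)" using l by (intro mult_right_mono) auto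
  ultimately have "\<epsilon> / (1 - \<epsilon>) + 3 * \<Delta> \<le> 75 * \<epsilon> + (75 * sqrt (real d / n) + 75 * sqrt (l / n))"
    using \<epsilon>1(2) by (intro add_mono order_trans[OF \<Delta>(2)] order_refl) auto
  with \<tau> have "\<tau> \<le> 75 * (\<epsilon> + sqrt (real d / n) + sqrt (l / n))" by simp
  then have rate: "\<tau> / \<kappa> \<le> 75 / \<kappa> * (\<epsilon> + sqrt (real d / n) + sqrt (l / n))"
    using assms divide_right_mono[of \<tau> _ \<kappa>] by simp
  show "ennreal (1 - 2 * \<delta>) \<le> (INF (P, Q) \<in> symmetric_class d \<alpha> \<gamma> \<kappa> \<times> distributions d.
       emeasure (sample_law n (mixture \<epsilon> P Q))
         {X \<in> space (sample_law n (mixture \<epsilon> P Q)).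
            lp_norm d (conj_exponent \<alpha>)
              (\<lambda>i. halfspace_median d (empirical d n X) i - halfspace_median d P i)
            \<le> 75 / \<kappa> * (\<epsilon> + sqrt (real d / real n) + sqrt (ln (1 / \<delta>) / real n))})"
  proof (rule INF_greatest, clarify)
    fix P Q assume PA: "P \<in> symmetric_class d \<alpha> \<gamma> \<kappa>" and Q: "Q \<in> distributions d"
    interpret symmetric_population d \<alpha> P \<gamma> \<kappa>
      by unfold_locales (use PA d assms in \<open>auto simp: symmetric_class_def\<close>)
    let ?M = "mixture \<epsilon> P Q"
    have M: "?M \<in> distributions d" using \<epsilon> by (intro mixture_in_distributions P Q) auto
    interpret M: prob_space ?M using distributionsD[OF M] by simp
    interpret L: prob_space "sample_law n ?M" unfolding sample_law_def by (intro prob_space_PiM M.prob_space_axioms)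
    have \<delta>1: "0 < \<delta>" "\<delta> < 1" using \<delta> by auto
    obtain G where G: "G \<in> sets (sample_law n ?M)" "L.prob G \<ge> 1 - 2 * \<delta>"
      "\<And>X u t. X \<in> G \<Longrightarrow> \<bar>emp_frac d n X u t - M.prob {y \<in> space ?M. ip d y u \<le> t}\<bar> \<le> \<Delta>"
      using uniform_halfspace_deviation[OF M n \<delta>1] unfolding \<Delta>_def l_def by blast
    let ?E = "{X \<in> space (sample_law n ?M). lp_norm d (conj_exponent \<alpha>)
              (\<lambda>i. halfspace_median d (empirical d n X) i - halfspace_median d P i)
            \<le> 75 / \<kappa> * (\<epsilon> + sqrt (real d / real n) + sqrt (ln (1 / \<delta>) / real n))}"
    have E: "?E \<in> sets (sample_law n ?M)" using d by (intro median_error_event_measurable M n) simp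
    have "G \<subseteq> ?E"
    proof
      fix X assume X: "X \<in> G"
      then have Xs: "X \<in> space (sample_law n ?M)" using G(1) sets.sets_into_space by blast
      then have Xi: "X i \<in> space (Rd d)" if "i < n" for i
        using that distributionsD(3)[OF M] by (auto simp: sample_law_def space_PiM)
      have "lp_norm d (conj_exponent \<alpha>) (\<lambda>i. halfspace_median d (empirical d n X) i - halfspace_median d P i) \<le> \<tau> / \<kappa>"
        unfolding \<tau>_def
        by (rule median_error_on_deviation_event[OF Q _ _ n Xi G(3)[OF X]]) (use \<epsilon> small in \<open>auto simp: \<tau>_def\<close>)
      then show "X \<in> ?E" using Xs rate unfolding l_def by simp
    qed
    then have "L.prob G \<le> L.prob ?E" using E by (intro L.finite_measure_mono)
    then have "1 - 2 * \<delta> \<le> L.prob ?E" using G(2) by linarith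
    then show "ennreal (1 - 2 * \<delta>) \<le> emeasure (sample_law n ?M) ?E"
      by (simp only: L.emeasure_eq_measure ennreal_leI)
  qed
qed

end
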